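(* Let $m\ge 0$, let $(s_{1,1},\ldots,s_{1,m})=\mathcal N(\sigma_1,\ldots,\sigma_m)$ be a Nikishin system and let $\mathbf n=(n_0,\ldots,n_m)\in\mathbb Z_+^{m+1}$. Then there exist a permutation $\lambda$ of $(0,\ldots,m)$ which reorders the components of $\mathbf n$ decreasingly, $n_{\lambda(0)}\ge\cdots\ge n_{\lambda(m)}$, and an associated Nikishin system $S(\lambda)=(r_{1,1},\ldots,r_{1,m})=\mathcal N(\rho_1,\ldots,\rho_m)$ such that for any real polynomials $p_k$, $\deg p_k\le n_k-1$, $k=0,\ldots,m$, there exist real polynomials $q_k$, $\deg q_k\le n_{\lambda(k)}-1$, $k=0,\ldots,m$, such that $$p_0+\sum_{k=1}^m p_k\,\widehat s_{1,k}=\Bigl(q_0+\sum_{k=1}^m q_k\,\widehat r_{1,k}\Bigr)\widehat s_{1,\lambda(0)}$$ (an identity between analytic functions off the convex hulls of the supports of the measures involved), where $\widehat s_{1,0}$ denotes the function identically equal to $1$.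
   Context: For a bounded interval $\Delta\subset\mathbb R$, $\mathcal M(\Delta)$ is the class of finite Borel measures $s$ of constant sign (positive or negative) on $\mathbb R$ whose support is compact and infinite and such that $\Delta=\mathrm{Co}(\mathrm{supp}\,s)$ (convex hull). The Cauchy transform is $\widehat s(z)=\int\frac{ds(x)}{z-x}$. If $\Delta_\alpha\cap\Delta_\beta=\emptyset$, $\sigma_\alpha\in\mathcal M(\Delta_\alpha)$, $\sigma_\beta\in\mathcal M(\Delta_\beta)$, then $d\langle\sigma_\alpha,\sigma_\beta\rangle(x)=\widehat\sigma_\beta(x)\,d\sigma_\alpha(x)$. Nikishin system: given $\sigma_j\in\mathcal M(\Delta_j)$, $j=1,\ldots,m$, with $\Delta_j\cap\Delta_{j+1}=\emptyset$ for consecutive $j$, put $s_{j,j}=\sigma_j$ and $s_{j,k}=\langle\sigma_j,\ldots,\sigma_k\rangle=\langle\sigma_j,\langle\sigma_{j+1},\ldots,\sigma_k\rangle\rangle$ for $j<k$; then $\mathcal N(\sigma_1,\ldots,\sigma_m)=(s_{1,1},\ldots,s_{1,m})$ (empty if $m=0$). In the same way $r_{1,k}=\langle\rho_1,\ldots,\rho_k\rangle$. A real polynomial is one with real coefficients; $\deg p\le-1$ means $p\equiv0$; $\mathbb Z_+=\{0,1,2,\ldots\}$. *)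

theory Defs
  imports "HOL-Analysis.Analysis" "HOL-Computational_Algebra.Polynomial"
    "HOL-Combinatorics.Permutations"
begin

text \<open>A Borel measure of constant sign on the real line is encoded as a pair \<open>(e, M)\<close> standing
  for the signed measure \<open>e * M\<close>, where \<open>e\<close> is \<open>1\<close> or \<open>-1\<close> and \<open>M\<close> is a positive Borel measure
  (both requirements are part of \<open>const_sign_measures\<close> below).\<close>

type_synonym sgn_measure = "real \<times> real measure"

definition sm_value :: "sgn_measure \<Rightarrow> real set \<Rightarrow> real" where
  "sm_value s A = fst s * measure (snd s) A"

definition sm_integral ::
    "sgn_measure \<Rightarrow> (real \<Rightarrow> 'a) \<Rightarrow> 'a::{banach, second_countable_topology}" where
  "sm_integral s f = fst s *\<^sub>R (\<integral>x. f x \<partial>(snd s))"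

definition sm_supp :: "sgn_measure \<Rightarrow> real set" where
  "sm_supp s = {x. \<forall>U. open U \<longrightarrow> x \<in> U \<longrightarrow> emeasure (snd s) U > 0}"

definition const_sign_measures :: "real set \<Rightarrow> sgn_measure set" where
  "const_sign_measures \<Delta> = {s. (fst s = 1 \<or> fst s = -1) \<and>
     finite_measure (snd s) \<and> sets (snd s) = sets borel \<and>
     compact (sm_supp s) \<and> infinite (sm_supp s) \<and> \<Delta> = convex hull (sm_supp s)}"

text \<open>Used at complex arguments for the analytic function, and at real arguments (outside the
  convex hull of the support) for the real density in the product of two measures.\<close>

definition cauchy_transform ::
    "sgn_measure \<Rightarrow> 'a \<Rightarrow> 'a::{banach, second_countable_topology, real_normed_field}" where
  "cauchy_transform s z = sm_integral s (\<lambda>x. 1 / (z - of_real x))"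

text \<open>The measure with density \<open>f\<close> with respect to \<open>s\<close>, meaningful if \<open>f\<close> is integrable and of
  constant sign almost everywhere; then the sign of \<open>f\<close> is moved to the first component
  (see the lemma following the definition).\<close>

definition sm_density :: "(real \<Rightarrow> real) \<Rightarrow> sgn_measure \<Rightarrow> sgn_measure" where
  "sm_density f s =
     ((if (AE x in snd s. 0 \<le> f x) then fst s else - fst s),
      density (snd s) (\<lambda>x. ennreal \<bar>f x\<bar>))"

lemma sm_value_sm_density:
  assumes f: "integrable (snd s) f"
    and sgn: "(AE x in snd s. 0 \<le> f x) \<or> (AE x in snd s. f x \<le> 0)"
    and A: "A \<in> sets (snd s)"
  shows "sm_value (sm_density f s) A = sm_integral s (\<lambda>x. indicator A x * f x)"
proof -
  define M where "M = snd s"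
  have fM: "integrable M f" and AM: "A \<in> sets M"
    using f A by (simp_all add: M_def)
  have int: "integrable M (\<lambda>x. indicator A x * \<bar>f x\<bar>)"
    using integrable_mult_indicator[OF AM integrable_abs[OF fM]] by simp
  have "emeasure (density M (\<lambda>x. ennreal \<bar>f x\<bar>)) A = (\<integral>\<^sup>+x. ennreal \<bar>f x\<bar> * indicator A x \<partial>M)"
    using fM AM by (intro emeasure_density) auto
  also have "\<dots> = (\<integral>\<^sup>+x. ennreal (indicator A x * \<bar>f x\<bar>) \<partial>M)"
    by (intro nn_integral_cong) (auto simp: indicator_def)
  also have "\<dots> = ennreal (\<integral>x. indicator A x * \<bar>f x\<bar> \<partial>M)"
    by (intro nn_integral_eq_integral int) auto
  finally have meas: "measure (density M (\<lambda>x. ennreal \<bar>f x\<bar>)) A = (\<integral>x. indicator A x * \<bar>f x\<bar> \<partial>M)"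
    by (simp add: measure_def)
  show ?thesis
  proof (cases "AE x in M. 0 \<le> f x")
    case True
    have "(\<integral>x. indicator A x * \<bar>f x\<bar> \<partial>M) = (\<integral>x. indicator A x * f x \<partial>M)"
      using True fM AM by (intro integral_cong_AE) auto
    with True[unfolded M_def] meas show ?thesis
      by (simp add: sm_value_def sm_density_def sm_integral_def M_def)
  next
    case False
    with sgn have neg: "AE x in M. f x \<le> 0" unfolding M_def by blast
    have "(\<integral>x. indicator A x * \<bar>f x\<bar> \<partial>M) = (\<integral>x. - (indicator A x * f x) \<partial>M)"
      using neg fM AM by (intro integral_cong_AE) auto
    with False[unfolded M_def] meas show ?thesis
      by (simp add: sm_value_def sm_density_def sm_integral_def M_def)
  qed
qed

definition sm_bracket :: "sgn_measure \<Rightarrow> sgn_measure \<Rightarrow> sgn_measure" where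
  "sm_bracket \<sigma>\<^sub>\<alpha> \<sigma>\<^sub>\<beta> = sm_density (cauchy_transform \<sigma>\<^sub>\<beta>) \<sigma>\<^sub>\<alpha>"

definition nikishin_generator :: "nat \<Rightarrow> (nat \<Rightarrow> sgn_measure) \<Rightarrow> bool" where
  "nikishin_generator m \<sigma> \<longleftrightarrow> (\<exists>\<Delta>. (\<forall>j\<in>{1..m}. \<sigma> j \<in> const_sign_measures (\<Delta> j)) \<and>
     (\<forall>j\<in>{1..<m}. \<Delta> j \<inter> \<Delta> (Suc j) = {}))"

text \<open>\<open>nikishin \<sigma> j k\<close> is the measure \<open>s\<^sub>j\<^sub>,\<^sub>k\<close> for \<open>j \<le> k\<close>; the value for \<open>j > k\<close> is never used.\<close>

function nikishin :: "(nat \<Rightarrow> sgn_measure) \<Rightarrow> nat \<Rightarrow> nat \<Rightarrow> sgn_measure" where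
  "nikishin \<sigma> j k = (if j < k then sm_bracket (\<sigma> j) (nikishin \<sigma> (Suc j) k) else \<sigma> j)"
  by pat_completeness auto
termination by (relation "Wellfounded.measure (\<lambda>(\<sigma>, j, k). k - j)") auto

declare nikishin.simps [simp del]

definition nikishin_hat :: "(nat \<Rightarrow> sgn_measure) \<Rightarrow> nat \<Rightarrow> complex \<Rightarrow> complex" where
  "nikishin_hat \<sigma> k z = (if k = 0 then 1 else cauchy_transform (nikishin \<sigma> 1 k) z)"

definition nikishin_domain :: "nat \<Rightarrow> (nat \<Rightarrow> sgn_measure) \<Rightarrow> complex set" where
  "nikishin_domain m \<sigma> =
     - (\<Union>k\<in>{1..m}. complex_of_real ` (convex hull (sm_supp (nikishin \<sigma> 1 k))))"

definition deg_le :: "real poly \<Rightarrow> int \<Rightarrow> bool" where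
  "deg_le p d \<longleftrightarrow> p = 0 \<or> int (degree p) \<le> d"

abbreviation cpoly :: "real poly \<Rightarrow> complex \<Rightarrow> complex" where
  "cpoly p z \<equiv> poly (map_poly complex_of_real p) z"

end

theory Submission
  imports Defs "HOL-Probability.Probability" "HOL-Computational_Algebra.Fundamental_Theorem_Algebra"
    "HOL-Real_Asymp.Real_Asymp"
begin

text \<open>
  Consider the triangular array with rows \<open>(0, \<dots>, 0, 1, C(s\<^sub>r\<^sub>+\<^sub>1\<^sub>,\<^sub>r\<^sub>+\<^sub>1), \<dots>, C(s\<^sub>r\<^sub>+\<^sub>1\<^sub>,\<^sub>m))\<close>, where \<open>r = 0, \<dots>, m\<close>
  and \<open>C\<close> denotes the Cauchy transform;
  each row is the Cauchy transform of the next one with respect to \<open>\<sigma>\<^sub>r\<^sub>+\<^sub>1\<close>. For a set \<open>J\<close> of columns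
  let \<open>Y\<^sub>J\<close> be the combination of the first \<open>|J| + 1\<close> rows that vanishes on \<open>J\<close> and equals 1 at the
  least index outside \<open>J\<close>. If \<open>1 / C(s) = \<ell> + C(\<tau>)\<close> is the inverse of a Cauchy transform, partial fractions
  show that \<open>Y\<^sub>J\<^sub>,\<^sub>i / Y\<^sub>J\<^sub>,\<^sub>j\<close> is a polynomial of degree at most one plus the Cauchy transform of
  \<open>Y\<^bsub>J \<union> {j},i\<^esub>\<close> with respect to a measure that does not depend on \<open>i\<close>. Following the columns in the
  order \<open>\<lambda>(0), \<lambda>(1), \<dots>\<close> one obtains the generators of \<open>S(\<lambda>)\<close>.

  All of this needs that \<open>Y\<^sub>J\<^sub>,\<^sub>i\<close> has no zeros off the interval of its level. Since \<open>Y\<^sub>J\<close> depends only on the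
  set \<open>J\<close>, its columns may be eliminated in increasing order; then the entries to the right of \<open>J\<close> are
  Cauchy transforms of measures of constant sign, without additive constants, and every other entry is
  a quotient of products of such entries. The linear term of \<open>Y\<^sub>J\<^sub>,\<^sub>i / Y\<^sub>J\<^sub>,\<^sub>j\<close> can only be present if \<open>i < j\<close>, so
  the degrees work out if \<open>\<lambda>\<close> breaks ties by the natural order.

  The inverse of a Cauchy transform is found by partial fractions for finitely supported measures, and
  by discretisation and Helly's theorem in general.
\<close>

section \<open>Inverses of finite Cauchy sums\<close>

text \<open>The obstacle is that a general entry is a real constant plus a Cauchy transform, and
  such a sum may vanish at a real point off its interval; its inverse would then have a pole there.
  The pure entries carry no constant and cannot vanish, so they alone serve as divisors until all
  rows are available; exchanging two columns then transfers zero-freeness to the other entries.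
  Polynomial parts are controlled by growth along the imaginary axis. At \<open>\<i> * y\<close> a
  Cauchy transform is O(1/y). If its density keeps a sign, it is also at least a multiple of 1/y,
  whatever real constant is added, because the imaginary part alone gives the bound. Comparing these
  orders removes additive constants and slopes. The new generators must again have infinite support.
  A weak limit does not preserve this property, so it is proved separately: a finitely supported
  inverse would make the original transform rational and the original measure finitely
  supported.\<close>

lemma prod_linear_dvd:
  fixes R :: "'a::field poly"
  assumes "finite Y" "\<And>y. y \<in> Y \<Longrightarrow> poly R y = 0"
  shows "(\<Prod>y\<in>Y. [:-y, 1:]) dvd R"
  using assms
proof (induction Y arbitrary: R)
  case empty
  then show ?case by simp
next
  case (insert y Y)
  have "[:-y, 1:] dvd R"
    using insert.prems by (simp add: poly_eq_0_iff_dvd)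
  then obtain S where S: "R = [:-y, 1:] * S" by (auto simp: dvd_def)
  have "poly S x = 0" if "x \<in> Y" for x
  proof -
    have "poly R x = 0" using insert.prems that by auto
    then have "(x - y) * poly S x = 0" by (simp add: S algebra_simps)
    moreover have "x \<noteq> y" using insert.hyps that by auto
    ultimately show ?thesis by simp
  qed
  then have "(\<Prod>y\<in>Y. [:-y, 1:]) dvd S" using insert.IH by blast
  then have "[:-y, 1:] * (\<Prod>y\<in>Y. [:-y, 1:]) dvd R" unfolding S by (rule mult_dvd_mono[OF dvd_refl])
  then show ?case using insert.hyps by (simp del: mult_pCons_left)
qed

lemma Im_pole: "Im (complex_of_real w / (z - complex_of_real x)) = - (w * Im z / (cmod (z - of_real x))\<^sup>2)"
  by (simp add: Im_divide cmod_power2)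

text \<open>With positive weights the sign of the imaginary part is opposite to that of
  \<open>Im z\<close>; this is why all zeros of such a fraction are real.\<close>

lemma Im_simple_fraction:
  "Im (complex_of_real c + (\<Sum>x\<in>A. of_real (w x) / (z - of_real x)))
     = - (Im z * (\<Sum>x\<in>A. w x / (cmod (z - of_real x))\<^sup>2))"
  by (simp add: Im_pole sum_distrib_left sum_negf mult.commute)

text \<open>The zeros of the fraction are real and simple, so its reciprocal is determined by the
  residues there and by its growth. That \<open>Z\<close> consists of zeros of the fraction serves
  later to locate the poles of the reciprocal.\<close>

theorem simple_fraction_inverse:
  fixes A :: "real set" and w :: "real \<Rightarrow> real" and c :: real
  assumes A: "finite A" "A \<noteq> {}" and w: "\<And>x. x \<in> A \<Longrightarrow> 0 < w x"
  obtains Z \<rho> \<beta> \<gamma> where "finite Z" "\<And>y. y \<in> Z \<Longrightarrow> 0 \<le> \<rho> y" "0 \<le> \<beta>"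
    "\<And>y. y \<in> Z \<Longrightarrow> y \<notin> A \<and> c + (\<Sum>x\<in>A. w x / (y - x)) = 0"
    "\<And>z. Im z \<noteq> 0 \<Longrightarrow> 1 / (complex_of_real c + (\<Sum>x\<in>A. of_real (w x) / (z - of_real x)))
       = of_real \<beta> * z + of_real \<gamma> - (\<Sum>y\<in>Z. of_real (\<rho> y) / (z - of_real y))"
proof -
  define T where "T z = complex_of_real c + (\<Sum>x\<in>A. of_real (w x) / (z - of_real x))" for z
  define P where "P = (\<Prod>x\<in>A. [:-complex_of_real x, 1:])"
  define Px where "Px x = (\<Prod>y\<in>A-{x}. [:-complex_of_real y, 1:])" for x
  \<comment> \<open>\<open>Q\<close> is \<open>P\<close> times the fraction, so its roots are the
    poles of the reciprocal.\<close>
  define Q where "Q = smult (of_real c) P + (\<Sum>x\<in>A. smult (of_real (w x)) (Px x))"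
  have PPx: "P = [:-of_real x, 1:] * Px x" if "x \<in> A" for x
    unfolding P_def Px_def by (rule prod.remove[OF A(1) that])
  have P0: "poly P z \<noteq> 0" if "z \<notin> complex_of_real ` A" for z
    using that A(1) by (auto simp: P_def poly_prod)
  have PxP: "poly (Px x) z = poly P z / (z - of_real x)" if "x \<in> A" "z \<notin> complex_of_real ` A" for x z
    proof -
    have "poly P z = (z - of_real x) * poly (Px x) z"
      by (subst PPx[OF that(1)]) (simp add: algebra_simps)
    then show ?thesis using that by auto
  qed
  have QT: "poly Q z = poly P z * T z" if z: "z \<notin> complex_of_real ` A" for z
  proof -
    have "poly Q z = of_real c * poly P z + (\<Sum>x\<in>A. of_real (w x) * poly (Px x) z)"
      by (simp add: Q_def poly_sum)
    also have "(\<Sum>x\<in>A. of_real (w x) * poly (Px x) z) = (\<Sum>x\<in>A. poly P z * (of_real (w x) / (z - of_real x)))"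
      using z by (intro sum.cong refl) (simp add: PxP)
    finally show ?thesis by (simp add: T_def sum_distrib_left algebra_simps)
  qed
  have QA: "poly Q (of_real x) \<noteq> 0" if x: "x \<in> A" for x
  proof -
    have "poly P (of_real x) = 0" using PPx[OF x] by simp
    moreover have "poly (Px y) (of_real x) = 0" if "y \<in> A" "y \<noteq> x" for y
      using that x A(1) by (auto simp: Px_def poly_prod intro!: prod_zero)
    ultimately have "poly Q (of_real x) = (\<Sum>y\<in>A. if y = x then of_real (w x) * poly (Px x) (of_real x) else 0)"
      by (auto simp: Q_def poly_sum intro!: sum.cong)
    also have "\<dots> = of_real (w x) * poly (Px x) (of_real x)"
      using A x by simp
    also have "\<dots> \<noteq> 0"
      using w[OF x] A(1) by (auto simp: Px_def poly_prod)
    finally show ?thesis .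
  qed
  have pos: "0 < (\<Sum>x\<in>A. w x / (cmod (z - of_real x))\<^sup>2)" if "z \<notin> complex_of_real ` A" for z
    using A that by (intro sum_pos divide_pos_pos w) auto
  have ImT: "Im (T z) = - (Im z * (\<Sum>x\<in>A. w x / (cmod (z - of_real x))\<^sup>2))" for z
    unfolding T_def by (rule Im_simple_fraction)
  define Y where "Y = {y. poly Q y = 0}"
  have YA: "y \<notin> complex_of_real ` A" if "y \<in> Y" for y
    using that QA by (auto simp: Y_def)
  have TY: "T y = 0" if "y \<in> Y" for y
    using that QT[OF YA[OF that]] P0[OF YA[OF that]] by (auto simp: Y_def)
  have Yreal: "y = of_real (Re y)" if "y \<in> Y" for y
  proof -
    have "Im y = 0" using ImT[of y] TY[OF that] pos[OF YA[OF that]] by auto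
    then show ?thesis by (simp add: complex_eq_iff)
  qed
  define S where "S y = (\<Sum>x\<in>A. w x / (y - x)\<^sup>2)" for y :: real
  have S0: "S (Re y) > 0" if "y \<in> Y" for y
    unfolding S_def using A YA[OF that] Yreal[OF that]
    by (intro sum_pos divide_pos_pos w) (auto simp: image_iff)
  \<comment> \<open>Differentiating \<open>Q = P * T\<close> at a root leaves \<open>P * T'\<close>.
    At a real point \<open>T' = - S\<close> is negative, hence all roots are simple.\<close>
  have dQ: "poly (pderiv Q) y = - (poly P y * of_real (S (Re y)))" if y: "y \<in> Y" for y
  proof -
    have yx: "y \<noteq> of_real x" if "x \<in> A" for x using YA[OF y] that by auto
    have dT: "(T has_field_derivative (- of_real (S (Re y)))) (at y)"
    proof -
      have "((\<lambda>z. \<Sum>x\<in>A. of_real (w x) / (z - of_real x)) has_field_derivative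
               (\<Sum>x\<in>A. - of_real (w x) / (y - of_real x)^2)) (at y)"
        by (intro DERIV_sum) (use yx in \<open>auto intro!: derivative_eq_intros simp: power2_eq_square\<close>)
      moreover have "(\<Sum>x\<in>A. - of_real (w x) / (y - of_real x)^2) = - complex_of_real (S (Re y))"
      proof -
        obtain r where "y = of_real r" using Yreal[OF y] by blast
        then show ?thesis by (simp add: S_def sum_negf)
      qed
      ultimately have "((\<lambda>z. \<Sum>x\<in>A. of_real (w x) / (z - of_real x)) has_field_derivative
          - complex_of_real (S (Re y))) (at y)" by simp
      from DERIV_add[OF DERIV_const this] show ?thesis
        unfolding T_def[abs_def] by simp
    qed
    have "((\<lambda>z. poly P z * T z) has_field_derivative
        (poly (pderiv P) y * T y + (- of_real (S (Re y))) * poly P y)) (at y)"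
      by (intro DERIV_mult poly_DERIV dT)
    moreover have "eventually (\<lambda>z. poly P z * T z = poly Q z) (nhds y)"
    proof -
      have "open (- (complex_of_real ` A))" using A by (auto intro!: finite_imp_closed open_Compl)
      then show ?thesis using YA[OF y] QT by (auto simp: eventually_nhds)
    qed
    ultimately have "(poly Q has_field_derivative (- of_real (S (Re y))) * poly P y) (at y)"
      using TY[OF y] by (subst (asm) DERIV_cong_ev[OF refl _ refl]) auto
    then show ?thesis
      using DERIV_unique[OF poly_DERIV] by fastforce
  qed
  have dQ0: "poly (pderiv Q) y \<noteq> 0" if "y \<in> Y" for y
    using dQ[OF that] S0[OF that] P0[OF YA[OF that]] by auto
  have sf: "rsquarefree Q"
    unfolding rsquarefree_roots using dQ0 by (auto simp: Y_def)
  have Q0: "Q \<noteq> 0" using sf by (simp add: rsquarefree_def)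
  have finY: "finite Y" unfolding Y_def using Q0 by (rule poly_roots_finite)
  define lc where "lc = lead_coeff Q"
  have lc0: "lc \<noteq> 0" using Q0 by (simp add: lc_def)
  have Qdec: "Q = smult lc (\<Prod>y\<in>Y. [:-y, 1:])"
    using complex_poly_decompose_rsquarefree[OF sf] by (simp add: lc_def Y_def)
  define Qy where "Qy y = smult lc (\<Prod>y\<in>Y-{y}. [:-y, 1:])" for y
  have QQy: "Q = [:-y, 1:] * Qy y" if "y \<in> Y" for y
    unfolding Qdec Qy_def using prod.remove[OF finY that, of "\<lambda>y. [:-y, 1:]"] by (simp del: mult_pCons_left)
  have Qyy: "poly (Qy y) y = poly (pderiv Q) y" if "y \<in> Y" for y
    by (subst QQy[OF that]) (simp only: pderiv_mult, simp add: pderiv_pCons)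
  have Qyx: "poly (Qy y) x = 0" if "y \<in> Y" "x \<in> Y" "x \<noteq> y" for x y
    using that finY by (auto simp: Qy_def poly_prod intro!: prod_zero)
  \<comment> \<open>The residue of \<open>1 / T\<close> at a zero \<open>y\<close> is
    \<open>1 / T'(y) = - 1 / S y\<close>.\<close>
  define \<rho> where "\<rho> y = 1 / S y" for y
  have PQ: "poly P y / poly (pderiv Q) y = - of_real (\<rho> (Re y))" if "y \<in> Y" for y
    using dQ[OF that] S0[OF that] P0[OF YA[OF that]] by (simp add: \<rho>_def)
  \<comment> \<open>\<open>R / Q\<close> is \<open>P / Q\<close> with all poles cancelled, so
    \<open>R\<close> vanishes at every root of \<open>Q\<close>.\<close>
  define R where "R = P + (\<Sum>y\<in>Y. smult (of_real (\<rho> (Re y))) (Qy y))"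
  have "poly R y = 0" if y: "y \<in> Y" for y
  proof -
    have "poly R y = poly P y + (\<Sum>x\<in>Y. if x = y then of_real (\<rho> (Re y)) * poly (pderiv Q) y else 0)"
      using Qyx y by (auto simp: R_def poly_sum Qyy intro!: sum.cong)
    also have "\<dots> = poly P y + of_real (\<rho> (Re y)) * poly (pderiv Q) y"
      using finY y by simp
    also have "\<dots> = 0" using PQ[OF y] dQ0[OF y] by (simp add: field_simps)
    finally show ?thesis .
  qed
  then have "(\<Prod>y\<in>Y. [:-y, 1:]) dvd R" by (intro prod_linear_dvd finY)
  then have "Q dvd R" unfolding Qdec using lc0 by (simp add: smult_dvd)
  then obtain L where L: "R = Q * L" by (auto simp: dvd_def)
  have degP: "degree P = card A" unfolding P_def
    by (subst degree_prod_eq_sum_degree) auto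
  have degPx: "degree (Px x) = card A - 1" "coeff (Px x) (card A - 1) = 1" if "x \<in> A" for x
  proof -
    show d: "degree (Px x) = card A - 1" unfolding Px_def using A that
      by (subst degree_prod_eq_sum_degree) auto
    have "lead_coeff (Px x) = 1" unfolding Px_def by (simp add: lead_coeff_prod)
    with d show "coeff (Px x) (card A - 1) = 1" by simp
  qed
  have "lead_coeff P = 1" unfolding P_def by (simp add: lead_coeff_prod)
  then have lP: "coeff P (card A) = 1" by (simp add: degP)
  have cA: "card A > 0" using A by (simp add: card_gt_0_iff)
  \<comment> \<open>For \<open>c = 0\<close> the coefficient of degree \<open>card A - 1\<close> is
    the total weight, which is positive. The quotient \<open>R / Q\<close> is therefore at most
    linear.\<close>
  have degQ: "card A - 1 \<le> degree Q"
  proof (cases "c = 0")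
    case True
    have "coeff Q (card A - 1) = (\<Sum>x\<in>A. of_real (w x))"
      using degPx(2) by (auto simp: Q_def True coeff_sum intro!: sum.cong)
    also have "\<dots> = of_real (\<Sum>x\<in>A. w x)" by simp
    finally have "coeff Q (card A - 1) = of_real (\<Sum>x\<in>A. w x)" .
    moreover have "(\<Sum>x\<in>A. w x) > 0" using A w by (intro sum_pos) auto
    ultimately have "coeff Q (card A - 1) \<noteq> 0" by (metis less_irrefl of_real_eq_0_iff)
    then show ?thesis by (rule le_degree)
  next
    case False
    have "coeff (Px x) (card A) = 0" if "x \<in> A" for x
      using degPx(1)[OF that] cA by (intro coeff_eq_0) auto
    then have "coeff Q (card A) = of_real c"
      by (simp add: Q_def coeff_sum lP)
    then have "card A \<le> degree Q" using False by (intro le_degree) simp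
    then show ?thesis by simp
  qed
  have degQy: "degree (Qy y) \<le> card A" if "y \<in> Y" for y
  proof -
    have "degree Q \<le> card A" unfolding Q_def
      by (intro degree_add_le degree_sum_le A degree_smult_le[THEN order_trans]) (auto simp: degP degPx)
    moreover have "Qy y \<noteq> 0" using QQy[OF that] Q0 by auto
    then have "degree Q = degree (Qy y) + 1"
      by (subst QQy[OF that], subst degree_mult_eq) auto
    ultimately show ?thesis by simp
  qed
  have degR: "degree R \<le> card A" unfolding R_def
    by (intro degree_add_le degree_sum_le finY degree_smult_le[THEN order_trans]) (auto simp: degP degQy)
  have degL: "degree L \<le> 1"
  proof (cases "L = 0")
    case False
    then have "degree R = degree Q + degree L" by (simp add: L degree_mult_eq Q0)
    with degR degQ cA show ?thesis by simp
  qed auto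
  define b g where "b = coeff L 1" and "g = coeff L 0"
  have Lbg: "poly L z = b * z + g" for z
  proof -
    have "coeff L n = coeff [:g, b:] n" for n
      using degL by (cases n; cases "n - 1") (auto simp: b_def g_def intro!: coeff_eq_0)
    then have "L = [:g, b:]" by (rule poly_eqI)
    then show ?thesis by (simp add: algebra_simps)
  qed
  have main: "1 / T z = b * z + g - (\<Sum>y\<in>Y. of_real (\<rho> (Re y)) / (z - y))" if z: "Im z \<noteq> 0" for z
  proof -
    have zA: "z \<notin> complex_of_real ` A" using z by auto
    have zY: "z \<noteq> y" if "y \<in> Y" for y using z Yreal[OF that] by (metis Im_complex_of_real)
    have Qz: "poly Q z \<noteq> 0" using zY by (auto simp: Y_def)
    have "1 / T z = poly P z / poly Q z" using QT[OF zA] P0[OF zA] by simp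
    also have "poly P z = poly L z * poly Q z - (\<Sum>y\<in>Y. of_real (\<rho> (Re y)) * poly (Qy y) z)"
      using arg_cong[OF L, of "\<lambda>p. poly p z"] by (simp add: R_def poly_sum algebra_simps)
    also have "(\<Sum>y\<in>Y. of_real (\<rho> (Re y)) * poly (Qy y) z) = (\<Sum>y\<in>Y. poly Q z * (of_real (\<rho> (Re y)) / (z - y)))"
    proof (intro sum.cong refl)
      fix y assume y: "y \<in> Y"
      have "poly Q z = (z - y) * poly (Qy y) z" by (subst QQy[OF y]) (simp add: algebra_simps)
      then show "of_real (\<rho> (Re y)) * poly (Qy y) z = poly Q z * (of_real (\<rho> (Re y)) / (z - y))"
        using zY[OF y] by simp
    qed
    also have "\<dots> = poly Q z * (\<Sum>y\<in>Y. of_real (\<rho> (Re y)) / (z - y))" by (simp only: sum_distrib_left)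
    finally show ?thesis using Qz by (simp add: Lbg diff_divide_distrib)
  qed
  define Z where "Z = Re ` Y"
  have injY: "inj_on Re Y" using Yreal by (metis inj_onI)
  have sumZ: "(\<Sum>y\<in>Y. of_real (\<rho> (Re y)) / (z - y)) = (\<Sum>y\<in>Z. of_real (\<rho> y) / (z - of_real y))" for z
    unfolding Z_def sum.reindex[OF injY] using Yreal by (intro sum.cong refl) (metis comp_apply)
  have Tcnj: "T (cnj z) = cnj (T z)" for z by (simp add: T_def)
  have cnjL: "b * cnj z + g = cnj (b * z + g)" if "Im z \<noteq> 0" for z
  proof -
    have "1 / T (cnj z) = cnj (1 / T z)" by (simp add: Tcnj)
    then show ?thesis using main[of z] main[of "cnj z"] that unfolding sumZ by simp
  qed
  \<comment> \<open>A linear polynomial is determined by two values, so symmetry under conjugation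
    at two points makes both coefficients real.\<close>
  have "b * (- \<i>) + g = cnj b * (-\<i>) + cnj g" "b * (- 2 * \<i>) + g = cnj b * (- 2 * \<i>) + cnj g"
    using cnjL[of \<i>] cnjL[of "2 * \<i>"] by auto
  then have "b = cnj b" "g = cnj g" by (auto simp: complex_eq_iff)
  then have bg: "b = of_real (Re b)" "g = of_real (Re g)" by (auto simp: complex_eq_iff)
  have rho0: "0 \<le> \<rho> y" for y
  proof -
    have "0 \<le> S y" unfolding S_def using w by (intro sum_nonneg divide_nonneg_nonneg zero_le_power2) force
    then show ?thesis by (simp add: \<rho>_def)
  qed
  have main': "1 / T z = of_real (Re b) * z + of_real (Re g) - (\<Sum>y\<in>Z. of_real (\<rho> y) / (z - of_real y))"
    if "Im z \<noteq> 0" for z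
    using main[OF that] unfolding sumZ bg[symmetric] .
  have "0 \<le> Re b"
  proof -
    \<comment> \<open>This is \<open>Im (1 / T)\<close> at \<open>\<i> * t\<close>, divided by
      \<open>t\<close>; the sum over the poles tends to 0 and leaves \<open>Re b\<close>.\<close>
    have *: "0 \<le> Re b + (\<Sum>y\<in>Z. \<rho> y / (cmod (\<i> * of_real t - of_real y))\<^sup>2)" if t: "t > 0" for t :: real
    proof -
      have "Im (T (\<i> * of_real t)) \<le> 0" using ImT[of "\<i> * of_real t"] pos[of "\<i> * of_real t"] t by (auto simp: image_iff complex_eq_iff)
      then have "0 \<le> Im (1 / T (\<i> * of_real t))"
        by (simp add: Im_divide divide_nonpos_nonneg)
      also have "Im (1 / T (\<i> * of_real t)) = t * (Re b + (\<Sum>y\<in>Z. \<rho> y / (cmod (\<i> * of_real t - of_real y))\<^sup>2))"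
        using t by (subst main') (simp_all add: Im_pole sum_negf sum_distrib_left distrib_left mult.commute)
      finally show ?thesis using t by (simp add: zero_le_mult_iff)
    qed
    have "((\<lambda>t::real. Re b + (\<Sum>y\<in>Z. \<rho> y / (cmod (\<i> * of_real t - of_real y))\<^sup>2)) \<longlongrightarrow> Re b + (\<Sum>y\<in>Z. 0)) at_top"
    proof (intro tendsto_intros)
      fix y
      have "((\<lambda>t. \<rho> y / (t\<^sup>2 + y\<^sup>2)) \<longlongrightarrow> 0) at_top" by real_asymp
      then show "((\<lambda>t::real. \<rho> y / (cmod (\<i> * of_real t - of_real y))\<^sup>2) \<longlongrightarrow> 0) at_top"
        by (simp add: cmod_power2 add.commute)
    qed
    then have "((\<lambda>t::real. Re b + (\<Sum>y\<in>Z. \<rho> y / (cmod (\<i> * of_real t - of_real y))\<^sup>2)) \<longlongrightarrow> Re b) at_top"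
      by simp
    moreover have "\<forall>\<^sub>F t in at_top. 0 \<le> Re b + (\<Sum>y\<in>Z. \<rho> y / (cmod (\<i> * of_real t - of_real y))\<^sup>2)"
      using eventually_gt_at_top[of "0::real"] by eventually_elim (rule *)
    ultimately show ?thesis by (rule tendsto_lowerbound) simp
  qed
  moreover have "finite Z" using finY by (simp add: Z_def)
  moreover have "y \<notin> A \<and> c + (\<Sum>x\<in>A. w x / (y - x)) = 0" if "y \<in> Z" for y
  proof -
    have y: "of_real y \<in> Y" using that Yreal by (auto simp: Z_def)
    have "complex_of_real (c + (\<Sum>x\<in>A. w x / (y - x))) = T (of_real y)" by (simp add: T_def)
    also have "\<dots> = 0" by (rule TY[OF y])
    finally show ?thesis using YA[OF y] of_real_eq_0_iff by blast
  qed
  moreover have "1 / T z = of_real (Re b) * z + of_real (Re g) - (\<Sum>y\<in>Z. of_real (\<rho> y) / (z - of_real y))" if "Im z \<noteq> 0" for z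
    using that by (rule main')
  ultimately show thesis using that[of Z \<rho> "Re b" "Re g"] rho0 unfolding T_def by blast
qed

section \<open>Weak limits and discretisation\<close>

text \<open>Normalised to total mass 1, the weights form a tight sequence, since they all live in
  one bounded interval. The limit of the masses is put back as a constant density.\<close>

lemma helly_discrete:
  fixes Z :: "nat \<Rightarrow> real set" and \<rho> :: "nat \<Rightarrow> real \<Rightarrow> real"
  assumes fin: "\<And>n. finite (Z n)" and nonneg: "\<And>n y. y \<in> Z n \<Longrightarrow> 0 \<le> \<rho> n y"
    and sub: "\<And>n. Z n \<subseteq> {A..B}" and lim: "(\<lambda>n. \<Sum>y\<in>Z n. \<rho> n y) \<longlonglongrightarrow> mass"
  obtains r \<nu> where "strict_mono r" "finite_measure \<nu>" "sets \<nu> = sets borel"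
    "\<And>f :: real \<Rightarrow> complex. continuous_on UNIV f \<Longrightarrow> bounded (range f) \<Longrightarrow>
       (\<lambda>n. \<Sum>y\<in>Z (r n). of_real (\<rho> (r n) y) * f y) \<longlonglongrightarrow> (\<integral>x. f x \<partial>\<nu>)"
proof -
  define mm where "mm n = (\<Sum>y\<in>Z n. \<rho> n y)" for n
  have mm0: "mm n \<ge> 0" for n unfolding mm_def using nonneg by (intro sum_nonneg)
  have mm_lim: "mm \<longlonglongrightarrow> mass" using lim by (simp add: mm_def[abs_def])
  have mass0: "mass \<ge> 0" by (rule LIMSEQ_le_const[OF mm_lim]) (auto intro: mm0)
  show thesis
  proof (cases "mass = 0")
    \<comment> \<open>No normalisation is possible if the masses tend to 0, but then every integral
      tends to 0 as well.\<close>
    case True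
    have "(\<lambda>n. \<Sum>y\<in>Z n. of_real (\<rho> n y) * f y) \<longlonglongrightarrow> 0"
      if bd: "bounded (range f)" for f :: "real \<Rightarrow> complex"
    proof -
      obtain K where K: "\<And>x. norm (f x) \<le> K" using bd by (auto simp: bounded_iff)
      show ?thesis
      proof (rule Lim_null_comparison)
        show "\<forall>\<^sub>F n in sequentially. norm (\<Sum>y\<in>Z n. of_real (\<rho> n y) * f y) \<le> mm n * K"
          by (intro always_eventually allI order_trans[OF norm_sum], unfold mm_def sum_distrib_right)
             (auto intro!: sum_mono mult_left_mono K simp: norm_mult nonneg)
        show "(\<lambda>n. mm n * K) \<longlonglongrightarrow> 0" using tendsto_mult_left_zero[of mm sequentially K] mm_lim True by simp
      qed
    qed
    then show thesis
      by (intro that[of id "null_measure borel"])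
         (auto intro: finite_measureI simp: strict_mono_def)
  next
    case False
    then have "\<forall>\<^sub>F n in sequentially. mm n > 0"
      using mass0 mm_lim by (intro order_tendstoD(1)) auto
    then obtain n0 where n0: "\<And>n. n \<ge> n0 \<Longrightarrow> mm n > 0" by (auto simp: eventually_sequentially)
    define P where "P n = point_measure (Z (n + n0)) (\<lambda>y. ennreal (\<rho> (n + n0) y / mm (n + n0)))" for n
    define \<mu> where "\<mu> n = distr (P n) borel (\<lambda>x. x)" for n
    have meas: "(\<lambda>x. x) \<in> P n \<rightarrow>\<^sub>M (borel :: real measure)" for n
      by (simp add: P_def)
    have em: "emeasure (\<mu> n) X = 1" if "X \<in> sets borel" "{A..B} \<subseteq> X" for X n
    proof -
      have "emeasure (\<mu> n) X = emeasure (P n) (X \<inter> Z (n + n0))"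
        unfolding \<mu>_def by (subst emeasure_distr[OF meas that(1)]) (simp add: P_def space_point_measure)
      also have "X \<inter> Z (n + n0) = Z (n + n0)" using sub that(2) by auto
      also have "emeasure (P n) \<dots> = (\<Sum>y\<in>Z (n + n0). ennreal (\<rho> (n + n0) y / mm (n + n0)))"
        unfolding P_def by (rule emeasure_point_measure_finite[OF fin order_refl])
      also have "\<dots> = ennreal (\<Sum>y\<in>Z (n + n0). \<rho> (n + n0) y / mm (n + n0))"
        using nonneg mm0 by (intro sum_ennreal) auto
      also have "(\<Sum>y\<in>Z (n + n0). \<rho> (n + n0) y / mm (n + n0)) = 1"
        using n0[of "n + n0"] by (simp add: sum_divide_distrib[symmetric] mm_def)
      finally show ?thesis by simp
    qed
    have rd: "real_distribution (\<mu> n)" for n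
    proof -
      have "prob_space (\<mu> n)"
        by (rule prob_spaceI) (use em[of UNIV n] in \<open>simp add: \<mu>_def\<close>)
      then show ?thesis by (simp add: real_distribution_def real_distribution_axioms_def \<mu>_def)
    qed
    have int: "(\<integral>x. f x \<partial>\<mu> n) = (\<Sum>y\<in>Z (n + n0). of_real (\<rho> (n + n0) y / mm (n + n0)) * f y)"
      if "continuous_on UNIV f" for f :: "real \<Rightarrow> complex" and n
    proof -
      have [measurable]: "f \<in> borel_measurable borel" using that by (rule borel_measurable_continuous_onI)
      have "(\<integral>x. f x \<partial>\<mu> n) = (\<integral>x. f x \<partial>P n)"
        unfolding \<mu>_def by (rule integral_distr[OF meas]) simp
      also have "\<dots> = (\<Sum>y\<in>Z (n + n0). (\<rho> (n + n0) y / mm (n + n0)) *\<^sub>R f y)"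
        unfolding P_def by (intro lebesgue_integral_point_measure_finite fin) (auto intro!: divide_nonneg_nonneg nonneg mm0)
      finally show ?thesis by (simp add: scaleR_conv_of_real)
    qed
    have "tight \<mu>" unfolding tight_def
    proof (intro conjI allI impI rd)
      fix e :: real assume "e > 0"
      \<comment> \<open>Tightness is phrased with half-open intervals: \<open>A - 1\<close> brings
        in the left endpoint, and the maximum keeps the interval nonempty even if
        \<open>B < A\<close>.\<close>
      have "{A..B} \<subseteq> {A - 1<..max A B}" by auto
      then have "measure (\<mu> n) {A - 1<..max A B} = 1" for n
        using em[of "{A - 1<..max A B}" n] by (simp add: measure_def)
      then show "\<exists>a b. a < b \<and> (\<forall>n. 1 - e < measure (\<mu> n) {a<..b})"
        using \<open>e > 0\<close> by (intro exI[of _ "A - 1"] exI[of _ "max A B"]) auto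
    qed
    from tight_imp_convergent_subsubsequence[OF this, of id]
    obtain r \<nu> where r: "strict_mono (r :: nat \<Rightarrow> nat)" and \<nu>: "real_distribution \<nu>" "weak_conv_m (\<mu> \<circ> r) \<nu>"
      by (auto simp: strict_mono_def)
    interpret \<nu>: real_distribution \<nu> by fact
    define s where "s n = r n + n0" for n
    have s: "strict_mono s" using r by (simp add: s_def strict_mono_def)
    define \<nu>' where "\<nu>' = density \<nu> (\<lambda>_. ennreal mass)"
    show thesis
    proof (rule that[OF s])
      show "finite_measure \<nu>'"
        by (rule finite_measureI) (simp add: \<nu>'_def emeasure_density \<nu>.emeasure_eq_measure ennreal_mult_eq_top_iff)
      show "sets \<nu>' = sets borel" by (simp add: \<nu>'_def)
      fix f :: "real \<Rightarrow> complex"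
      assume f: "continuous_on UNIV f" "bounded (range f)"
      obtain K where K: "\<And>x. norm (f x) \<le> K" using f by (auto simp: bounded_iff)
      have fm[measurable]: "f \<in> borel_measurable \<nu>" using f(1) by (simp add: borel_measurable_continuous_onI)
      have "(\<lambda>n. integral\<^sup>L ((\<mu> \<circ> r) n) f) \<longlonglongrightarrow> integral\<^sup>L \<nu> f"
        using f(1) by (intro weak_conv_imp_integral_bdd_continuous_conv[OF _ \<nu> _ K])
           (auto simp: rd continuous_on_eq_continuous_at)
      then have "(\<lambda>n. of_real (mm (s n)) * (integral\<^sup>L ((\<mu> \<circ> r) n) f)) \<longlonglongrightarrow> of_real mass * integral\<^sup>L \<nu> f"
        using LIMSEQ_subseq_LIMSEQ[OF mm_lim s] by (intro tendsto_mult tendsto_of_real) (simp_all add: comp_def)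
      moreover have "of_real (mm (s n)) * (integral\<^sup>L ((\<mu> \<circ> r) n) f) = (\<Sum>y\<in>Z (s n). of_real (\<rho> (s n) y) * f y)" for n
        using n0[of "s n"] unfolding comp_def int[OF f(1)] s_def[symmetric] sum_distrib_left
        by (intro sum.cong refl) (auto simp: s_def)
      moreover have "(\<integral>x. f x \<partial>\<nu>') = of_real mass * integral\<^sup>L \<nu> f"
        unfolding \<nu>'_def using mass0 by (subst integral_density) (auto simp: scaleR_conv_of_real)
      ultimately show "(\<lambda>n. \<Sum>y\<in>Z (s n). of_real (\<rho> (s n) y) * f y) \<longlonglongrightarrow> (\<integral>x. f x \<partial>\<nu>')"
        by simp
    qed
  qed
qed

text \<open>Pushing a measure forward under this rounding map makes it finitely supported.\<close>

definition grid_round :: "real \<Rightarrow> nat \<Rightarrow> real \<Rightarrow> real" where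
  "grid_round b n x = min b (of_int \<lceil>real (Suc n) * x\<rceil> / real (Suc n))"

lemma grid_round_measurable [measurable]: "grid_round b n \<in> borel_measurable borel"
  unfolding grid_round_def[abs_def] by measurable

text \<open>Rounding goes upwards and is capped at \<open>b\<close>, so that points of an interval
  ending at \<open>b\<close> stay inside it.\<close>

lemma grid_round_ge: "x \<le> b \<Longrightarrow> x \<le> grid_round b n x"
  unfolding grid_round_def using le_of_int_ceiling[of "real (Suc n) * x"]
  by (auto simp: field_simps)

lemma grid_round_le: "grid_round b n x \<le> b"
  by (simp add: grid_round_def)

lemma grid_round_tendsto:
  assumes "x \<le> b" shows "(\<lambda>n. grid_round b n x) \<longlonglongrightarrow> x"
proof (rule tendsto_sandwich)
  show "\<forall>\<^sub>F n in sequentially. x \<le> grid_round b n x"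
    using grid_round_ge[OF assms] by simp
  show "\<forall>\<^sub>F n in sequentially. grid_round b n x \<le> x + 1 / real (Suc n)"
  proof (intro always_eventually allI)
    fix n
    have "of_int \<lceil>real (Suc n) * x\<rceil> \<le> real (Suc n) * x + 1" by linarith
    then have "of_int \<lceil>real (Suc n) * x\<rceil> / real (Suc n) \<le> (real (Suc n) * x + 1) / real (Suc n)"
      by (rule divide_right_mono) simp
    also have "\<dots> = x + 1 / real (Suc n)" by (simp add: add_divide_distrib del: of_nat_Suc)
    finally have "of_int \<lceil>real (Suc n) * x\<rceil> / real (Suc n) \<le> x + 1 / real (Suc n)" .
    then show "grid_round b n x \<le> x + 1 / real (Suc n)" by (simp add: grid_round_def)
  qed
  show "(\<lambda>n. x + 1 / real (Suc n)) \<longlonglongrightarrow> x" by real_asymp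
qed simp

lemma finite_grid_round: "finite (grid_round b n ` {a..b})"
proof (rule finite_subset)
  show "grid_round b n ` {a..b} \<subseteq> insert b ((\<lambda>k. of_int k / real (Suc n)) ` {\<lceil>real (Suc n) * a\<rceil>..\<lceil>real (Suc n) * b\<rceil>})"
    by (auto simp: grid_round_def min_def intro!: imageI ceiling_mono mult_left_mono)
qed auto

lemma grid_round_integral:
  fixes f :: "real \<Rightarrow> 'a::{banach, second_countable_topology}"
  assumes "finite_measure M" and sets: "sets M = sets borel" and null: "emeasure M (- {a..b}) = 0"
    and f: "continuous_on UNIV f"
  shows "(\<integral>x. f (grid_round b n x) \<partial>M) =
    (\<Sum>y\<in>grid_round b n ` {a..b}. measure M (grid_round b n -` {y} \<inter> {a..b}) *\<^sub>R f y)"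
proof -
  interpret finite_measure M by fact
  have [measurable_cong]: "sets M = sets borel" by fact
  have [measurable]: "f \<in> borel_measurable borel" using f by (rule borel_measurable_continuous_onI)
  let ?I = "\<lambda>y. grid_round b n -` {y} \<inter> {a..b}"
  have I: "?I y \<in> sets M" for y
  proof -
    have "grid_round b n -` {y} \<inter> space borel \<in> sets borel" by measurable
    then show ?thesis unfolding sets by auto
  qed
  have ae: "AE x in M. x \<in> {a..b}"
    by (rule AE_I[of _ _ "- {a..b}"]) (auto simp: null sets)
  have "(\<integral>x. f (grid_round b n x) \<partial>M) = (\<integral>x. (\<Sum>y\<in>grid_round b n ` {a..b}. indicator (?I y) x *\<^sub>R f y) \<partial>M)"
  proof (rule integral_cong_AE)
    show "AE x in M. f (grid_round b n x) = (\<Sum>y\<in>grid_round b n ` {a..b}. indicator (?I y) x *\<^sub>R f y)"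
      using ae
    proof eventually_elim
      case (elim x)
      have "(\<Sum>y\<in>grid_round b n ` {a..b}. indicator (?I y) x *\<^sub>R f y) =
            (\<Sum>y\<in>grid_round b n ` {a..b}. if y = grid_round b n x then f y else 0)"
        using elim by (intro sum.cong refl) (auto simp: indicator_def)
      also have "\<dots> = f (grid_round b n x)"
        using elim finite_grid_round[of b n a] by (subst sum.delta) auto
      finally show ?case by simp
    qed
  qed (use I in measurable)
  also have "\<dots> = (\<Sum>y\<in>grid_round b n ` {a..b}. measure M (?I y) *\<^sub>R f y)"
    using I by (subst Bochner_Integration.integral_sum)
      (auto simp: sets[THEN sets_eq_imp_space_eq] emeasure_eq_measure)
  finally show ?thesis .
qed

lemma grid_round_integral_tendsto:
  fixes f :: "real \<Rightarrow> 'a::{banach, second_countable_topology}"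
  assumes "finite_measure M" and sets: "sets M = sets borel" and null: "emeasure M (- {a..b}) = 0"
    and f: "continuous_on UNIV f" "bounded (range f)"
  shows "(\<lambda>n. \<integral>x. f (grid_round b n x) \<partial>M) \<longlonglongrightarrow> (\<integral>x. f x \<partial>M)"
proof -
  interpret finite_measure M by fact
  have [measurable_cong]: "sets M = sets borel" by fact
  have [measurable]: "f \<in> borel_measurable borel" using f(1) by (rule borel_measurable_continuous_onI)
  obtain K where K: "\<And>x. norm (f x) \<le> K" using f(2) by (auto simp: bounded_iff)
  have ae: "AE x in M. x \<in> {a..b}"
    by (rule AE_I[of _ _ "- {a..b}"]) (auto simp: null sets)
  show ?thesis
  proof (rule integral_dominated_convergence)
    show "AE x in M. (\<lambda>n. f (grid_round b n x)) \<longlonglongrightarrow> f x"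
      using ae
    proof eventually_elim
      case (elim x)
      then have "(\<lambda>n. grid_round b n x) \<longlonglongrightarrow> x" by (intro grid_round_tendsto) auto
      moreover have "isCont f x" using f(1) by (simp add: continuous_on_eq_continuous_at)
      ultimately show ?case by (rule isCont_tendsto_compose[rotated])
    qed
  qed (use K in auto)
qed

section \<open>Cauchy transforms of densities\<close>

text \<open>\<open>\<Gamma>\<close> only has to carry the measure and need not be the hull of its
  support: the intervals stay fixed while the measures on them change.\<close>

definition concentrated :: "real set \<Rightarrow> sgn_measure \<Rightarrow> bool" where
  "concentrated \<Gamma> s \<longleftrightarrow> (fst s = 1 \<or> fst s = -1) \<and> finite_measure (snd s) \<and>
     sets (snd s) = sets borel \<and> emeasure (snd s) (- \<Gamma>) = 0"

text \<open>Infinite support, phrased through null sets; in this form it survives multiplication by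
  a nonvanishing density.\<close>

definition concentrated_inf :: "real set \<Rightarrow> sgn_measure \<Rightarrow> bool" where
  "concentrated_inf \<Gamma> s \<longleftrightarrow> concentrated \<Gamma> s \<and> (\<forall>F. finite F \<longrightarrow> emeasure (snd s) (- F) \<noteq> 0)"

text \<open>The Cauchy transform of the measure \<open>f ds\<close>. Keeping \<open>f\<close> apart
  from \<open>s\<close> makes the transform linear in \<open>f\<close> and allows complex-valued
  densities of varying sign.\<close>

definition ctrans :: "sgn_measure \<Rightarrow> (complex \<Rightarrow> complex) \<Rightarrow> complex \<Rightarrow> complex" where
  "ctrans s f z = sm_integral s (\<lambda>x. f (of_real x) / (z - of_real x))"

text \<open>Measurability is global because the integrals range over the whole line. Continuity is
  asked on \<open>\<Gamma>\<close> only, since the densities are themselves transforms with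
  singularities elsewhere.\<close>

definition density_on :: "real set \<Rightarrow> (complex \<Rightarrow> complex) \<Rightarrow> bool" where
  "density_on \<Gamma> f \<longleftrightarrow> (\<lambda>x. f (of_real x)) \<in> borel_measurable borel \<and> continuous_on \<Gamma> (\<lambda>x. f (of_real x))"

lemma density_on_const [simp]: "density_on \<Gamma> (\<lambda>_. c)"
  by (simp add: density_on_def)

lemma density_on_ident [simp]: "density_on \<Gamma> (\<lambda>z. z)"
  by (auto simp: density_on_def intro!: continuous_intros borel_measurable_continuous_onI)

lemma density_on_add: "density_on \<Gamma> f \<Longrightarrow> density_on \<Gamma> g \<Longrightarrow> density_on \<Gamma> (\<lambda>z. f z + g z)"
  by (auto simp: density_on_def intro!: continuous_intros)

lemma density_on_mult: "density_on \<Gamma> f \<Longrightarrow> density_on \<Gamma> g \<Longrightarrow> density_on \<Gamma> (\<lambda>z. f z * g z)"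
  by (auto simp: density_on_def intro!: continuous_intros)

lemma density_on_divide:
  "density_on \<Gamma> f \<Longrightarrow> density_on \<Gamma> g \<Longrightarrow> (\<And>x. x \<in> \<Gamma> \<Longrightarrow> g (of_real x) \<noteq> 0) \<Longrightarrow> density_on \<Gamma> (\<lambda>z. f z / g z)"
  by (auto simp: density_on_def intro!: continuous_intros)

section \<open>Bounds and integrability on compact sets\<close>

lemma density_on_bounded:
  assumes "compact \<Gamma>" "density_on \<Gamma> f"
  obtains K where "0 < K" "\<And>x. x \<in> \<Gamma> \<Longrightarrow> norm (f (of_real x)) \<le> K"
proof -
  have "compact ((\<lambda>x. f (of_real x)) ` \<Gamma>)"
    using assms by (intro compact_continuous_image) (auto simp: density_on_def)
  then have "bounded ((\<lambda>x. f (of_real x)) ` \<Gamma>)" by (rule compact_imp_bounded)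
  then show thesis using that by (auto simp: bounded_pos)
qed

lemma compact_of_real_image: "compact \<Gamma> \<Longrightarrow> compact (complex_of_real ` \<Gamma>)"
  by (intro compact_continuous_image continuous_intros)

lemma off_compact_distance:
  assumes "compact \<Gamma>" "z \<notin> complex_of_real ` \<Gamma>"
  obtains d where "0 < d" "\<And>x. x \<in> \<Gamma> \<Longrightarrow> d \<le> norm (z - of_real x)"
  using separate_point_closed[OF compact_imp_closed[OF compact_of_real_image[OF assms(1)]] assms(2)]
  by (auto simp: dist_norm)

lemma concentrated_AE:
  assumes "concentrated \<Gamma> s" "compact \<Gamma>"
  shows "AE x in snd s. x \<in> \<Gamma>"
proof (rule AE_I[of _ _ "- \<Gamma>"])
  show "- \<Gamma> \<in> sets (snd s)"
    using assms compact_imp_closed[OF assms(2)] by (auto simp: concentrated_def)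
qed (use assms in \<open>auto simp: concentrated_def\<close>)

lemma concentrated_integrable:
  fixes f :: "real \<Rightarrow> 'a::{banach, second_countable_topology}"
  assumes s: "concentrated \<Gamma> s" "compact \<Gamma>" and f: "f \<in> borel_measurable borel"
    and K: "\<And>x. x \<in> \<Gamma> \<Longrightarrow> norm (f x) \<le> K"
  shows "integrable (snd s) f"
proof -
  interpret finite_measure "snd s" using s by (simp add: concentrated_def)
  have [measurable_cong]: "sets (snd s) = sets borel" using s by (simp add: concentrated_def)
  show ?thesis
  proof (rule integrable_const_bound)
    show "AE x in snd s. norm (f x) \<le> K"
      using concentrated_AE[OF s] by eventually_elim (rule K)
    show "f \<in> borel_measurable (snd s)" using f by measurable
  qed
qed

lemma kernel_integrable:
  assumes s: "concentrated \<Gamma> s" "compact \<Gamma>" and f: "density_on \<Gamma> f" and z: "z \<notin> complex_of_real ` \<Gamma>"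
  shows "integrable (snd s) (\<lambda>x. f (of_real x) / (z - of_real x))"
proof -
  obtain d where d: "0 < d" "\<And>x. x \<in> \<Gamma> \<Longrightarrow> d \<le> norm (z - of_real x)"
    using off_compact_distance[OF s(2) z] by blast
  obtain K where K: "0 < K" "\<And>x. x \<in> \<Gamma> \<Longrightarrow> norm (f (of_real x)) \<le> K"
    using density_on_bounded[OF s(2) f] by blast
  have [measurable]: "(\<lambda>x. f (of_real x)) \<in> borel_measurable borel" using f by (simp add: density_on_def)
  show ?thesis
    by (rule concentrated_integrable[OF s, where K = "K / d"])
       (use d K in \<open>auto simp: norm_divide intro!: frac_le\<close>)
qed

lemma density_on_integrable:
  assumes s: "concentrated \<Gamma> s" "compact \<Gamma>" and f: "density_on \<Gamma> f"
  shows "integrable (snd s) (\<lambda>x. f (of_real x))"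
proof -
  obtain K where K: "0 < K" "\<And>x. x \<in> \<Gamma> \<Longrightarrow> norm (f (of_real x)) \<le> K"
    using density_on_bounded[OF s(2) f] by blast
  show ?thesis
    by (rule concentrated_integrable[OF s, where K = K]) (use f K in \<open>auto simp: density_on_def\<close>)
qed

lemma sm_integral_cong:
  assumes s: "concentrated \<Gamma> s" "compact \<Gamma>"
    and f: "f \<in> borel_measurable borel" "g \<in> borel_measurable borel"
    and eq: "\<And>x. x \<in> \<Gamma> \<Longrightarrow> f x = g x"
  shows "sm_integral s f = sm_integral s g"
proof -
  have [measurable_cong]: "sets (snd s) = sets borel" using s by (simp add: concentrated_def)
  have "integral\<^sup>L (snd s) f = integral\<^sup>L (snd s) g"
    using concentrated_AE[OF s] f by (intro integral_cong_AE) (auto simp: eq elim!: eventually_mono)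
  then show ?thesis by (simp add: sm_integral_def)
qed

lemma ctrans_cong:
  assumes s: "concentrated \<Gamma> s" "compact \<Gamma>" and f: "density_on \<Gamma> f" "density_on \<Gamma> g"
    and eq: "\<And>x. x \<in> \<Gamma> \<Longrightarrow> f (of_real x) = g (of_real x)"
  shows "ctrans s f z = ctrans s g z"
  unfolding ctrans_def using f by (intro sm_integral_cong[OF s]) (auto simp: density_on_def eq)

lemma sm_integral_norm_le:
  fixes f :: "real \<Rightarrow> 'a::{banach, second_countable_topology}"
  assumes s: "concentrated \<Gamma> s" "compact \<Gamma>" and K: "\<And>x. x \<in> \<Gamma> \<Longrightarrow> norm (f x) \<le> K" "0 \<le> K"
  shows "norm (sm_integral s f) \<le> K * measure (snd s) UNIV"
proof (cases "integrable (snd s) f")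
  case True
  interpret finite_measure "snd s" using s by (simp add: concentrated_def)
  have sp: "space (snd s) = UNIV" using s by (auto simp: concentrated_def dest: sets_eq_imp_space_eq)
  have "norm (integral\<^sup>L (snd s) f) \<le> (\<integral>x. norm (f x) \<partial>snd s)" by (rule integral_norm_bound)
  also have "\<dots> \<le> (\<integral>x. K \<partial>snd s)"
    using concentrated_AE[OF s] True by (intro integral_mono_AE) (auto intro: K elim!: eventually_mono)
  also have "\<dots> = K * measure (snd s) UNIV" by (simp add: sp)
  finally show ?thesis using s by (auto simp: sm_integral_def concentrated_def)
next
  \<comment> \<open>By convention the integral of a function that is not integrable is 0.\<close>
  case False
  then show ?thesis using K by (simp add: sm_integral_def not_integrable_integral_eq)
qed

section \<open>Linearity, continuity and symmetry of the transform\<close>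

lemma sm_integral_add:
  "integrable (snd s) f \<Longrightarrow> integrable (snd s) g \<Longrightarrow>
     sm_integral s (\<lambda>x. f x + g x) = sm_integral s f + sm_integral s g"
  by (simp add: sm_integral_def scaleR_right_distrib)

lemma sm_integral_diff:
  "integrable (snd s) f \<Longrightarrow> integrable (snd s) g \<Longrightarrow>
     sm_integral s (\<lambda>x. f x - g x) = sm_integral s f - sm_integral s g"
  by (simp add: sm_integral_def scaleR_right_diff_distrib)

lemma sm_integral_cmult:
  fixes f :: "real \<Rightarrow> complex"
  shows "sm_integral s (\<lambda>x. c * f x) = c * sm_integral s f"
  by (simp add: sm_integral_def)

lemma ctrans_add:
  assumes s: "concentrated \<Gamma> s" "compact \<Gamma>" and f: "density_on \<Gamma> f" "density_on \<Gamma> g" and z: "z \<notin> complex_of_real ` \<Gamma>"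
  shows "ctrans s (\<lambda>z. f z + g z) z = ctrans s f z + ctrans s g z"
  unfolding ctrans_def add_divide_distrib
  by (intro sm_integral_add kernel_integrable[OF s _ z] f)

lemma ctrans_cmult: "ctrans s (\<lambda>z. c * f z) z = c * ctrans s f z"
  unfolding ctrans_def by (simp flip: sm_integral_cmult)

text \<open>The difference of the kernels at \<open>u\<close> and \<open>z\<close> is
  \<open>z - u\<close> times their product, which gives a Lipschitz bound near
  \<open>z\<close>.\<close>

lemma ctrans_continuous:
  assumes s: "concentrated \<Gamma> s" "compact \<Gamma>" and f: "density_on \<Gamma> f"
  shows "continuous_on (- (complex_of_real ` \<Gamma>)) (ctrans s f)"
proof -
  have op: "open (- (complex_of_real ` \<Gamma>))"
    using compact_imp_closed[OF compact_of_real_image[OF s(2)]] by (rule open_Compl)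
  have "isCont (ctrans s f) z" if "z \<in> - (complex_of_real ` \<Gamma>)" for z
  proof -
    have z: "z \<notin> complex_of_real ` \<Gamma>" using that by simp
    obtain d where d: "0 < d" "\<And>x. x \<in> \<Gamma> \<Longrightarrow> d \<le> norm (z - of_real x)"
      using off_compact_distance[OF s(2) z] by blast
    obtain K where K: "0 < K" "\<And>x. x \<in> \<Gamma> \<Longrightarrow> norm (f (of_real x)) \<le> K"
      using density_on_bounded[OF s(2) f] by blast
    let ?C = "K * (2 / d * (1 / d)) * measure (snd s) UNIV"
    have "((\<lambda>u. ctrans s f u - ctrans s f z) \<longlongrightarrow> 0) (at z)"
    proof (rule Lim_null_comparison)
      show "((\<lambda>u. norm (u - z) * ?C) \<longlongrightarrow> 0) (at z)"
        by (intro tendsto_mult_left_zero tendsto_norm_zero LIM_zero tendsto_ident_at)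
      show "\<forall>\<^sub>F u in at z. norm (ctrans s f u - ctrans s f z) \<le> norm (u - z) * ?C"
        unfolding eventually_at
      proof (intro exI[of _ "d / 2"] conjI ballI impI)
        fix u assume u: "u \<noteq> z \<and> dist u z < d / 2"
        have ux: "d / 2 \<le> norm (u - of_real x)" if "x \<in> \<Gamma>" for x
          using d(2)[OF that] u norm_triangle_ineq4[of "u - of_real x" "u - z"] by (auto simp: dist_norm)
        have un: "u \<notin> complex_of_real ` \<Gamma>" using ux d(1) by force
        have "ctrans s f u - ctrans s f z = sm_integral s (\<lambda>x. f (of_real x) / (u - of_real x) - f (of_real x) / (z - of_real x))"
          unfolding ctrans_def by (intro sm_integral_diff[symmetric] kernel_integrable[OF s f] un z)
        also have "norm \<dots> \<le> norm (u - z) * (K * (2 / d * (1 / d))) * measure (snd s) UNIV"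
        proof (rule sm_integral_norm_le[OF s])
          fix x assume x: "x \<in> \<Gamma>"
          have nz: "u - of_real x \<noteq> 0" "z - of_real x \<noteq> 0" using x un z by auto
          have "f (of_real x) / (u - of_real x) - f (of_real x) / (z - of_real x) =
             (z - u) * (f (of_real x) * (1 / (u - of_real x) * (1 / (z - of_real x))))"
            using nz by (simp add: field_simps)
          also have "norm \<dots> \<le> norm (u - z) * (K * (2 / d * (1 / d)))"
            unfolding norm_mult norm_minus_commute[of z u]
          proof (intro mult_mono mult_left_mono)
            show "norm (1 / (u - of_real x)) \<le> 2 / d"
              using frac_le[of 1 1 "d / 2" "norm (u - of_real x)"] ux[OF x] d(1) by (simp add: norm_divide)
            show "norm (1 / (z - of_real x)) \<le> 1 / d"
              using d x by (simp add: norm_divide frac_le)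
          qed (use K x d in auto)
          finally show "norm (f (of_real x) / (u - of_real x) - f (of_real x) / (z - of_real x))
             \<le> norm (u - z) * (K * (2 / d * (1 / d)))" .
        qed (use K d in auto)
        finally show "norm (ctrans s f u - ctrans s f z) \<le> norm (u - z) * ?C" by (simp add: mult.assoc)
      qed (use d in auto)
    qed
    then show ?thesis unfolding isCont_def by (rule Lim_null[THEN iffD2])
  qed
  then show ?thesis using op by (simp add: continuous_on_eq_continuous_at)
qed

lemma borel_measurable_cnj: "f \<in> borel_measurable M \<Longrightarrow> (\<lambda>x. cnj (f x)) \<in> borel_measurable M"
  by (rule measurable_compose[OF _ borel_measurable_continuous_onI]) (auto intro: continuous_intros)

lemma sm_integral_cnj: "cnj (sm_integral s f) = sm_integral s (\<lambda>x. cnj (f x))"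
  by (simp add: sm_integral_def)

lemma sm_integral_real:
  assumes s: "concentrated \<Gamma> s" "compact \<Gamma>" and f: "density_on \<Gamma> f"
    and re: "\<And>x. x \<in> \<Gamma> \<Longrightarrow> f (of_real x) \<in> \<real>"
  shows "sm_integral s (\<lambda>x. f (of_real x)) \<in> \<real>"
proof -
  have "cnj (sm_integral s (\<lambda>x. f (of_real x))) = sm_integral s (\<lambda>x. f (of_real x))"
    unfolding sm_integral_cnj
    by (rule sm_integral_cong[OF s]) (use f re in \<open>auto simp: density_on_def Reals_cnj_iff intro: borel_measurable_cnj\<close>)
  then show ?thesis by (simp add: Reals_cnj_iff)
qed

lemma ctrans_cnj:
  assumes s: "concentrated \<Gamma> s" "compact \<Gamma>" and f: "density_on \<Gamma> f"
    and re: "\<And>x. x \<in> \<Gamma> \<Longrightarrow> f (of_real x) \<in> \<real>"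
  shows "ctrans s f (cnj z) = cnj (ctrans s f z)"
proof -
  have [measurable]: "(\<lambda>x. f (of_real x)) \<in> borel_measurable borel" using f by (simp add: density_on_def)
  have [measurable]: "(\<lambda>x. cnj (f (of_real x))) \<in> borel_measurable borel"
    by (intro borel_measurable_cnj) measurable
  show ?thesis unfolding ctrans_def sm_integral_cnj
    by (rule sm_integral_cong[OF s]) (use re in \<open>auto simp: Reals_cnj_iff\<close>)
qed

text \<open>A point \<open>\<i> * y\<close> has distance at least \<open>y\<close> from the real
  line. This decay is what later detects constants and linear terms.\<close>

lemma ctrans_i_bound:
  assumes s: "concentrated \<Gamma> s" "compact \<Gamma>" and f: "density_on \<Gamma> f"
  obtains C where "0 < C" "\<And>y. 0 < y \<Longrightarrow> norm (ctrans s f (\<i> * of_real y)) \<le> C / y"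
proof -
  obtain K where K: "0 < K" "\<And>x. x \<in> \<Gamma> \<Longrightarrow> norm (f (of_real x)) \<le> K"
    using density_on_bounded[OF s(2) f] by blast
  have "norm (ctrans s f (\<i> * of_real y)) \<le> (K * measure (snd s) UNIV + 1) / y" if y: "0 < y" for y
  proof -
    have "norm (ctrans s f (\<i> * of_real y)) \<le> K / y * measure (snd s) UNIV"
      unfolding ctrans_def
    proof (rule sm_integral_norm_le[OF s])
      fix x assume x: "x \<in> \<Gamma>"
      have "y \<le> norm (\<i> * of_real y - complex_of_real x)"
        using abs_Im_le_cmod[of "\<i> * of_real y - complex_of_real x"] y by simp
      then show "norm (f (of_real x) / (\<i> * of_real y - of_real x)) \<le> K / y"
        using K x y by (auto simp: norm_divide intro!: frac_le)
    qed (use K y in auto)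
    also have "\<dots> \<le> (K * measure (snd s) UNIV + 1) / y" using y by (simp add: field_simps)
    finally show ?thesis .
  qed
  moreover have "0 < K * measure (snd s) UNIV + 1" using K by (auto intro!: add_nonneg_pos)
  ultimately show thesis using that by blast
qed

section \<open>Exchange of integrals and change of density\<close>

lemma sm_integral_swap:
  fixes k :: "real \<Rightarrow> real \<Rightarrow> complex"
  assumes s: "concentrated \<Gamma> s" "compact \<Gamma>" and t: "concentrated \<Gamma>' t" "compact \<Gamma>'"
    and k [measurable]: "(\<lambda>(x, y). k x y) \<in> borel_measurable (borel \<Otimes>\<^sub>M borel)"
    and K: "\<And>x y. x \<in> \<Gamma> \<Longrightarrow> y \<in> \<Gamma>' \<Longrightarrow> norm (k x y) \<le> K"
  shows "sm_integral s (\<lambda>x. sm_integral t (\<lambda>y. k x y)) = sm_integral t (\<lambda>y. sm_integral s (\<lambda>x. k x y))"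
proof -
  interpret s: finite_measure "snd s" using s by (simp add: concentrated_def)
  interpret t: finite_measure "snd t" using t by (simp add: concentrated_def)
  interpret pair_sigma_finite "snd s" "snd t" ..
  have [measurable_cong]: "sets (snd s) = sets borel" "sets (snd t) = sets borel"
    using s t by (simp_all add: concentrated_def)
  have fin: "finite_measure (snd s \<Otimes>\<^sub>M snd t)"
    by (rule finite_measureI)
       (simp add: space_pair_measure t.emeasure_pair_measure_Times s.emeasure_eq_measure t.emeasure_eq_measure flip: ennreal_mult)
  have "integrable (snd s \<Otimes>\<^sub>M snd t) (\<lambda>(x, y). k x y)"
  proof (rule finite_measure.integrable_const_bound[OF fin])
    have "AE x in snd s. AE y in snd t. norm (k x y) \<le> K"
      using concentrated_AE[OF s]
    proof eventually_elim
      case (elim x)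
      show ?case using concentrated_AE[OF t] by eventually_elim (use elim K in auto)
    qed
    then have "AE p in snd s \<Otimes>\<^sub>M snd t. norm (k (fst p) (snd p)) \<le> K"
      by (intro AE_pair_measure) (auto simp: case_prod_beta)
    then show "AE p in snd s \<Otimes>\<^sub>M snd t. norm (case p of (x, y) \<Rightarrow> k x y) \<le> K"
      by (simp add: case_prod_beta)
  qed measurable
  then have "(\<integral>y. \<integral>x. k x y \<partial>snd s \<partial>snd t) = (\<integral>x. \<integral>y. k x y \<partial>snd t \<partial>snd s)"
    by (rule Fubini_integral)
  then show ?thesis by (simp add: sm_integral_def)
qed

lemma concentrated_infD: "concentrated_inf \<Gamma> s \<Longrightarrow> concentrated \<Gamma> s"
  by (simp add: concentrated_inf_def)

lemma concentrated_inf_mass: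
  assumes "concentrated_inf \<Gamma> s"
  shows "0 < measure (snd s) UNIV"
proof -
  interpret finite_measure "snd s" using assms by (simp add: concentrated_def concentrated_inf_def)
  have "emeasure (snd s) (- {}) \<noteq> 0" using assms unfolding concentrated_inf_def by blast
  then show ?thesis by (simp add: emeasure_eq_measure zero_less_measure_iff)
qed

lemma concentrated_sm_density:
  fixes f :: "real \<Rightarrow> real"
  assumes s: "concentrated_inf \<Gamma> s" "compact \<Gamma>" and f: "f \<in> borel_measurable borel"
    and K: "\<And>x. x \<in> \<Gamma> \<Longrightarrow> \<bar>f x\<bar> \<le> K"
    and sign: "(\<forall>x\<in>\<Gamma>. 0 < f x) \<or> (\<forall>x\<in>\<Gamma>. f x < 0)"
  shows "concentrated_inf \<Gamma> (sm_density f s)"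
    and "(g :: real \<Rightarrow> complex) \<in> borel_measurable borel \<Longrightarrow>
      sm_integral (sm_density f s) g = sm_integral s (\<lambda>x. of_real (f x) * g x)"
proof -
  define M where "M = snd s"
  have s': "concentrated \<Gamma> s" using s(1) by (rule concentrated_infD)
  interpret finite_measure M using s' by (simp add: concentrated_def M_def)
  have sets: "sets M = sets borel" using s' by (simp add: concentrated_def M_def)
  have [measurable_cong]: "sets M = sets borel" by (rule sets)
  have sp: "space M = UNIV" using sets by (auto dest: sets_eq_imp_space_eq)
  have [measurable]: "f \<in> borel_measurable borel" by fact
  have ae: "AE x in M. x \<in> \<Gamma>" unfolding M_def by (rule concentrated_AE[OF s' s(2)])
  have \<Gamma>: "\<Gamma> \<in> sets borel" using s(2) by (simp add: compact_imp_closed)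
  have fin: "finite_measure (density M (\<lambda>x. ennreal \<bar>f x\<bar>))"
  proof (rule finite_measureI)
    have "emeasure (density M (\<lambda>x. ennreal \<bar>f x\<bar>)) (space (density M (\<lambda>x. ennreal \<bar>f x\<bar>)))
        = (\<integral>\<^sup>+x. ennreal \<bar>f x\<bar> \<partial>M)"
      by (simp add: emeasure_density sp)
    also have "\<dots> \<le> (\<integral>\<^sup>+x. ennreal K \<partial>M)"
      using ae by (intro nn_integral_mono_AE) (auto elim!: eventually_mono intro!: ennreal_leI K)
    also have "\<dots> < \<infinity>" by (simp add: ennreal_mult_less_top emeasure_eq_measure)
    finally show "emeasure (density M (\<lambda>x. ennreal \<bar>f x\<bar>)) (space (density M (\<lambda>x. ennreal \<bar>f x\<bar>))) \<noteq> \<infinity>" by simp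
  qed
  have null: "emeasure (density M (\<lambda>x. ennreal \<bar>f x\<bar>)) (- F) = 0 \<longleftrightarrow> (AE x in M. x \<in> - F \<longrightarrow> f x = 0)"
    if "F \<in> sets borel" for F
  proof -
    have "- F \<in> sets M" using that by (auto simp: sets)
    then have "emeasure (density M (\<lambda>x. ennreal \<bar>f x\<bar>)) (- F) = 0 \<longleftrightarrow>
        - F \<in> null_sets (density M (\<lambda>x. ennreal \<bar>f x\<bar>))" by auto
    also have "\<dots> \<longleftrightarrow> (AE x in M. x \<in> - F \<longrightarrow> f x = 0)"
      using \<open>- F \<in> sets M\<close> by (subst null_sets_density_iff) auto
    finally show ?thesis .
  qed
  have conc: "emeasure (density M (\<lambda>x. ennreal \<bar>f x\<bar>)) (- \<Gamma>) = 0"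
    unfolding null[OF \<Gamma>] using ae by eventually_elim auto
  have inf: "emeasure (density M (\<lambda>x. ennreal \<bar>f x\<bar>)) (- F) \<noteq> 0" if F: "finite F" for F
  proof
    have FB: "F \<in> sets borel" using finite_imp_closed[OF F] by (rule borel_closed)
    assume "emeasure (density M (\<lambda>x. ennreal \<bar>f x\<bar>)) (- F) = 0"
    then have "AE x in M. x \<in> - F \<longrightarrow> f x = 0" using null[OF FB] by simp
    then have "AE x in M. x \<in> F" using ae by eventually_elim (use sign in force)
    then have "emeasure M (- F) = 0"
      using FB AE_iff_measurable[of "- F" M "\<lambda>x. x \<in> F"] by (auto simp: sets sp)
    then show False using s(1) F by (simp add: concentrated_inf_def M_def)
  qed
  show "concentrated_inf \<Gamma> (sm_density f s)"
    using s' fin conc inf by (auto simp: concentrated_inf_def concentrated_def sm_density_def M_def)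
  \<comment> \<open>Since the mass is positive, the sign test inside \<open>sm_density\<close>
    cannot succeed for a negative density.\<close>
  have mpos: "\<not> (AE x in M. False)"
    using concentrated_inf_mass[OF s(1)] AE_iff_measurable[of UNIV M "\<lambda>_. False"]
    by (auto simp: sets sp measure_def simp flip: M_def)
  assume g [measurable]: "g \<in> borel_measurable borel"
  have int: "(\<integral>x. g x \<partial>density M (\<lambda>x. ennreal \<bar>f x\<bar>)) = (\<integral>x. \<bar>f x\<bar> *\<^sub>R g x \<partial>M)"
    by (rule integral_density) auto
  show "sm_integral (sm_density f s) g = sm_integral s (\<lambda>x. of_real (f x) * g x)"
    using sign
  proof
    assume pos: "\<forall>x\<in>\<Gamma>. 0 < f x"
    have "AE x in M. 0 \<le> f x" using ae by eventually_elim (use pos in force)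
    moreover have "(\<integral>x. \<bar>f x\<bar> *\<^sub>R g x \<partial>M) = (\<integral>x. of_real (f x) * g x \<partial>M)"
    proof (rule integral_cong_AE)
      show "AE x in M. \<bar>f x\<bar> *\<^sub>R g x = of_real (f x) * g x"
        using ae by eventually_elim (use pos in \<open>auto simp: scaleR_conv_of_real\<close>)
    qed measurable
    ultimately show ?thesis
      using int unfolding sm_integral_def sm_density_def M_def[symmetric] fst_conv snd_conv by simp
  next
    assume neg: "\<forall>x\<in>\<Gamma>. f x < 0"
    have "\<not> (AE x in M. 0 \<le> f x)"
    proof
      assume "AE x in M. 0 \<le> f x"
      then have "AE x in M. False" using ae by eventually_elim (use neg in force)
      with mpos show False by simp
    qed
    moreover have "(\<integral>x. \<bar>f x\<bar> *\<^sub>R g x \<partial>M) = (\<integral>x. - (of_real (f x) * g x) \<partial>M)"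
    proof (rule integral_cong_AE)
      show "AE x in M. \<bar>f x\<bar> *\<^sub>R g x = - (of_real (f x) * g x)"
        using ae by eventually_elim (use neg in \<open>auto simp: scaleR_conv_of_real\<close>)
    qed measurable
    ultimately show ?thesis
      using int unfolding sm_integral_def sm_density_def M_def[symmetric] fst_conv snd_conv by simp
  qed
qed

lemma nonzero_constant_sign:
  fixes f :: "real \<Rightarrow> real"
  assumes "continuous_on {a..b} f" "\<And>x. x \<in> {a..b} \<Longrightarrow> f x \<noteq> 0"
  shows "(\<forall>x\<in>{a..b}. 0 < f x) \<or> (\<forall>x\<in>{a..b}. f x < 0)"
proof (rule ccontr)
  assume "\<not> ?thesis"
  then obtain x y where xy: "x \<in> {a..b}" "y \<in> {a..b}" "f x \<le> 0" "0 \<le> f y" by force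
  have "connected (f ` {a..b})" using assms(1) by (intro connected_continuous_image) auto
  then have "0 \<in> f ` {a..b}" using connectedD_interval[of "f ` {a..b}" "f x" "f y" 0] xy by blast
  then show False using assms(2) by auto
qed

text \<open>A real continuous function without zeros has one sign on an interval, so it can be made
  part of a measure of constant sign. Every new generator is formed in this way.\<close>

lemma absorb_density:
  assumes s: "concentrated_inf {a..b} s" and f: "density_on {a..b} f"
    and re: "\<And>x. x \<in> {a..b} \<Longrightarrow> f (of_real x) \<in> \<real>" and nz: "\<And>x. x \<in> {a..b} \<Longrightarrow> f (of_real x) \<noteq> 0"
  shows "\<exists>s'. concentrated_inf {a..b} s' \<and> (\<forall>g z. density_on {a..b} g \<longrightarrow> ctrans s (\<lambda>z. f z * g z) z = ctrans s' g z)"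
proof -
  define h where "h x = Re (f (of_real x))" for x
  have fh: "f (of_real x) = of_real (h x)" if "x \<in> {a..b}" for x
    using re[OF that] by (simp add: h_def complex_eq_iff complex_is_Real_iff)
  have [measurable]: "(\<lambda>x. f (of_real x)) \<in> borel_measurable borel" using f by (simp add: density_on_def)
  have hm [measurable]: "h \<in> borel_measurable borel" unfolding h_def by measurable
  have hc: "continuous_on {a..b} h" unfolding h_def using f by (auto simp: density_on_def intro!: continuous_intros)
  have hnz: "h x \<noteq> 0" if "x \<in> {a..b}" for x using nz[OF that] fh[OF that] by auto
  obtain K where K: "\<And>x. x \<in> {a..b} \<Longrightarrow> norm (f (of_real x)) \<le> K"
    using density_on_bounded[OF compact_Icc f] by blast
  have hK: "\<bar>h x\<bar> \<le> K" if "x \<in> {a..b}" for x using K[OF that] fh[OF that] by simp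
  have sgn: "(\<forall>x\<in>{a..b}. 0 < h x) \<or> (\<forall>x\<in>{a..b}. h x < 0)"
    by (rule nonzero_constant_sign[OF hc]) (rule hnz)
  have D1: "concentrated_inf {a..b} (sm_density h s)"
    by (rule concentrated_sm_density(1)[OF s compact_Icc hm _ sgn]) (rule hK)
  have D2: "sm_integral (sm_density h s) g = sm_integral s (\<lambda>x. of_real (h x) * g x)"
    if "g \<in> borel_measurable borel" for g :: "real \<Rightarrow> complex"
    by (rule concentrated_sm_density(2)[OF s compact_Icc hm _ sgn that]) (rule hK)
  have eq: "sm_integral s (\<lambda>x. f (of_real x) * g x) = sm_integral (sm_density h s) g"
    if [measurable]: "g \<in> borel_measurable borel" for g
    unfolding D2[OF that]
    by (rule sm_integral_cong[OF concentrated_infD[OF s] compact_Icc]) (auto simp: fh)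
  have "ctrans s (\<lambda>z. f z * g z) z = ctrans (sm_density h s) g z" if g: "density_on {a..b} g" for g z
  proof -
    have [measurable]: "(\<lambda>x. g (of_real x)) \<in> borel_measurable borel" using g by (simp add: density_on_def)
    show ?thesis unfolding ctrans_def by (subst eq[symmetric]) auto
  qed
  then show ?thesis using D1 by blast
qed

section \<open>Lower bounds for the transform and absence of zeros\<close>

lemma integral_lower_bound:
  fixes f :: "real \<Rightarrow> real"
  assumes s: "concentrated \<Gamma> s" "compact \<Gamma>" and f: "integrable (snd s) f"
    and d: "\<And>x. x \<in> \<Gamma> \<Longrightarrow> d \<le> f x"
  shows "d * measure (snd s) UNIV \<le> (\<integral>x. f x \<partial>snd s)"
proof -
  interpret finite_measure "snd s" using s by (simp add: concentrated_def)
  have sp: "space (snd s) = UNIV" using s by (auto simp: concentrated_def dest: sets_eq_imp_space_eq)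
  have "d * measure (snd s) UNIV = (\<integral>x. d \<partial>snd s)" by (simp add: sp)
  also have "\<dots> \<le> (\<integral>x. f x \<partial>snd s)"
    using concentrated_AE[OF s] f by (intro integral_mono_AE) (auto intro: d elim!: eventually_mono)
  finally show ?thesis .
qed

lemma Im_ct_one:
  assumes s: "concentrated \<Gamma> s" "compact \<Gamma>" and z: "z \<notin> complex_of_real ` \<Gamma>"
  shows "Im (ctrans s (\<lambda>_. 1) z) = - (fst s * Im z * (\<integral>x. 1 / (cmod (z - of_real x))\<^sup>2 \<partial>snd s))"
proof -
  have "Im (ctrans s (\<lambda>_. 1) z) = fst s * (\<integral>x. Im (1 / (z - of_real x)) \<partial>snd s)"
    using kernel_integrable[OF s density_on_const z, of 1] by (simp add: ctrans_def sm_integral_def)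
  also have "(\<lambda>x. Im (1 / (z - of_real x))) = (\<lambda>x. - Im z * (1 / (cmod (z - of_real x))\<^sup>2))"
    using Im_pole[of 1 z] by auto
  also have "(\<integral>x. - Im z * (1 / (cmod (z - of_real x))\<^sup>2) \<partial>snd s) = - Im z * (\<integral>x. 1 / (cmod (z - of_real x))\<^sup>2 \<partial>snd s)"
    by (rule integral_mult_right_zero)
  finally show ?thesis by simp
qed

text \<open>Points of \<open>\<Gamma>\<close> lie within \<open>norm z + R\<close> of
  \<open>z\<close>, where \<open>R\<close> bounds \<open>\<Gamma>\<close>. Bounding the imaginary
  part rather than the modulus makes the estimate insensitive to real additive constants.\<close>

lemma Im_ct_lower_bound:
  assumes s: "concentrated_inf \<Gamma> s" "compact \<Gamma>"
  obtains R m where "0 < R" "0 < m"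
    "\<And>z. Im z \<noteq> 0 \<Longrightarrow> \<bar>Im z\<bar> * m / (norm z + R)\<^sup>2 \<le> \<bar>Im (ctrans s (\<lambda>_. 1) z)\<bar>"
proof -
  have s': "concentrated \<Gamma> s" using s(1) by (rule concentrated_infD)
  obtain R where R: "0 < R" "\<And>x. x \<in> \<Gamma> \<Longrightarrow> norm (complex_of_real x) \<le> R"
    using density_on_bounded[OF s(2) density_on_ident] by blast
  define m where "m = measure (snd s) UNIV"
  have m: "m > 0" using concentrated_inf_mass[OF s(1)] by (simp add: m_def)
  show thesis
  proof (rule that[OF R(1) m])
    fix z assume z: "Im z \<noteq> 0"
    then have zn: "z \<notin> complex_of_real ` \<Gamma>" by auto
    have zx: "z \<noteq> of_real x" for x using z by auto
    have int: "integrable (snd s) (\<lambda>x. 1 / (cmod (z - of_real x))\<^sup>2)"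
    proof -
      have "integrable (snd s) (\<lambda>x. Im (1 / (z - of_real x)))"
        using kernel_integrable[OF s' s(2) density_on_const zn, of 1] by simp
      then have "integrable (snd s) (\<lambda>x. (- 1 / Im z) * Im (1 / (z - of_real x)))"
        by (rule integrable_mult_right)
      moreover have "(\<lambda>x. (- 1 / Im z) * Im (1 / (z - of_real x))) = (\<lambda>x. 1 / (cmod (z - of_real x))\<^sup>2)"
        using z Im_pole[of 1 z] by auto
      ultimately show ?thesis by metis
    qed
    have "1 / (norm z + R)\<^sup>2 * m \<le> (\<integral>x. 1 / (cmod (z - of_real x))\<^sup>2 \<partial>snd s)"
      unfolding m_def
    proof (rule integral_lower_bound[OF s' s(2) int])
      fix x assume x: "x \<in> \<Gamma>"
      have "cmod (z - of_real x) \<le> norm z + R"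
        using norm_triangle_ineq4[of z "of_real x"] R(2)[OF x] by simp
      then show "1 / (norm z + R)\<^sup>2 \<le> 1 / (cmod (z - of_real x))\<^sup>2"
        using zx[of x] R(1) by (intro divide_left_mono power_mono mult_pos_pos zero_less_power add_nonneg_pos) auto
    qed
    then have "\<bar>Im z\<bar> * (1 / (norm z + R)\<^sup>2 * m) \<le> \<bar>Im z\<bar> * (\<integral>x. 1 / (cmod (z - of_real x))\<^sup>2 \<partial>snd s)"
      by (rule mult_left_mono) simp
    also have "\<dots> \<le> \<bar>Im (ctrans s (\<lambda>_. 1) z)\<bar>"
      using s' unfolding Im_ct_one[OF s' s(2) zn] by (auto simp: concentrated_def abs_mult mult_left_mono)
    finally show "\<bar>Im z\<bar> * m / (norm z + R)\<^sup>2 \<le> \<bar>Im (ctrans s (\<lambda>_. 1) z)\<bar>" by (simp add: field_simps)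
  qed
qed

lemma Im_ct_nonzero:
  assumes s: "concentrated_inf \<Gamma> s" "compact \<Gamma>" and z: "Im z \<noteq> 0"
  shows "Im (ctrans s (\<lambda>_. 1) z) \<noteq> 0"
proof -
  obtain R m where R: "0 < R" "0 < m"
    "\<And>z. Im z \<noteq> 0 \<Longrightarrow> \<bar>Im z\<bar> * m / (norm z + R)\<^sup>2 \<le> \<bar>Im (ctrans s (\<lambda>_. 1) z)\<bar>"
    using Im_ct_lower_bound[OF s] by blast
  have "0 < \<bar>Im z\<bar> * m / (norm z + R)\<^sup>2" using z R(1,2)
    by (intro divide_pos_pos mult_pos_pos zero_less_power add_nonneg_pos) auto
  then show ?thesis using R(3)[OF z] by linarith
qed

text \<open>Off the real line the imaginary part does not vanish; at a real point outside the
  interval the kernel keeps one sign.\<close>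

lemma ctrans_nonzero:
  assumes s: "concentrated_inf {a..b} s" and z: "z \<notin> complex_of_real ` {a..b}"
  shows "ctrans s (\<lambda>_. 1) z \<noteq> 0"
proof (cases "Im z = 0")
  case False
  then show ?thesis using Im_ct_nonzero[OF s compact_Icc False] by auto
next
  case True
  then obtain x where zx: "z = of_real x" by (metis complex_is_Real_iff Reals_cases)
  have s': "concentrated {a..b} s" using s by (rule concentrated_infD)
  have x: "x \<notin> {a..b}" using z zx by auto
  have int: "integrable (snd s) (\<lambda>t. complex_of_real (1 / (x - t)))"
    using kernel_integrable[OF s' compact_Icc density_on_const z, of 1] unfolding zx by simp
  then have int': "integrable (snd s) (\<lambda>t. 1 / (x - t))"
    by (simp only: complex_of_real_integrable_eq)
  have ctrans: "ctrans s (\<lambda>_. 1) z = of_real (fst s * (\<integral>t. 1 / (x - t) \<partial>snd s))"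
  proof -
    have "(\<integral>t. 1 / (z - of_real t) \<partial>snd s) = (\<integral>t. complex_of_real (1 / (x - t)) \<partial>snd s)"
      by (simp add: zx)
    also have "\<dots> = of_real (\<integral>t. 1 / (x - t) \<partial>snd s)" by (rule integral_complex_of_real)
    finally show ?thesis by (simp add: ctrans_def sm_integral_def scaleR_conv_of_real)
  qed
  have m: "0 < measure (snd s) UNIV" using concentrated_inf_mass[OF s] .
  have "(\<integral>t. 1 / (x - t) \<partial>snd s) \<noteq> 0"
  proof (cases "x < a")
    case True
    have "1 / (b - x) * measure (snd s) UNIV \<le> (\<integral>t. - (1 / (x - t)) \<partial>snd s)"
    proof (rule integral_lower_bound[OF s' compact_Icc])
      fix t assume "t \<in> {a..b}"
      then have "1 / (b - x) \<le> 1 / (t - x)" using True by (intro divide_left_mono) auto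
      also have "1 / (t - x) = - (1 / (x - t))" by (metis minus_diff_eq minus_divide_right)
      finally show "1 / (b - x) \<le> - (1 / (x - t))" .
    qed (use int' in simp)
    moreover have "a \<le> b"
    proof (rule ccontr)
      assume "\<not> a \<le> b"
      then have "emeasure (snd s) (- {}) = 0" using s' by (simp add: concentrated_def)
      with m show False by (simp add: measure_def)
    qed
    then have "0 < 1 / (b - x) * measure (snd s) UNIV" using m True by simp
    ultimately show ?thesis by auto
  next
    case False
    have "1 / (x - a) * measure (snd s) UNIV \<le> (\<integral>t. 1 / (x - t) \<partial>snd s)"
    proof (rule integral_lower_bound[OF s' compact_Icc int'])
      fix t assume "t \<in> {a..b}"
      then show "1 / (x - a) \<le> 1 / (x - t)" using x False by (intro divide_left_mono) auto
    qed
    moreover have "a \<le> b"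
    proof (rule ccontr)
      assume "\<not> a \<le> b"
      then have "emeasure (snd s) (- {}) = 0" using s' by (simp add: concentrated_def)
      with m show False by (simp add: measure_def)
    qed
    then have "0 < 1 / (x - a) * measure (snd s) UNIV" using m x False by auto
    ultimately show ?thesis by auto
  qed
  then show ?thesis using s' unfolding ctrans by (auto simp: concentrated_def)
qed

section \<open>The inverse measure\<close>

lemma kernel_sum_left_mono:
  fixes w :: "real \<Rightarrow> real"
  assumes "\<And>y. y \<in> A \<Longrightarrow> 0 \<le> w y" "\<And>y. y \<in> A \<Longrightarrow> u < y" "x \<le> u"
  shows "(\<Sum>y\<in>A. w y / (u - y)) \<le> (\<Sum>y\<in>A. w y / (x - y))"
proof (rule sum_mono)
  fix y assume y: "y \<in> A"
  have "w y / (y - x) \<le> w y / (y - u)"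
    using assms y by (intro divide_left_mono mult_pos_pos) (auto simp: less_imp_le intro: le_less_trans)
  moreover have "w y / (u - y) = - (w y / (y - u))" "w y / (x - y) = - (w y / (y - x))"
    by (metis minus_diff_eq minus_divide_right)+
  ultimately show "w y / (u - y) \<le> w y / (x - y)" by simp
qed

lemma kernel_sum_right_mono:
  fixes w :: "real \<Rightarrow> real"
  assumes "\<And>y. y \<in> A \<Longrightarrow> 0 \<le> w y" "\<And>y. y \<in> A \<Longrightarrow> y < u" "u \<le> x"
  shows "(\<Sum>y\<in>A. w y / (x - y)) \<le> (\<Sum>y\<in>A. w y / (u - y))"
proof (rule sum_mono)
  fix y assume "y \<in> A"
  then show "w y / (x - y) \<le> w y / (u - y)"
    using assms by (intro divide_left_mono mult_pos_pos) (auto simp: less_imp_le intro: less_le_trans)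
qed

lemma ctrans_one_norm_le:
  assumes s: "concentrated \<Gamma> s" "compact \<Gamma>" and d: "0 < d" "\<And>x. x \<in> \<Gamma> \<Longrightarrow> d \<le> norm (z - of_real x)"
  shows "norm (ctrans s (\<lambda>_. 1) z) \<le> measure (snd s) UNIV / d"
proof -
  have "norm (ctrans s (\<lambda>_. 1) z) \<le> 1 / d * measure (snd s) UNIV"
    unfolding ctrans_def using d by (intro sm_integral_norm_le[OF s]) (auto simp: norm_divide intro!: frac_le)
  then show ?thesis by simp
qed

text \<open>The function tends to \<open>c\<close> far from the interval. Having no zeros on a
  half-line it keeps its sign there, and the limit \<open>c\<close> inherits that sign
  weakly.\<close>

lemma one_sided_sign:
  fixes c :: real and a b :: real
  defines "Tr s x \<equiv> Re (of_real c + ctrans s (\<lambda>_. 1) (complex_of_real x))"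
  assumes s: "concentrated_inf {a..b} s"
    and nz: "\<And>x. x \<notin> {a..b} \<Longrightarrow> Tr s x \<noteq> 0"
  shows "u < a \<Longrightarrow> Tr s u < 0 \<Longrightarrow> c \<le> 0" and "b < u \<Longrightarrow> 0 < Tr s u \<Longrightarrow> 0 \<le> c"
proof -
  have s': "concentrated {a..b} s" using s by (rule concentrated_infD)
  define m where "m = measure (snd s) UNIV"
  have m: "m > 0" using concentrated_inf_mass[OF s] by (simp add: m_def)
  have cont: "continuous_on S (Tr s)" if "S \<inter> {a..b} = {}" for S
  proof -
    have "continuous_on S (\<lambda>x. ctrans s (\<lambda>_. 1) (complex_of_real x))"
      by (rule continuous_on_compose2[OF ctrans_continuous[OF s' compact_Icc density_on_const]])
         (use that in \<open>auto intro!: continuous_intros\<close>)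
    then show ?thesis unfolding Tr_def[abs_def] by (intro continuous_intros)
  qed
  have far: "\<bar>Tr s x - c\<bar> \<le> m / d" if "0 < d" "\<And>t. t \<in> {a..b} \<Longrightarrow> d \<le> \<bar>x - t\<bar>" for x d
  proof -
    have "norm (ctrans s (\<lambda>_. 1) (complex_of_real x)) \<le> m / d" unfolding m_def
      by (rule ctrans_one_norm_le[OF s' compact_Icc that(1)])
         (use that(2) in \<open>simp flip: of_real_diff del: of_real_diff\<close>)
    then show ?thesis unfolding Tr_def using abs_Re_le_cmod[of "ctrans s (\<lambda>_. 1) (complex_of_real x)"] by simp
  qed
  {
    assume u: "u < a" "Tr s u < 0"
    show "c \<le> 0"
    proof (rule ccontr)
      assume c: "\<not> c \<le> 0"
      \<comment> \<open>At distance \<open>q\<close> from the interval the transform is at most half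
        of \<open>c\<close> in modulus, so the function has the sign of \<open>c\<close>
        there.\<close>
      define q where "q = 2 * m / c"
      have q: "q > 0" "m / q = c / 2" using c m by (simp_all add: q_def)
      define x where "x = u - q"
      have xu: "x < u" using q by (simp add: x_def)
      have "\<bar>Tr s x - c\<bar> \<le> m / q"
        using q u by (intro far) (auto simp: x_def)
      then have "Tr s x > 0" unfolding q(2) abs_le_iff using c by linarith
      then obtain v where "x \<le> v" "v \<le> u" "Tr s v = 0"
        using IVT2'[of "Tr s" u 0 x] u xu cont[of "{x..u}"] by auto
      then show False using nz[of v] u by auto
    qed
  }
  {
    assume u: "b < u" "0 < Tr s u"
    show "0 \<le> c"
    proof (rule ccontr)
      assume c: "\<not> 0 \<le> c"
      define q where "q = 2 * m / (- c)"
      have q: "q > 0" "m / q = - c / 2" using c m by (simp_all add: q_def divide_pos_neg)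
      define x where "x = u + q"
      have xu: "u < x" using q by (simp add: x_def)
      have "\<bar>Tr s x - c\<bar> \<le> m / q"
        using q u by (intro far) (auto simp: x_def)
      then have "Tr s x < 0" unfolding q(2) abs_le_iff using c by linarith
      then obtain v where "u \<le> v" "v \<le> x" "Tr s v = 0"
        using IVT2'[of "Tr s" x 0 u] u xu cont[of "{u..x}"] by auto
      then show False using nz[of v] u by auto
    qed
  }
qed

text \<open>The point is compactness of the discretised inverses. Their values at
  \<open>\<i>\<close> bound slopes, constants and masses, and the absence of real zeros of the limit
  off \<open>{a..b}\<close> keeps their poles close to that interval.\<close>

lemma inverse_pos:
  fixes a b c :: real
  assumes s: "concentrated_inf {a..b} s" and s1: "fst s = 1"
    and nz: "\<And>x. x \<notin> {a..b} \<Longrightarrow> of_real c + ctrans s (\<lambda>_. 1) (complex_of_real x) \<noteq> 0"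
  obtains \<nu> \<beta> \<gamma> where "finite_measure \<nu>" "sets \<nu> = sets borel" "emeasure \<nu> (- {a..b}) = 0"
    "\<And>z. Im z \<noteq> 0 \<Longrightarrow> 1 / (of_real c + ctrans s (\<lambda>_. 1) z) =
       of_real \<beta> * z + of_real \<gamma> - (\<integral>x. 1 / (z - of_real x) \<partial>\<nu>)"
proof -
  have s': "concentrated {a..b} s" using s by (rule concentrated_infD)
  define M where "M = snd s"
  have M: "finite_measure M" "sets M = sets borel" "emeasure M (- {a..b}) = 0"
    using s' by (simp_all add: concentrated_def M_def)
  have mass: "0 < measure M UNIV" using concentrated_inf_mass[OF s] by (simp add: M_def)
  have ab: "a \<le> b"
  proof (rule ccontr)
    assume "\<not> a \<le> b"
    then have "emeasure M (- {}) = 0" using M(3) by simp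
    with mass show False by (simp add: measure_def)
  qed
  have spM: "space M = UNIV" using M(2) by (auto dest: sets_eq_imp_space_eq)
  define T where "T z = of_real c + ctrans s (\<lambda>_. 1) z" for z :: complex
  define Tr where "Tr x = Re (T (of_real x))" for x :: real
  have Tr: "T (of_real x) = of_real (Tr x)" for x
  proof -
    have "T (of_real x) = cnj (T (of_real x))"
      using ctrans_cnj[OF s' compact_Icc density_on_const, of 1 "of_real x"] by (simp add: T_def)
    then have "Im (T (of_real x)) = 0" by (simp add: complex_eq_iff)
    then show ?thesis by (simp add: Tr_def complex_eq_iff)
  qed
  have Trnz: "Tr x \<noteq> 0" if "x \<notin> {a..b}" for x
    using nz[OF that] Tr[of x] unfolding T_def by auto
  define A where "A n = {y \<in> grid_round b n ` {a..b}. 0 < measure M (grid_round b n -` {y} \<inter> {a..b})}" for n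
  define w where "w n y = measure M (grid_round b n -` {y} \<inter> {a..b})" for n y
  have finA: "finite (A n)" for n unfolding A_def using finite_grid_round by auto
  have Aab: "A n \<subseteq> {a..b}" for n
  proof
    fix y assume "y \<in> A n"
    then obtain x where "x \<in> {a..b}" "y = grid_round b n x" by (auto simp: A_def)
    then show "y \<in> {a..b}" using grid_round_ge[of x b n] grid_round_le[of b n x] by simp
  qed
  have wpos: "0 < w n y" if "y \<in> A n" for n y using that by (simp add: A_def w_def)
  have restrict: "(\<integral>x. f (grid_round b n x) \<partial>M) = (\<Sum>y\<in>A n. w n y *\<^sub>R f y)"
    if "continuous_on UNIV f" for f :: "real \<Rightarrow> 'a::{banach, second_countable_topology}" and n
    unfolding grid_round_integral[OF M that] w_def
  proof (rule sum.mono_neutral_right)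
    show "\<forall>i\<in>grid_round b n ` {a..b} - A n. measure M (grid_round b n -` {i} \<inter> {a..b}) *\<^sub>R f i = 0"
      by (auto simp: A_def zero_less_measure_iff)
  qed (auto simp: A_def finite_grid_round)
  have Ane: "A n \<noteq> {}" for n
    using restrict[of "\<lambda>_. 1 :: real" n] mass by (auto simp: spM)
  define Tn where "Tn n z = complex_of_real c + (\<Sum>y\<in>A n. of_real (w n y) / (z - of_real y))" for n z
  have conv: "(\<lambda>n. Tn n z) \<longlonglongrightarrow> T z" if z: "z \<notin> complex_of_real ` {a..b}" for z
  proof -
    \<comment> \<open>Clamping \<open>t\<close> to the interval makes the kernel continuous on the
      whole line, also for a real \<open>z\<close> outside the interval.\<close>
    define H where "H t = 1 / (z - complex_of_real (max a (min b t)))" for t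
    have cl: "max a (min b t) \<in> {a..b}" for t using ab by auto
    have Hc: "continuous_on UNIV H" unfolding H_def
      by (intro continuous_intros) (use z cl in force)
    have "range H = H ` {a..b}"
    proof safe
      fix t show "H t \<in> H ` {a..b}" using cl[of t] by (intro image_eqI[of _ _ "max a (min b t)"]) (auto simp: H_def)
    qed auto
    moreover have "compact (H ` {a..b})"
      by (intro compact_continuous_image continuous_on_subset[OF Hc]) auto
    ultimately have Hb: "bounded (range H)" using compact_imp_bounded by metis
    have "(\<lambda>n. \<integral>x. H (grid_round b n x) \<partial>M) \<longlonglongrightarrow> (\<integral>x. H x \<partial>M)"
      by (rule grid_round_integral_tendsto[OF M Hc Hb])
    moreover have "(\<integral>x. H (grid_round b n x) \<partial>M) = (\<Sum>y\<in>A n. of_real (w n y) / (z - of_real y))" for n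
      unfolding restrict[OF Hc]
    proof (rule sum.cong)
      fix y assume "y \<in> A n"
      then have "y \<in> {a..b}" using Aab by blast
      then show "w n y *\<^sub>R H y = of_real (w n y) / (z - of_real y)" by (simp add: H_def scaleR_conv_of_real)
    qed simp
    moreover have "(\<integral>x. H x \<partial>M) = ctrans s (\<lambda>_. 1) z"
    proof -
      have "sm_integral s H = ctrans s (\<lambda>_. 1) z" unfolding ctrans_def
        by (rule sm_integral_cong[OF s' compact_Icc])
           (auto simp: H_def intro: borel_measurable_continuous_onI[OF Hc])
      then show ?thesis using s1 by (simp add: sm_integral_def M_def)
    qed
    ultimately show ?thesis unfolding Tn_def T_def by (simp add: tendsto_add)
  qed
  define Tnr where "Tnr n x = c + (\<Sum>y\<in>A n. w n y / (x - y))" for n x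
  have Tnr: "Tn n (of_real x) = of_real (Tnr n x)" for n x by (simp add: Tn_def Tnr_def)
  have convr: "(\<lambda>n. Tnr n x) \<longlonglongrightarrow> Tr x" if "x \<notin> {a..b}" for x
  proof -
    have "(\<lambda>n. Tn n (of_real x)) \<longlonglongrightarrow> T (of_real x)" using that by (intro conv) auto
    then show ?thesis unfolding Tnr Tr by (rule tendsto_of_real_iff[THEN iffD1])
  qed
  \<comment> \<open>All data of one inverse form a tuple, so that a single choice selects them for
    every \<open>n\<close>.\<close>
  define inv where "inv n q \<longleftrightarrow> (case q of (Z, \<rho>, \<beta>, \<gamma>) \<Rightarrow> finite Z \<and> (\<forall>y\<in>Z. 0 \<le> \<rho> y) \<and> 0 \<le> \<beta> \<and>
    (\<forall>y\<in>Z. y \<notin> A n \<and> Tnr n y = 0) \<and>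
    (\<forall>z. Im z \<noteq> 0 \<longrightarrow> 1 / Tn n z = of_real \<beta> * z + of_real \<gamma> - (\<Sum>y\<in>Z. of_real (\<rho> y) / (z - of_real y))))"
    for n :: nat and q :: "real set \<times> (real \<Rightarrow> real) \<times> real \<times> real"
  have "\<exists>q. inv n q" for n
  proof (rule simple_fraction_inverse[OF finA[of n] Ane[of n] wpos[of _ n], where c = c])
    fix Z \<rho> \<beta> \<gamma>
    assume "finite Z" "\<And>y. y \<in> Z \<Longrightarrow> 0 \<le> \<rho> y" "0 \<le> \<beta>"
      "\<And>y. y \<in> Z \<Longrightarrow> y \<notin> A n \<and> c + (\<Sum>x\<in>A n. w n x / (y - x)) = 0"
      "\<And>z. Im z \<noteq> 0 \<Longrightarrow> 1 / (complex_of_real c + (\<Sum>x\<in>A n. of_real (w n x) / (z - of_real x)))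
       = of_real \<beta> * z + of_real \<gamma> - (\<Sum>y\<in>Z. of_real (\<rho> y) / (z - of_real y))"
    then have "inv n (Z, \<rho>, \<beta>, \<gamma>)" unfolding inv_def Tnr_def Tn_def by simp
    then show ?thesis by blast
  qed
  then obtain q where q: "\<And>n. inv n (q n)" by metis
  define Z where "Z n = fst (q n)" for n
  define \<rho> where "\<rho> n = fst (snd (q n))" for n
  define \<beta> where "\<beta> n = fst (snd (snd (q n)))" for n
  define \<gamma> where "\<gamma> n = snd (snd (snd (q n)))" for n
  have qn: "q n = (Z n, \<rho> n, \<beta> n, \<gamma> n)" for n by (simp add: Z_def \<rho>_def \<beta>_def \<gamma>_def)
  have finZ: "finite (Z n)" and \<rho>0: "y \<in> Z n \<Longrightarrow> 0 \<le> \<rho> n y" and \<beta>0: "0 \<le> \<beta> n"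
    and Z0: "y \<in> Z n \<Longrightarrow> Tnr n y = 0"
    and invT: "Im z \<noteq> 0 \<Longrightarrow> 1 / Tn n z = of_real (\<beta> n) * z + of_real (\<gamma> n) - (\<Sum>y\<in>Z n. of_real (\<rho> n y) / (z - of_real y))"
    for n y z
    using q[of n] unfolding qn inv_def by auto

  \<comment> \<open>Left of the interval \<open>Tnr n\<close> is decreasing, so a positive value at
    \<open>a - e\<close> persists further left. If instead the limit is negative at
    \<open>a - e\<close>, then \<open>c\<close> is at most 0 and every term of the sum is
    negative.\<close>
  have locl: "\<forall>\<^sub>F n in sequentially. \<forall>x\<le>a - e. Tnr n x \<noteq> 0" if e: "0 < e" for e
  proof (cases "Tr (a - e) > 0")
    case True
    then have "\<forall>\<^sub>F n in sequentially. Tnr n (a - e) > 0"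
      using convr[of "a - e"] e by (intro order_tendstoD) auto
    then show ?thesis
    proof eventually_elim
      case (elim n)
      show ?case
      proof (intro allI impI)
        fix x assume "x \<le> a - e"
        then have "(\<Sum>y\<in>A n. w n y / (a - e - y)) \<le> (\<Sum>y\<in>A n. w n y / (x - y))"
          using wpos Aab[of n] e by (intro kernel_sum_left_mono) (auto simp: less_imp_le)
        then show "Tnr n x \<noteq> 0" using elim by (simp add: Tnr_def)
      qed
    qed
  next
    case False
    then have "Tr (a - e) < 0" using Trnz[of "a - e"] e by auto
    then have c: "c \<le> 0"
      using one_sided_sign(1)[OF s, where c = c and u = "a - e"] Trnz e by (auto simp: Tr_def T_def)
    have "Tnr n x \<noteq> 0" if x: "x \<le> a - e" for n x
    proof -
      have "(\<Sum>y\<in>A n. w n y / (x - y)) < (\<Sum>y\<in>A n. 0)"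
        by (intro sum_strict_mono finA Ane divide_pos_neg wpos) (use Aab[of n] x e in force)+
      then show ?thesis using c by (simp add: Tnr_def)
    qed
    then show ?thesis by simp
  qed
  have locr: "\<forall>\<^sub>F n in sequentially. \<forall>x\<ge>b + e. Tnr n x \<noteq> 0" if e: "0 < e" for e
  proof (cases "Tr (b + e) < 0")
    case True
    then have "\<forall>\<^sub>F n in sequentially. Tnr n (b + e) < 0"
      using convr[of "b + e"] e by (intro order_tendstoD) auto
    then show ?thesis
    proof eventually_elim
      case (elim n)
      show ?case
      proof (intro allI impI)
        fix x assume "x \<ge> b + e"
        then have "(\<Sum>y\<in>A n. w n y / (x - y)) \<le> (\<Sum>y\<in>A n. w n y / (b + e - y))"
          using wpos Aab[of n] e by (intro kernel_sum_right_mono) (auto simp: less_imp_le)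
        then show "Tnr n x \<noteq> 0" using elim by (simp add: Tnr_def)
      qed
    qed
  next
    case False
    then have "0 < Tr (b + e)" using Trnz[of "b + e"] e by auto
    then have c: "0 \<le> c"
      using one_sided_sign(2)[OF s, where c = c and u = "b + e"] Trnz e by (auto simp: Tr_def T_def)
    have "Tnr n x \<noteq> 0" if x: "x \<ge> b + e" for n x
    proof -
      have "(\<Sum>y\<in>A n. 0) < (\<Sum>y\<in>A n. w n y / (x - y))"
        by (intro sum_strict_mono finA Ane divide_pos_pos wpos) (use Aab[of n] x e in force)+
      then show ?thesis using c by (simp add: Tnr_def)
    qed
    then show ?thesis by simp
  qed
  have loc: "\<forall>\<^sub>F n in sequentially. Z n \<subseteq> {a - e..b + e}" if e: "0 < e" for e
    using locl[OF e] locr[OF e]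
  proof eventually_elim
    case (elim n)
    show ?case
    proof
      fix y assume "y \<in> Z n"
      then have "Tnr n y = 0" by (rule Z0)
      with elim show "y \<in> {a - e..b + e}" by (auto simp: not_le[symmetric]) (meson le_cases)+
    qed
  qed
  obtain n0 where n0: "\<And>n. n0 \<le> n \<Longrightarrow> Z n \<subseteq> {a - 1..b + 1}"
    using loc[of 1] by (auto simp: eventually_sequentially)

  have Ti: "T \<i> \<noteq> 0"
    using Im_ct_nonzero[OF s compact_Icc, of \<i>] by (auto simp: T_def complex_eq_iff)
  have "(\<lambda>n. 1 / Tn n \<i>) \<longlonglongrightarrow> 1 / T \<i>"
    using Ti by (intro tendsto_divide tendsto_const conv) (auto simp: complex_eq_iff)
  then obtain B where B: "\<And>n. norm (1 / Tn n \<i>) \<le> B"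
    by (metis Bseq_def convergentI convergent_imp_Bseq)
  define K where "K = 1 + (\<bar>a - 1\<bar> + \<bar>b + 1\<bar>)\<^sup>2"
  define L where "L = \<bar>a - 1\<bar> + \<bar>b + 1\<bar>"
  have K: "1 + y\<^sup>2 \<le> K" and L: "\<bar>y\<bar> \<le> L" if "y \<in> Z n" "n0 \<le> n" for y n
  proof -
    show "\<bar>y\<bar> \<le> L" using n0[OF that(2)] that(1) by (fastforce simp: L_def abs_if)
    then have "\<bar>y\<bar>\<^sup>2 \<le> L\<^sup>2" by (intro power_mono) auto
    then show "1 + y\<^sup>2 \<le> K" by (simp add: K_def L_def)
  qed
  have Kpos: "0 < K" by (auto simp: K_def intro: add_pos_nonneg)
  have Iform: "1 / Tn n \<i> = of_real (\<beta> n) * \<i> + of_real (\<gamma> n) - (\<Sum>y\<in>Z n. of_real (\<rho> n y) / (\<i> - of_real y))" for n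
    by (rule invT) simp
  \<comment> \<open>At \<open>\<i>\<close> the imaginary part is a sum of nonnegative terms, so one
    bound controls the slope and all weights.\<close>
  have Im_i: "Im (1 / Tn n \<i>) = \<beta> n + (\<Sum>y\<in>Z n. \<rho> n y / (1 + y\<^sup>2))" for n
    unfolding Iform by (simp add: Im_pole cmod_power2 sum_negf add.commute)
  have ImB: "\<beta> n + (\<Sum>y\<in>Z n. \<rho> n y / (1 + y\<^sup>2)) \<le> B" for n
    using abs_Im_le_cmod[of "1 / Tn n \<i>"] B[of n] unfolding Im_i by linarith
  have sum0: "0 \<le> (\<Sum>y\<in>Z n. \<rho> n y / (1 + y\<^sup>2))" for n
    using \<rho>0 by (intro sum_nonneg divide_nonneg_nonneg) auto
  define mm where "mm n = (\<Sum>y\<in>Z n. \<rho> n y)" for n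
  have mm0: "0 \<le> mm n" for n unfolding mm_def using \<rho>0 by (intro sum_nonneg)
  have mmB: "mm n \<le> K * B" if n: "n0 \<le> n" for n
  proof -
    have "mm n \<le> (\<Sum>y\<in>Z n. K * (\<rho> n y / (1 + y\<^sup>2)))" unfolding mm_def
    proof (rule sum_mono)
      fix y assume y: "y \<in> Z n"
      have "\<rho> n y * (1 + y\<^sup>2) \<le> \<rho> n y * K" using K[OF y n] \<rho>0[OF y] by (rule mult_left_mono)
      moreover have "0 < 1 + y\<^sup>2" by (auto intro: add_pos_nonneg)
      ultimately show "\<rho> n y \<le> K * (\<rho> n y / (1 + y\<^sup>2))" by (simp add: field_simps)
    qed
    also have "\<dots> = K * (\<Sum>y\<in>Z n. \<rho> n y / (1 + y\<^sup>2))" by (simp add: sum_distrib_left)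
    also have "\<dots> \<le> K * B" using ImB[of n] \<beta>0[of n] Kpos by (intro mult_left_mono) auto
    finally show ?thesis .
  qed
  have \<gamma>B: "\<bar>\<gamma> n\<bar> \<le> B + K * B" if n: "n0 \<le> n" for n
  proof -
    have "of_real (\<gamma> n) = 1 / Tn n \<i> - of_real (\<beta> n) * \<i> + (\<Sum>y\<in>Z n. of_real (\<rho> n y) / (\<i> - of_real y))"
      unfolding Iform by simp
    then have "\<gamma> n = Re (1 / Tn n \<i> - of_real (\<beta> n) * \<i> + (\<Sum>y\<in>Z n. of_real (\<rho> n y) / (\<i> - of_real y)))"
      by (metis Re_complex_of_real)
    also have "\<dots> = Re (1 / Tn n \<i>) + Re (\<Sum>y\<in>Z n. of_real (\<rho> n y) / (\<i> - of_real y))" by simp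
    finally have "\<bar>\<gamma> n\<bar> \<le> norm (1 / Tn n \<i>) + norm (\<Sum>y\<in>Z n. of_real (\<rho> n y) / (\<i> - of_real y))"
      using abs_Re_le_cmod[of "1 / Tn n \<i>"] abs_Re_le_cmod[of "\<Sum>y\<in>Z n. of_real (\<rho> n y) / (\<i> - of_real y)"] by linarith
    moreover have "norm (\<Sum>y\<in>Z n. of_real (\<rho> n y) / (\<i> - of_real y)) \<le> mm n" unfolding mm_def
    proof (rule order_trans[OF norm_sum], rule sum_mono)
      fix y assume y: "y \<in> Z n"
      have "1 \<le> norm (\<i> - complex_of_real y)" using abs_Im_le_cmod[of "\<i> - complex_of_real y"] by simp
      then show "norm (of_real (\<rho> n y) / (\<i> - complex_of_real y)) \<le> \<rho> n y"
        using \<rho>0[OF y] by (simp add: norm_divide divide_le_eq mult_le_cancel_left1)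
    qed
    ultimately show ?thesis using B[of n] mmB[OF n] by linarith
  qed
  have "bounded (range (\<lambda>n. (\<beta> (n + n0), \<gamma> (n + n0), mm (n + n0))))"
  proof -
    have "norm (\<beta> (n + n0), \<gamma> (n + n0), mm (n + n0)) \<le> B + (B + K * B) + K * B" for n
    proof -
      have "norm (\<beta> (n + n0), \<gamma> (n + n0), mm (n + n0)) \<le> norm (\<beta> (n + n0)) + (norm (\<gamma> (n + n0)) + norm (mm (n + n0)))"
        by (rule order_trans[OF norm_Pair_le]) (intro add_left_mono norm_Pair_le)
      also have "\<dots> \<le> B + ((B + K * B) + K * B)"
        using \<beta>0[of "n + n0"] mm0[of "n + n0"] mmB[of "n + n0"] \<gamma>B[of "n + n0"] ImB[of "n + n0"] sum0[of "n + n0"]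
        unfolding real_norm_def by (simp only: abs_of_nonneg) linarith
      finally show ?thesis by simp
    qed
    then show ?thesis by (auto simp: bounded_iff)
  qed
  from bounded_imp_convergent_subsequence[OF this]
  obtain l r where r: "strict_mono (r :: nat \<Rightarrow> nat)"
      and l: "((\<lambda>n. (\<beta> (n + n0), \<gamma> (n + n0), mm (n + n0))) \<circ> r) \<longlonglongrightarrow> l"
    by blast
  obtain \<beta>' \<gamma>' m' where l': "l = (\<beta>', \<gamma>', m')" by (cases l) auto
  define p where "p n = r n + n0" for n
  have p: "strict_mono p" using r by (simp add: p_def strict_mono_def)
  have \<beta>lim: "(\<lambda>n. \<beta> (p n)) \<longlonglongrightarrow> \<beta>'" and \<gamma>lim: "(\<lambda>n. \<gamma> (p n)) \<longlonglongrightarrow> \<gamma>'" and mlim: "(\<lambda>n. mm (p n)) \<longlonglongrightarrow> m'"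
    using tendsto_fst[OF l] tendsto_fst[OF tendsto_snd[OF l]] tendsto_snd[OF tendsto_snd[OF l]]
    by (simp_all add: l' p_def comp_def)
  have sub: "Z (p n) \<subseteq> {a - 1..b + 1}" for n by (rule n0) (simp add: p_def)
  obtain t \<nu> where t: "strict_mono t" and \<nu>: "finite_measure \<nu>" "sets \<nu> = sets borel"
    and helly: "\<And>f :: real \<Rightarrow> complex. continuous_on UNIV f \<Longrightarrow> bounded (range f) \<Longrightarrow>
       (\<lambda>n. \<Sum>y\<in>Z (p (t n)). of_real (\<rho> (p (t n)) y) * f y) \<longlonglongrightarrow> (\<integral>x. f x \<partial>\<nu>)"
    using helly_discrete[of "\<lambda>n. Z (p n)" "\<lambda>n. \<rho> (p n)" "a - 1" "b + 1" m'] finZ \<rho>0 sub mlim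
    unfolding mm_def by blast
  have pt: "strict_mono (\<lambda>n. p (t n))" using p t by (simp add: strict_mono_def)
  interpret \<nu>: finite_measure \<nu> by fact
  have [measurable_cong]: "sets \<nu> = sets borel" by fact
  have ae: "AE x in \<nu>. a - e \<le> x \<and> x \<le> b + e" if e: "0 < e" for e
  proof -
    \<comment> \<open>\<open>\<phi>\<close> vanishes exactly on \<open>{a - e..b + e}\<close>, which
      contains the poles for all large \<open>n\<close>; the limit measure therefore has no mass
      outside.\<close>
    define \<phi> where "\<phi> x = min 1 (max 0 (max (a - e - x) (x - b - e)))" for x
    have \<phi>c: "continuous_on UNIV \<phi>" unfolding \<phi>_def by (intro continuous_intros)
    have "\<phi> \<in> borel_measurable borel" using \<phi>c by (rule borel_measurable_continuous_onI)
    then have \<phi>m: "\<phi> \<in> borel_measurable \<nu>" by measurable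
    have \<phi>b: "0 \<le> \<phi> x" "\<phi> x \<le> 1" for x by (auto simp: \<phi>_def)
    have "(\<lambda>n. \<Sum>y\<in>Z (p (t n)). of_real (\<rho> (p (t n)) y) * complex_of_real (\<phi> y)) \<longlonglongrightarrow> (\<integral>x. complex_of_real (\<phi> x) \<partial>\<nu>)"
      using \<phi>c \<phi>b by (intro helly continuous_intros) (auto simp: bounded_iff intro!: exI[of _ 1])
    moreover have "\<forall>\<^sub>F n in sequentially. (\<Sum>y\<in>Z (p (t n)). of_real (\<rho> (p (t n)) y) * complex_of_real (\<phi> y)) = 0"
    proof -
      have "\<forall>\<^sub>F n in sequentially. Z (p (t n)) \<subseteq> {a - e..b + e}"
        using loc[OF e] by (rule eventually_compose_filterlim[OF _ filterlim_subseq[OF pt]])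
      then show ?thesis
      proof eventually_elim
        case (elim n)
        show ?case by (rule sum.neutral) (use elim in \<open>force simp: \<phi>_def\<close>)
      qed
    qed
    ultimately have "(\<integral>x. complex_of_real (\<phi> x) \<partial>\<nu>) = 0"
      by (rule LIMSEQ_unique[OF _ tendsto_eventually])
    then have "(\<integral>x. \<phi> x \<partial>\<nu>) = 0" by simp
    moreover have "integrable \<nu> \<phi>"
      by (rule \<nu>.integrable_const_bound[of _ 1]) (use \<phi>b \<phi>m in auto)
    ultimately have "AE x in \<nu>. \<phi> x = 0"
      using \<phi>b by (subst (asm) integral_nonneg_eq_0_iff_AE) auto
    then show ?thesis by eventually_elim (auto simp: \<phi>_def min_def max_def split: if_splits)
  qed
  have "AE x in \<nu>. \<forall>k::nat. a - 1 / real (Suc k) \<le> x \<and> x \<le> b + 1 / real (Suc k)"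
    unfolding AE_all_countable by (intro allI ae) simp
  then have "AE x in \<nu>. x \<in> {a..b}"
  proof eventually_elim
    case (elim x)
    have "(\<lambda>k. a - 1 / real (Suc k)) \<longlonglongrightarrow> a" "(\<lambda>k. b + 1 / real (Suc k)) \<longlonglongrightarrow> b" by real_asymp+
    then show ?case using elim LIMSEQ_le_const2[of _ a x] LIMSEQ_le_const[of _ b x] by auto
  qed
  then have \<nu>null: "emeasure \<nu> (- {a..b}) = 0"
    by (subst (asm) AE_iff_measurable[of "- {a..b}"]) (auto simp: \<nu>(2) sets_eq_imp_space_eq[OF \<nu>(2)])
  show thesis
  proof (rule that[OF \<nu> \<nu>null])
    fix z :: complex assume z: "Im z \<noteq> 0"
    have Tz: "T z \<noteq> 0" using Im_ct_nonzero[OF s compact_Icc z] by (auto simp: T_def complex_eq_iff)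
    have "(\<lambda>n. Tn n z) \<longlonglongrightarrow> T z" using z by (intro conv) auto
    then have "(\<lambda>n. 1 / Tn (p (t n)) z) \<longlonglongrightarrow> 1 / T z"
      using LIMSEQ_subseq_LIMSEQ[OF _ pt, of "\<lambda>n. Tn n z"] Tz by (intro tendsto_divide) (auto simp: comp_def)
    moreover have "(\<lambda>n. 1 / Tn (p (t n)) z) \<longlonglongrightarrow> of_real \<beta>' * z + of_real \<gamma>' - (\<integral>x. 1 / (z - of_real x) \<partial>\<nu>)"
    proof -
      have f: "continuous_on UNIV (\<lambda>x. 1 / (z - complex_of_real x))"
        by (intro continuous_intros) (use z in auto)
      have "norm (1 / (z - complex_of_real x)) \<le> 1 / \<bar>Im z\<bar>" for x
      proof -
        have "\<bar>Im z\<bar> \<le> norm (z - complex_of_real x)" using abs_Im_le_cmod[of "z - complex_of_real x"] by simp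
        then show ?thesis using z by (simp add: norm_divide frac_le)
      qed
      then have "bounded (range (\<lambda>x. 1 / (z - complex_of_real x)))" by (auto simp: bounded_iff)
      note h = helly[OF f this]
      have "(\<lambda>n. of_real (\<beta> (p (t n))) * z + of_real (\<gamma> (p (t n))) - (\<Sum>y\<in>Z (p (t n)). of_real (\<rho> (p (t n)) y) * (1 / (z - complex_of_real y))))
        \<longlonglongrightarrow> of_real \<beta>' * z + of_real \<gamma>' - (\<integral>x. 1 / (z - of_real x) \<partial>\<nu>)"
        using LIMSEQ_subseq_LIMSEQ[OF \<beta>lim t] LIMSEQ_subseq_LIMSEQ[OF \<gamma>lim t]
        by (intro tendsto_intros h) (simp_all add: comp_def)
      then show ?thesis using invT[OF z] by simp
    qed
    ultimately show "1 / (of_real c + ctrans s (\<lambda>_. 1) z) = of_real \<beta>' * z + of_real \<gamma>' - (\<integral>x. 1 / (z - of_real x) \<partial>\<nu>)"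
      unfolding T_def[symmetric] by (rule LIMSEQ_unique)
  qed
qed

text \<open>Real points are limits of the nonreal points \<open>z + \<i> / (n + 1)\<close>, so
  identities need only be verified off the real axis, where the divisions are unproblematic.\<close>

lemma agree_off_real:
  fixes f g :: "complex \<Rightarrow> 'a::t2_space"
  assumes U: "open U" and f: "continuous_on U f" and g: "continuous_on U g"
    and eq: "\<And>z. z \<in> U \<Longrightarrow> Im z \<noteq> 0 \<Longrightarrow> f z = g z" and z: "z \<in> U"
  shows "f z = g z"
proof (cases "Im z = 0")
  case True
  define u where "u n = z + \<i> * of_real (1 / real (Suc n))" for n
  have lim: "(\<lambda>n. complex_of_real (1 / real (Suc n))) \<longlonglongrightarrow> of_real 0"
    by (intro tendsto_of_real LIMSEQ_Suc lim_1_over_n)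
  have "u \<longlonglongrightarrow> z + \<i> * of_real 0" unfolding u_def
    by (intro tendsto_add tendsto_mult tendsto_const lim)
  then have u: "u \<longlonglongrightarrow> z" by simp
  have "isCont f z" "isCont g z" using U f g z by (auto simp: continuous_on_eq_continuous_at)
  then have lim: "(\<lambda>n. f (u n)) \<longlonglongrightarrow> f z" "(\<lambda>n. g (u n)) \<longlonglongrightarrow> g z"
    using u by (auto intro: isCont_tendsto_compose)
  have "\<forall>\<^sub>F n in sequentially. f (u n) = g (u n)"
    using topological_tendstoD[OF u U z]
    by eventually_elim (rule eq, auto simp: u_def True)
  then have "(\<lambda>n. f (u n)) \<longlonglongrightarrow> g z" using lim(2) tendsto_cong[of "\<lambda>n. f (u n)" "\<lambda>n. g (u n)" sequentially "g z"] by blast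
  then show ?thesis by (rule LIMSEQ_unique[OF lim(1)])
qed (use eq z in auto)

text \<open>\<open>x / (z - x) = z / (z - x) - 1\<close>: a factor \<open>x\<close> leaves the
  transform at the cost of a moment.\<close>

lemma ctrans_ident_mult:
  assumes s: "concentrated \<Gamma> s" "compact \<Gamma>" and f: "density_on \<Gamma> f" and z: "z \<notin> complex_of_real ` \<Gamma>"
  shows "ctrans s (\<lambda>x. x * f x) z = z * ctrans s f z - sm_integral s (\<lambda>x. f (of_real x))"
proof -
  have [measurable]: "(\<lambda>x. f (of_real x)) \<in> borel_measurable borel" using f by (simp add: density_on_def)
  have "ctrans s (\<lambda>x. x * f x) z = sm_integral s (\<lambda>x. z * (f (of_real x) / (z - of_real x)) - f (of_real x))"
    unfolding ctrans_def
  proof (rule sm_integral_cong[OF s])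
    fix x assume "x \<in> \<Gamma>"
    then have "z \<noteq> of_real x" using z by auto
    then show "of_real x * f (of_real x) / (z - of_real x) = z * (f (of_real x) / (z - of_real x)) - f (of_real x)"
      by (simp add: field_simps)
  qed measurable
  also have "\<dots> = z * ctrans s f z - sm_integral s (\<lambda>x. f (of_real x))"
  proof (subst sm_integral_diff)
    show "integrable (snd s) (\<lambda>x. z * (f (of_real x) / (z - of_real x)))"
      by (intro integrable_mult_right kernel_integrable[OF s f z])
    show "integrable (snd s) (\<lambda>x. f (of_real x))" by (rule density_on_integrable[OF s f])
  qed (simp only: sm_integral_cmult ctrans_def)
  finally show ?thesis .
qed

section \<open>Polynomial densities and infinite support of the inverse\<close>

lemma density_on_poly: "density_on \<Gamma> (poly p)"
  unfolding density_on_def by (auto intro!: continuous_intros borel_measurable_continuous_onI)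

lemma ctrans_poly:
  assumes s: "concentrated \<Gamma> s" "compact \<Gamma>"
  obtains E where "\<And>z. z \<notin> complex_of_real ` \<Gamma> \<Longrightarrow> ctrans s (poly A) z = poly A z * ctrans s (\<lambda>_. 1) z + poly E z"
proof (induction A arbitrary: thesis)
  case 0
  show ?case by (rule 0[of 0]) (simp add: ctrans_def sm_integral_def)
next
  case (pCons a p)
  obtain E where E: "\<And>z. z \<notin> complex_of_real ` \<Gamma> \<Longrightarrow> ctrans s (poly p) z = poly p z * ctrans s (\<lambda>_. 1) z + poly E z"
    using pCons.IH by blast
  show ?case
  proof (rule pCons.prems)
    fix z assume z: "z \<notin> complex_of_real ` \<Gamma>"
    have "poly (pCons a p) = (\<lambda>z. a * 1 + z * poly p z)" by auto
    then have "ctrans s (poly (pCons a p)) z = ctrans s (\<lambda>z. a * 1 + z * poly p z) z" by simp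
    also have "\<dots> = a * ctrans s (\<lambda>_. 1) z + (z * ctrans s (poly p) z - sm_integral s (\<lambda>x. poly p (of_real x)))"
      by (subst ctrans_add[OF s _ _ z]) (auto intro!: density_on_mult density_on_poly simp: ctrans_cmult[of s a "\<lambda>_. 1", simplified] ctrans_ident_mult[OF s density_on_poly z])
    finally show "ctrans s (poly (pCons a p)) z = poly (pCons a p) z * ctrans s (\<lambda>_. 1) z + poly (pCons (- sm_integral s (\<lambda>x. poly p (of_real x))) E) z"
      by (simp add: E[OF z] algebra_simps)
  qed
qed

text \<open>A factor \<open>x\<close> turns the zero transform into the constant given by minus the
  moment; decay along the imaginary axis forces this constant to be 0.\<close>

lemma ctrans_vanishing_moment:
  assumes s: "concentrated \<Gamma> s" "compact \<Gamma>" and f: "density_on \<Gamma> f"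
    and zero: "\<And>z. Im z \<noteq> 0 \<Longrightarrow> ctrans s f z = 0"
  shows "sm_integral s (\<lambda>x. f (of_real x)) = 0" and "Im z \<noteq> 0 \<Longrightarrow> ctrans s (\<lambda>x. x * f x) z = 0"
proof -
  let ?S = "sm_integral s (\<lambda>x. f (of_real x))"
  have eq: "ctrans s (\<lambda>x. x * f x) z = - ?S" if z: "Im z \<noteq> 0" for z
  proof -
    have "z \<notin> complex_of_real ` \<Gamma>" using z by auto
    then show ?thesis using ctrans_ident_mult[OF s f] zero[OF z] by simp
  qed
  obtain C where C: "0 < C" "\<And>y. 0 < y \<Longrightarrow> norm (ctrans s (\<lambda>x. x * f x) (\<i> * of_real y)) \<le> C / y"
    using ctrans_i_bound[OF s density_on_mult[OF density_on_ident f]] by blast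
  have "norm ?S \<le> 0"
  proof (rule field_le_epsilon)
    fix e :: real assume e: "0 < e"
    have "norm (ctrans s (\<lambda>x. x * f x) (\<i> * of_real (C / e))) \<le> C / (C / e)"
      using C e by (intro C(2)) auto
    then show "norm ?S \<le> 0 + e" using C e by (subst (asm) eq) auto
  qed
  then show S: "?S = 0" by simp
  show "Im z \<noteq> 0 \<Longrightarrow> ctrans s (\<lambda>x. x * f x) z = 0" using eq S by simp
qed

lemma ctrans_vanishing_poly:
  assumes s: "concentrated \<Gamma> s" "compact \<Gamma>" and f: "density_on \<Gamma> f"
    and zero: "\<And>z. Im z \<noteq> 0 \<Longrightarrow> ctrans s f z = 0"
  shows "Im z \<noteq> 0 \<Longrightarrow> ctrans s (\<lambda>x. f x * poly P x) z = 0"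
  using f zero
proof (induction P arbitrary: f z)
  case 0
  show ?case by (simp add: ctrans_def sm_integral_def)
next
  case (pCons a p)
  have zn: "z \<notin> complex_of_real ` \<Gamma>" using pCons.prems by auto
  have d: "density_on \<Gamma> (\<lambda>x. x * f x)" using pCons.prems by (intro density_on_mult) auto
  have "ctrans s (\<lambda>x. f x * poly (pCons a p) x) z = ctrans s (\<lambda>x. a * f x + (x * f x) * poly p x) z"
    by (simp add: algebra_simps)
  also have "\<dots> = a * ctrans s f z + ctrans s (\<lambda>x. (x * f x) * poly p x) z"
    using pCons.prems d by (subst ctrans_add[OF s _ _ zn]) (auto intro!: density_on_mult density_on_poly simp: ctrans_cmult)
  also have "ctrans s (\<lambda>x. (x * f x) * poly p x) z = 0"
    using ctrans_vanishing_moment(2)[OF s pCons.prems(2,3)] by (intro pCons.IH pCons.prems(1) d) auto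
  finally show ?case using pCons.prems by simp
qed

lemma poly_vanish_at_i_infinity:
  fixes D :: "complex poly"
  assumes "\<And>y. 0 < y \<Longrightarrow> norm (poly D (\<i> * of_real y)) \<le> C / y"
  shows "D = 0"
proof -
  have small: "\<exists>y\<ge>r. 0 < y \<and> norm (poly D (\<i> * of_real y)) < e" if "0 < e" for r e
  proof (intro exI conjI)
    define y where "y = max r (\<bar>C\<bar> / e + 1)"
    show "r \<le> y" by (simp add: y_def)
    have y: "\<bar>C\<bar> / e < y" by (auto simp: y_def)
    have "0 \<le> \<bar>C\<bar> / e" using that by simp
    then have y0: "0 < y" using y by linarith
    then show "0 < y" .
    have "C / y < e" using y y0 that by (simp add: field_simps abs_less_iff)
    then show "norm (poly D (\<i> * of_real y)) < e" using assms[OF y0] by simp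
  qed
  obtain a p where D: "D = pCons a p" by (cases D)
  have "p = 0"
  proof (rule ccontr)
    assume "p \<noteq> 0"
    then obtain r where r: "\<And>z. r \<le> norm z \<Longrightarrow> 1 \<le> norm (poly (pCons a p) z)"
      using poly_infinity[of p 1 a] by auto
    obtain y where y: "r \<le> y" "0 < y" "norm (poly D (\<i> * of_real y)) < 1"
      using small[of 1 r] by auto
    moreover have "norm (\<i> * of_real y) = y" using y by (simp add: norm_mult)
    ultimately show False using r[of "\<i> * of_real y"] D by auto
  qed
  moreover have "a = 0"
  proof (rule ccontr)
    assume "a \<noteq> 0"
    then show False using small[of "norm a" 0] \<open>p = 0\<close> D by auto
  qed
  ultimately show ?thesis by (simp add: D)
qed

lemma finite_support_integral:
  fixes f :: "real \<Rightarrow> complex"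
  assumes \<nu>: "finite_measure \<nu>" "sets \<nu> = sets borel" "finite F" "emeasure \<nu> (- F) = 0"
    and f: "f \<in> borel_measurable borel"
  shows "(\<integral>x. f x \<partial>\<nu>) = (\<Sum>y\<in>F. of_real (measure \<nu> {y}) * f y)"
proof -
  interpret finite_measure \<nu> by fact
  have [measurable_cong]: "sets \<nu> = sets borel" by fact
  have [measurable]: "f \<in> borel_measurable borel" by fact
  have FB: "F \<in> sets borel" using finite_imp_closed[OF assms(3)] by (rule borel_closed)
  have ae: "AE x in \<nu>. x \<in> F"
    by (rule AE_I[of _ _ "- F"]) (use assms(2,4) FB in auto)
  have sing: "{y} \<in> sets \<nu>" for y :: real by (simp add: assms(2))
  have "(\<integral>x. f x \<partial>\<nu>) = (\<integral>x. (\<Sum>y\<in>F. indicator {y} x *\<^sub>R f y) \<partial>\<nu>)"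
  proof (rule integral_cong_AE)
    show "AE x in \<nu>. f x = (\<Sum>y\<in>F. indicator {y} x *\<^sub>R f y)"
      using ae
    proof eventually_elim
      case (elim x)
      have "(\<Sum>y\<in>F. indicator {y} x *\<^sub>R f y) = (\<Sum>y\<in>F. if y = x then f y else 0)"
        by (intro sum.cong refl) (auto simp: indicator_def)
      also have "\<dots> = f x" using elim assms(3) by simp
      finally show ?case by simp
    qed
  qed measurable
  also have "\<dots> = (\<Sum>y\<in>F. measure \<nu> {y} *\<^sub>R f y)"
    using sing by (subst Bochner_Integration.integral_sum)
      (auto simp: assms(2)[THEN sets_eq_imp_space_eq] emeasure_eq_measure)
  finally show ?thesis by (simp add: scaleR_conv_of_real)
qed

text \<open>If \<open>\<nu>\<close> had finite support, the given function would be a quotient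
  \<open>B / A\<close> of polynomials that are real on the real line. The transform of
  \<open>A ds\<close> would then be a polynomial that decays, hence 0, so \<open>A\<close> would be
  orthogonal to all polynomials and to itself. As \<open>s\<close> has constant sign, it would be
  carried by the finitely many roots of \<open>A\<close>.\<close>

lemma reciprocal_infinite_support:
  assumes s: "concentrated_inf {a..b} s"
    and \<nu>: "finite_measure \<nu>" "sets \<nu> = sets borel"
    and eq: "\<And>z. Im z \<noteq> 0 \<Longrightarrow> 1 / (of_real c + ctrans s (\<lambda>_. 1) z) =
       of_real \<beta> * z + of_real \<gamma> - (\<integral>x. 1 / (z - of_real x) \<partial>\<nu>)"
    and F: "finite F"
  shows "emeasure \<nu> (- F) \<noteq> 0"
proof
  assume null: "emeasure \<nu> (- F) = 0"
  have s': "concentrated {a..b} s" using s by (rule concentrated_infD)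
  define B where "B = (\<Prod>y\<in>F. [:- complex_of_real y, 1:])"
  define By where "By y = (\<Prod>x\<in>F-{y}. [:- complex_of_real x, 1:])" for y
  define A where "A = B * [:of_real \<gamma>, of_real \<beta>:] - (\<Sum>y\<in>F. smult (of_real (measure \<nu> {y})) (By y))"
  have Bz: "poly B z \<noteq> 0" if "Im z \<noteq> 0" for z
    using that F by (auto simp: B_def poly_prod)
  have ByB: "poly (By y) z = poly B z / (z - of_real y)" if "y \<in> F" "Im z \<noteq> 0" for y z
  proof -
    have "poly B z = (z - of_real y) * poly (By y) z"
      unfolding B_def By_def prod.remove[OF F that(1), of "\<lambda>y. [:- complex_of_real y, 1:]"] by (simp add: algebra_simps)
    then show ?thesis using that by auto
  qed
  have TA: "(of_real c + ctrans s (\<lambda>_. 1) z) * poly A z = poly B z" if z: "Im z \<noteq> 0" for z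
  proof -
    have "(\<integral>x. 1 / (z - of_real x) \<partial>\<nu>) = (\<Sum>y\<in>F. of_real (measure \<nu> {y}) * (1 / (z - of_real y)))"
      by (rule finite_support_integral[OF \<nu> F null]) measurable
    then have "1 / (of_real c + ctrans s (\<lambda>_. 1) z) = of_real \<beta> * z + of_real \<gamma> - (\<Sum>y\<in>F. of_real (measure \<nu> {y}) * (1 / (z - of_real y)))"
      using eq[OF z] by simp
    moreover have "poly A z = poly B z * (of_real \<beta> * z + of_real \<gamma> - (\<Sum>y\<in>F. of_real (measure \<nu> {y}) * (1 / (z - of_real y))))"
      using z by (simp add: A_def poly_sum ByB algebra_simps sum_distrib_left)
    ultimately have "poly A z = poly B z * (1 / (of_real c + ctrans s (\<lambda>_. 1) z))" by simp
    moreover have "of_real c + ctrans s (\<lambda>_. 1) z \<noteq> 0"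
      using Im_ct_nonzero[OF s compact_Icc z] by (auto simp: complex_eq_iff)
    ultimately show ?thesis by simp
  qed
  have A0: "A \<noteq> 0" using TA[of \<i>] Bz[of \<i>] by auto
  obtain E where E: "\<And>z. z \<notin> complex_of_real ` {a..b} \<Longrightarrow> ctrans s (poly A) z = poly A z * ctrans s (\<lambda>_. 1) z + poly E z"
    using ctrans_poly[OF s' compact_Icc] by blast
  define D where "D = B - smult (of_real c) A + E"
  have ctA: "ctrans s (poly A) z = poly D z" if z: "Im z \<noteq> 0" for z
  proof -
    have "z \<notin> complex_of_real ` {a..b}" using z by auto
    then have "ctrans s (poly A) z = poly A z * ctrans s (\<lambda>_. 1) z + poly E z" by (rule E)
    then show ?thesis using TA[OF z] by (simp add: D_def algebra_simps)
  qed
  obtain C where C: "\<And>y. 0 < y \<Longrightarrow> norm (ctrans s (poly A) (\<i> * of_real y)) \<le> C / y"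
    using ctrans_i_bound[OF s' compact_Icc density_on_poly] by blast
  have "D = 0"
  proof (rule poly_vanish_at_i_infinity)
    fix y :: real assume "0 < y"
    then show "norm (poly D (\<i> * of_real y)) \<le> C / y" using C[of y] ctA[of "\<i> * of_real y"] by simp
  qed
  then have zero: "ctrans s (poly A) z = 0" if "Im z \<noteq> 0" for z using ctA[OF that] by simp
  have zero2: "ctrans s (\<lambda>x. poly A x * poly A x) z = 0" if "Im z \<noteq> 0" for z
    by (rule ctrans_vanishing_poly[OF s' compact_Icc density_on_poly zero that])
  have "sm_integral s (\<lambda>x. poly A (of_real x) * poly A (of_real x)) = 0"
    by (rule ctrans_vanishing_moment(1)[OF s' compact_Icc density_on_mult[OF density_on_poly density_on_poly] zero2])
  then have int0: "(\<integral>x. poly A (of_real x) * poly A (of_real x) \<partial>snd s) = 0"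
    using s' by (auto simp: sm_integral_def concentrated_def)
  have real: "poly A (of_real x) \<in> \<real>" for x
    unfolding A_def B_def By_def by (auto simp: poly_sum poly_prod intro!: Reals_diff Reals_mult Reals_add sum_in_Reals prod_in_Reals)
  define h where "h x = (Re (poly A (of_real x)))\<^sup>2" for x
  have h: "poly A (of_real x) * poly A (of_real x) = of_real (h x)" for x
    using real[of x] by (auto simp: h_def power2_eq_square elim!: Reals_cases)
  have "integrable (snd s) (\<lambda>x. complex_of_real (h x))"
    using density_on_integrable[OF s' compact_Icc density_on_mult[OF density_on_poly density_on_poly], of A A] by (simp add: h)
  then have above_mex: "integrable (snd s) h" by (simp only: complex_of_real_integrable_eq)
  have "(\<integral>x. h x \<partial>snd s) = 0" using int0 by (simp add: h)
  then have "AE x in snd s. h x = 0"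
    using above_mex by (subst (asm) integral_nonneg_eq_0_iff_AE) (auto simp: h_def)
  then have ae: "AE x in snd s. poly A (of_real x) = 0"
    by eventually_elim (use h in \<open>metis mult_eq_0_iff of_real_0\<close>)
  define R where "R = {x::real. poly A (of_real x) = 0}"
  have finR: "finite R"
  proof (rule finite_imageD)
    show "finite (complex_of_real ` R)"
      by (rule finite_subset[OF _ poly_roots_finite[OF A0]]) (auto simp: R_def)
  qed (auto simp: inj_on_def)
  have RB: "R \<in> sets borel" using finite_imp_closed[OF finR] by (rule borel_closed)
  have sets: "sets (snd s) = sets borel" using s' by (simp add: concentrated_def)
  have "emeasure (snd s) (- R) = 0"
    using ae RB by (subst (asm) AE_iff_measurable[of "- R"]) (auto simp: sets sets_eq_imp_space_eq[OF sets] R_def)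
  then show False using s finR by (simp add: concentrated_inf_def)
qed

theorem inverse_ct_one:
  fixes a b c :: real
  assumes s: "concentrated_inf {a..b} s"
    and nz: "\<And>x. x \<notin> {a..b} \<Longrightarrow> of_real c + ctrans s (\<lambda>_. 1) (complex_of_real x) \<noteq> 0"
  obtains \<tau> \<beta> \<gamma> where "concentrated_inf {a..b} \<tau>"
    "\<And>z. z \<notin> complex_of_real ` {a..b} \<Longrightarrow> 1 / (of_real c + ctrans s (\<lambda>_. 1) z) = of_real \<beta> * z + of_real \<gamma> + ctrans \<tau> (\<lambda>_. 1) z"
proof -
  define e where "e = fst s"
  have e: "e = 1 \<or> e = -1" using s by (simp add: concentrated_inf_def concentrated_def e_def)
  define s1 where "s1 = (1 :: real, snd s)"
  have s1: "concentrated_inf {a..b} s1" using s by (simp add: concentrated_inf_def concentrated_def s1_def)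
  have ct1: "ctrans s f z = of_real e * ctrans s1 f z" for f z
    by (simp add: ctrans_def sm_integral_def s1_def e_def scaleR_conv_of_real)
  have ee: "of_real e * of_real e = (1::complex)" using e by auto
  have fac: "of_real (e * c) + ctrans s1 (\<lambda>_. 1) z = of_real e * (of_real c + ctrans s (\<lambda>_. 1) z)" for z
    using ee by (simp add: ct1 distrib_left mult.assoc[symmetric])
  have e0: "complex_of_real e \<noteq> 0" using e by auto
  obtain \<nu> \<beta> \<gamma> where \<nu>: "finite_measure \<nu>" "sets \<nu> = sets borel" "emeasure \<nu> (- {a..b}) = 0"
    and inv: "\<And>z. Im z \<noteq> 0 \<Longrightarrow> 1 / (of_real (e * c) + ctrans s1 (\<lambda>_. 1) z) =
       of_real \<beta> * z + of_real \<gamma> - (\<integral>x. 1 / (z - of_real x) \<partial>\<nu>)"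
  proof (rule inverse_pos[OF s1, of "e * c"])
    show "fst s1 = 1" by (simp add: s1_def)
    fix x assume "x \<notin> {a..b}"
    then show "of_real (e * c) + ctrans s1 (\<lambda>_. 1) (complex_of_real x) \<noteq> 0"
      unfolding fac using nz e0 by simp
  qed blast
  \<comment> \<open>The representation from \<open>inverse_pos\<close> subtracts the transform of
    \<open>\<nu>\<close>, and restoring the sign of \<open>s\<close> multiplies everything by
    \<open>e\<close>; this gives the sign \<open>- e\<close>.\<close>
  define \<tau> where "\<tau> = (- e, \<nu>)"
  have "emeasure \<nu> (- F) \<noteq> 0" if "finite F" for F
    using reciprocal_infinite_support[OF s1 \<nu>(1,2) inv that] by blast
  then have \<tau>: "concentrated_inf {a..b} \<tau>"
    using \<nu> e by (auto simp: concentrated_inf_def concentrated_def \<tau>_def)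
  have s': "concentrated {a..b} s" and \<tau>': "concentrated {a..b} \<tau>" using s \<tau> by (auto dest: concentrated_infD)
  let ?U = "- (complex_of_real ` {a..b})"
  have op: "open ?U"
    using compact_imp_closed[OF compact_of_real_image[OF compact_Icc]] by (rule open_Compl)
  have T0: "of_real c + ctrans s (\<lambda>_. 1) z \<noteq> 0" if "z \<in> ?U" for z
  proof (cases "Im z = 0")
    case True
    then obtain x where "z = of_real x" by (metis complex_is_Real_iff Reals_cases)
    moreover from this have "x \<notin> {a..b}" using that by (auto simp del: atLeastAtMost_iff)
    ultimately show ?thesis using nz[of x] by simp
  next
    case False
    then show ?thesis using Im_ct_nonzero[OF s compact_Icc False] by (auto simp: complex_eq_iff)
  qed
  show thesis
  proof (rule that[OF \<tau>])
    fix z assume z: "z \<notin> complex_of_real ` {a..b}"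
    show "1 / (of_real c + ctrans s (\<lambda>_. 1) z) = of_real (e * \<beta>) * z + of_real (e * \<gamma>) + ctrans \<tau> (\<lambda>_. 1) z"
    proof (rule agree_off_real[OF op, where z = z])
      show "continuous_on ?U (\<lambda>z. 1 / (of_real c + ctrans s (\<lambda>_. 1) z))"
        by (intro continuous_intros ctrans_continuous[OF s' compact_Icc density_on_const]) (use T0 in auto)
      show "continuous_on ?U (\<lambda>z. of_real (e * \<beta>) * z + of_real (e * \<gamma>) + ctrans \<tau> (\<lambda>_. 1) z)"
        by (intro continuous_intros ctrans_continuous[OF \<tau>' compact_Icc density_on_const])
      fix z assume "Im z \<noteq> 0" and z: "z \<in> ?U"
      then have "1 / (of_real e * (of_real c + ctrans s (\<lambda>_. 1) z)) = of_real \<beta> * z + of_real \<gamma> - (\<integral>x. 1 / (z - of_real x) \<partial>\<nu>)"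
        using inv[of z] unfolding fac by simp
      moreover have "1 / (of_real c + ctrans s (\<lambda>_. 1) z) = of_real e * (1 / (of_real e * (of_real c + ctrans s (\<lambda>_. 1) z)))"
        using e0 by simp
      ultimately have "1 / (of_real c + ctrans s (\<lambda>_. 1) z) = of_real e * (of_real \<beta> * z + of_real \<gamma> - (\<integral>x. 1 / (z - of_real x) \<partial>\<nu>))"
        by simp
      then show "1 / (of_real c + ctrans s (\<lambda>_. 1) z) = of_real (e * \<beta>) * z + of_real (e * \<gamma>) + ctrans \<tau> (\<lambda>_. 1) z"
        by (simp add: ctrans_def sm_integral_def \<tau>_def scaleR_conv_of_real algebra_simps)
    qed (use z in auto)
  qed
qed

section \<open>Quotients of Cauchy transforms\<close>

lemma sm_integral_measurable:
  fixes k :: "real \<Rightarrow> real \<Rightarrow> complex"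
  assumes s: "concentrated \<Gamma> s" and k: "(\<lambda>(x, y). k x y) \<in> borel_measurable (borel \<Otimes>\<^sub>M borel)"
  shows "(\<lambda>x. sm_integral s (\<lambda>y. k x y)) \<in> borel_measurable borel"
proof -
  interpret finite_measure "snd s" using s by (simp add: concentrated_def)
  have [measurable_cong]: "sets (snd s) = sets borel" using s by (simp add: concentrated_def)
  have [measurable]: "(\<lambda>(x, y). k x y) \<in> borel_measurable (borel \<Otimes>\<^sub>M borel)" by fact
  show ?thesis unfolding sm_integral_def by measurable
qed

lemma ctrans_measurable:
  assumes s: "concentrated \<Gamma> s" and f: "density_on \<Gamma> f"
  shows "(\<lambda>x. ctrans s f (of_real x)) \<in> borel_measurable borel"
proof -
  have [measurable]: "(\<lambda>x. f (of_real x)) \<in> borel_measurable borel" using f by (simp add: density_on_def)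
  show ?thesis unfolding ctrans_def by (rule sm_integral_measurable[OF s]) measurable
qed

lemma density_on_ct:
  assumes s: "concentrated \<Gamma> s" "compact \<Gamma>" and f: "density_on \<Gamma> f" and disj: "\<Gamma> \<inter> \<Gamma>' = {}"
  shows "density_on \<Gamma>' (ctrans s f)"
  unfolding density_on_def
proof
  show "continuous_on \<Gamma>' (\<lambda>x. ctrans s f (of_real x))"
    by (rule continuous_on_compose2[OF ctrans_continuous[OF s f]])
       (use disj in \<open>auto intro!: continuous_intros\<close>)
qed (rule ctrans_measurable[OF s(1) f])

lemma density_on_uminus: "density_on \<Gamma> f \<Longrightarrow> density_on \<Gamma> (\<lambda>z. - f z)"
  by (auto simp: density_on_def intro!: continuous_intros)

text \<open>Partial fractions of \<open>1 / ((z - x) * (x - y))\<close> followed by Fubini. For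
  densities equal to 1 this is the classical relation that the transforms of the two brackets of
  \<open>s\<close> and \<open>t\<close> add up to the product of their transforms.\<close>

lemma ctrans_swap:
  assumes s: "concentrated \<Gamma> s" "compact \<Gamma>" and t: "concentrated \<Gamma>' t" "compact \<Gamma>'"
    and disj: "\<Gamma> \<inter> \<Gamma>' = {}" and f: "density_on \<Gamma> f" and g: "density_on \<Gamma>' g"
    and z: "z \<notin> complex_of_real ` \<Gamma>" "z \<notin> complex_of_real ` \<Gamma>'"
  shows "ctrans s (\<lambda>x. f x * ctrans t g x) z = ctrans s f z * ctrans t g z - ctrans t (\<lambda>y. g y * ctrans s f y) z"
proof -
  have [measurable]: "(\<lambda>x. f (of_real x)) \<in> borel_measurable borel" "(\<lambda>x. g (of_real x)) \<in> borel_measurable borel"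
    using f g by (simp_all add: density_on_def)
  have [measurable]: "(\<lambda>x. ctrans s f (of_real x)) \<in> borel_measurable borel" "(\<lambda>x. ctrans t g (of_real x)) \<in> borel_measurable borel"
    using ctrans_measurable[OF s(1) f] ctrans_measurable[OF t(1) g] .
  define k where "k x y = f (of_real x) / (z - of_real x) * (g (of_real y) / (of_real x - of_real y))" for x y :: real
  have km: "(\<lambda>(x, y). k x y) \<in> borel_measurable (borel \<Otimes>\<^sub>M borel)" unfolding k_def by measurable
  obtain d where d: "0 < d" "\<And>x. x \<in> \<Gamma> \<Longrightarrow> d \<le> norm (z - of_real x)"
    using off_compact_distance[OF s(2) z(1)] by blast
  obtain F where F: "0 < F" "\<And>x. x \<in> \<Gamma> \<Longrightarrow> norm (f (of_real x)) \<le> F"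
    using density_on_bounded[OF s(2) f] by blast
  obtain G where G: "0 < G" "\<And>x. x \<in> \<Gamma>' \<Longrightarrow> norm (g (of_real x)) \<le> G"
    using density_on_bounded[OF t(2) g] by blast
  obtain e where e: "0 < e" "\<And>x y. x \<in> \<Gamma> \<Longrightarrow> y \<in> \<Gamma>' \<Longrightarrow> e \<le> dist x y"
    using separate_compact_closed[OF s(2) compact_imp_closed[OF t(2)] disj] by blast
  have kb: "norm (k x y) \<le> F / d * (G / e)" if "x \<in> \<Gamma>" "y \<in> \<Gamma>'" for x y
  proof -
    have "e \<le> norm (complex_of_real x - of_real y)"
      using e(2)[OF that] by (simp add: dist_norm flip: of_real_diff)
    then show ?thesis unfolding k_def norm_mult norm_divide
      using F G d e that by (intro mult_mono frac_le) auto
  qed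
  have "ctrans s (\<lambda>x. f x * ctrans t g x) z = sm_integral s (\<lambda>x. sm_integral t (\<lambda>y. k x y))"
    unfolding ctrans_def k_def sm_integral_cmult by simp
  also have "\<dots> = sm_integral t (\<lambda>y. sm_integral s (\<lambda>x. k x y))"
    by (rule sm_integral_swap[OF s t km kb])
  also have "\<dots> = sm_integral t (\<lambda>y. ctrans s f z * (g (of_real y) / (z - of_real y)) - g (of_real y) * ctrans s f (of_real y) / (z - of_real y))"
  proof (rule sm_integral_cong[OF t])
    show "(\<lambda>y. sm_integral s (\<lambda>x. k x y)) \<in> borel_measurable borel"
      by (rule sm_integral_measurable[OF s(1)]) (use km in \<open>simp add: measurable_pair_swap_iff[of "\<lambda>(x, y). k y x"] case_prod_beta\<close>)
    fix y assume y: "y \<in> \<Gamma>'"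
    have yn: "complex_of_real y \<notin> complex_of_real ` \<Gamma>" using y disj by auto
    have "sm_integral s (\<lambda>x. k x y) = sm_integral s (\<lambda>x. g (of_real y) / (z - of_real y) *
       (f (of_real x) / (z - of_real x) - f (of_real x) / (of_real y - of_real x)))"
    proof (rule sm_integral_cong[OF s])
      fix x assume x: "x \<in> \<Gamma>"
      have "z \<noteq> of_real x" "z \<noteq> of_real y" "complex_of_real x \<noteq> of_real y" using x y z disj by auto
      then have nz: "z - of_real x \<noteq> 0" "z - of_real y \<noteq> 0" "of_real x - complex_of_real y \<noteq> 0" "of_real y - complex_of_real x \<noteq> 0" by auto
      have "1 / (z - of_real x) * (1 / (of_real x - of_real y)) = 1 / (z - of_real y) * (1 / (z - of_real x) - 1 / (complex_of_real y - of_real x))"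
        using nz by (simp add: divide_simps) (simp add: algebra_simps)
      then have "f (of_real x) * g (of_real y) * (1 / (z - of_real x) * (1 / (of_real x - of_real y))) =
         f (of_real x) * g (of_real y) * (1 / (z - of_real y) * (1 / (z - of_real x) - 1 / (complex_of_real y - of_real x)))" by simp
      then show "k x y = g (of_real y) / (z - of_real y) * (f (of_real x) / (z - of_real x) - f (of_real x) / (of_real y - of_real x))"
        unfolding k_def by (simp add: algebra_simps)
    qed (unfold k_def, measurable)
    also have "\<dots> = g (of_real y) / (z - of_real y) * (ctrans s f z - ctrans s f (of_real y))"
      unfolding sm_integral_cmult ctrans_def
      by (subst sm_integral_diff) (rule kernel_integrable[OF s f] z(1) yn refl)+
    finally show "sm_integral s (\<lambda>x. k x y) = ctrans s f z * (g (of_real y) / (z - of_real y)) - g (of_real y) * ctrans s f (of_real y) / (z - of_real y)"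
      by (simp add: algebra_simps)
  qed measurable
  also have "\<dots> = ctrans s f z * ctrans t g z - ctrans t (\<lambda>y. g y * ctrans s f y) z"
    unfolding ctrans_def[of t]
  proof (subst sm_integral_diff)
    show "integrable (snd t) (\<lambda>y. ctrans s f z * (g (of_real y) / (z - of_real y)))"
      by (intro integrable_mult_right kernel_integrable[OF t g z(2)])
    show "integrable (snd t) (\<lambda>y. g (of_real y) * ctrans s f (of_real y) / (z - of_real y))"
      by (rule kernel_integrable[OF t density_on_mult[OF g density_on_ct[OF s f disj]] z(2)])
  qed (simp only: sm_integral_cmult)
  finally show ?thesis .
qed

lemma ctrans_linear_mult:
  assumes s: "concentrated \<Gamma> s" "compact \<Gamma>" and f: "density_on \<Gamma> f" and z: "z \<notin> complex_of_real ` \<Gamma>"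
  shows "ctrans s (\<lambda>x. (p * x + q) * f x) z = (p * z + q) * ctrans s f z - p * sm_integral s (\<lambda>x. f (of_real x))"
proof -
  have "ctrans s (\<lambda>x. (p * x + q) * f x) z = ctrans s (\<lambda>x. p * (x * f x) + q * f x) z" by (simp add: algebra_simps)
  also have "\<dots> = p * ctrans s (\<lambda>x. x * f x) z + q * ctrans s f z"
    by (subst ctrans_add[OF s _ _ z]) (auto intro!: density_on_mult f simp: ctrans_cmult)
  finally show ?thesis by (simp add: ctrans_ident_mult[OF s f z] algebra_simps)
qed

lemma ctrans_uminus: "ctrans s (\<lambda>x. - f x) z = - ctrans s f z"
  using ctrans_cmult[of s "-1" f z] by simp

text \<open>Symmetry under conjugation records that the values on the real line are real.\<close>

definition real_continuous_off :: "real set \<Rightarrow> (complex \<Rightarrow> complex) \<Rightarrow> bool" where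
  "real_continuous_off \<Gamma> f \<longleftrightarrow> continuous_on (- (complex_of_real ` \<Gamma>)) f \<and> (\<forall>z. f (cnj z) = cnj (f z)) \<and> (\<forall>z\<in>complex_of_real ` \<Gamma>. f z = 0)"

text \<open>The value on the real line is obtained from the non-real values by continuity; on \<open>\<Gamma>\<close>,
  where no limit need exist, it is set to 0 to keep the function measurable.\<close>

definition extend_off :: "real set \<Rightarrow> (complex \<Rightarrow> complex) \<Rightarrow> complex \<Rightarrow> complex" where
  "extend_off \<Gamma> f z = (if z \<in> complex_of_real ` \<Gamma> then 0 else if z \<in> \<real> then Lim (at z within - \<real>) f else f z)"

section \<open>Extension from nonreal to real points\<close>

lemma real_continuous_off_real: "real_continuous_off \<Gamma> f \<Longrightarrow> f (of_real x) \<in> \<real>"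
  unfolding real_continuous_off_def by (metis Reals_cnj_iff complex_cnj_complex_of_real)

lemma real_continuous_off_dens:
  assumes f: "real_continuous_off \<Gamma> f" and \<Gamma>: "compact \<Gamma>" and disj: "\<Gamma>' \<inter> \<Gamma> = {}"
  shows "density_on \<Gamma>' f"
proof -
  have c: "continuous_on (- \<Gamma>) (\<lambda>x. f (of_real x))"
    by (rule continuous_on_compose2[of "- (complex_of_real ` \<Gamma>)" f])
       (use f in \<open>auto simp: real_continuous_off_def intro!: continuous_intros\<close>)
  have op: "open (- \<Gamma>)" using compact_imp_closed[OF \<Gamma>] by (rule open_Compl)
  have "(\<lambda>x. indicator (- \<Gamma>) x *\<^sub>R f (of_real x)) \<in> borel_measurable borel"
    by (rule borel_measurable_continuous_on_indicator[OF _ c]) (use op in simp)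
  also have "(\<lambda>x. indicator (- \<Gamma>) x *\<^sub>R f (of_real x)) = (\<lambda>x. f (of_real x))"
    using f by (auto simp: real_continuous_off_def indicator_def)
  finally show ?thesis
    unfolding density_on_def using disj by (auto intro: continuous_on_subset[OF c])
qed

lemma nonreal_limpt:
  fixes z :: complex
  assumes "z \<in> \<real>" shows "\<not> trivial_limit (at z within - \<real>)"
proof -
  have "z islimpt - \<real>"
    unfolding islimpt_approachable
  proof (intro allI impI)
    fix e :: real assume e: "0 < e"
    have "Im z = 0" using assms by (simp add: complex_is_Real_iff)
    then show "\<exists>x'\<in>- \<real>. x' \<noteq> z \<and> dist x' z < e"
      using e by (intro bexI[of _ "z + \<i> * of_real (e / 2)"])
        (auto simp: dist_norm complex_is_Real_iff norm_mult complex_eq_iff)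
  qed
  then show ?thesis by (simp add: trivial_limit_within)
qed

lemma extend_off_eq:
  assumes \<Gamma>: "compact \<Gamma>" and g: "continuous_on (- (complex_of_real ` \<Gamma>)) g"
    and eq: "\<And>z. Im z \<noteq> 0 \<Longrightarrow> f z = g z" and z: "z \<notin> complex_of_real ` \<Gamma>"
  shows "extend_off \<Gamma> f z = g z"
proof (cases "z \<in> \<real>")
  case True
  have op: "open (- (complex_of_real ` \<Gamma>))"
    using compact_imp_closed[OF compact_of_real_image[OF \<Gamma>]] by (rule open_Compl)
  have "isCont g z" using g op z by (simp add: continuous_on_eq_continuous_at)
  then have "(g \<longlongrightarrow> g z) (at z within - \<real>)"
    unfolding isCont_def by (rule tendsto_within_subset) simp
  moreover have "\<forall>\<^sub>F w in at z within - \<real>. g w = f w"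
    unfolding eventually_at_filter by (auto simp: eq complex_is_Real_iff)
  ultimately have "(f \<longlongrightarrow> g z) (at z within - \<real>)" by (rule Lim_transform_eventually)
  then have "Lim (at z within - \<real>) f = g z" using nonreal_limpt[OF True] by (intro tendsto_Lim)
  then show ?thesis using True z by (simp add: extend_off_def)
next
  case False
  then show ?thesis using z eq[of z] by (simp add: extend_off_def complex_is_Real_iff)
qed

lemma extend_off_nice:
  assumes \<Gamma>: "compact \<Gamma>" and g: "continuous_on (- (complex_of_real ` \<Gamma>)) g"
    and eq: "\<And>z. Im z \<noteq> 0 \<Longrightarrow> f z = g z"
    and sym: "\<And>z. z \<notin> complex_of_real ` \<Gamma> \<Longrightarrow> g (cnj z) = cnj (g z)"
  shows "real_continuous_off \<Gamma> (extend_off \<Gamma> f)"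
proof -
  have e: "extend_off \<Gamma> f z = g z" if "z \<notin> complex_of_real ` \<Gamma>" for z
    by (rule extend_off_eq[OF \<Gamma> g _ that]) (rule eq)
  have "continuous_on (- (complex_of_real ` \<Gamma>)) (extend_off \<Gamma> f)"
    using g by (subst continuous_on_cong[OF refl e]) auto
  moreover have cn: "cnj z \<notin> complex_of_real ` \<Gamma>" if "z \<notin> complex_of_real ` \<Gamma>" for z
    using that by (metis complex_cnj_cnj complex_cnj_complex_of_real image_iff)
  have "extend_off \<Gamma> f (cnj z) = cnj (extend_off \<Gamma> f z)" for z
  proof (cases "z \<in> complex_of_real ` \<Gamma>")
    case True
    then show ?thesis by (auto simp: extend_off_def)
  next
    case False
    then show ?thesis using e[OF False] e[OF cn[OF False]] sym[OF False] by simp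
  qed
  ultimately show ?thesis by (auto simp: real_continuous_off_def extend_off_def)
qed

text \<open>Inserting the formula for \<open>Ti' / Tj'\<close> under the transform defining
  \<open>Ti\<close> and exchanging the integrations by \<open>ctrans_swap\<close> makes the products
  of two transforms cancel. A linear term survives only if both \<open>cj\<close> and
  \<open>\<alpha>1\<close> are nonzero.\<close>

lemma rep_step1:
  fixes ci cj \<alpha>1 \<alpha>0 :: real
  assumes \<kappa>: "concentrated \<Gamma> \<kappa>" "compact \<Gamma>" and \<tau>: "concentrated \<Gamma>' \<tau>" "compact \<Gamma>'"
    and disj: "\<Gamma> \<inter> \<Gamma>' = {}"
    and Ti': "real_continuous_off \<Gamma>' Ti'" and Tj': "real_continuous_off \<Gamma>' Tj'" and Tj'0: "\<And>z. z \<notin> complex_of_real ` \<Gamma>' \<Longrightarrow> Tj' z \<noteq> 0"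
    and w: "density_on \<Gamma>' w"
    and Tjn: "real_continuous_off \<Gamma> Tj"
    and Ti: "\<And>z. Im z \<noteq> 0 \<Longrightarrow> Ti z = of_real ci + ctrans \<kappa> Ti' z"
    and Tj: "\<And>z. z \<notin> complex_of_real ` \<Gamma> \<Longrightarrow> Tj z = of_real cj + ctrans \<kappa> Tj' z"
    and rep: "\<And>z. Im z \<noteq> 0 \<Longrightarrow> Ti' z / Tj' z = of_real \<alpha>1 * z + of_real \<alpha>0 + ctrans \<tau> w z"
  obtains p0 :: real where
    "\<And>z. Im z \<noteq> 0 \<Longrightarrow> Ti z - Tj z * (Ti' z / Tj' z) = of_real (- cj * \<alpha>1) * z + of_real p0 + ctrans \<tau> (\<lambda>y. - Tj y * w y) z"
proof -
  let ?U = "- (complex_of_real ` \<Gamma>')"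
  have op: "open ?U" using compact_imp_closed[OF compact_of_real_image[OF \<tau>(2)]] by (rule open_Compl)
  have rep': "Ti' z / Tj' z = of_real \<alpha>1 * z + of_real \<alpha>0 + ctrans \<tau> w z" if z: "z \<in> ?U" for z
    by (rule agree_off_real[OF op _ _ rep z])
       (use Ti' Tj' Tj'0 in \<open>auto simp: real_continuous_off_def intro!: continuous_intros ctrans_continuous[OF \<tau> w]\<close>)
  have dTj': "density_on \<Gamma> Tj'" and dTi': "density_on \<Gamma> Ti'" using real_continuous_off_dens[OF _ \<tau>(2) disj] Ti' Tj' by auto
  have dct: "density_on \<Gamma> (ctrans \<tau> w)" by (rule density_on_ct[OF \<tau> w]) (use disj in auto)
  have dctk: "density_on \<Gamma>' (ctrans \<kappa> Tj')" by (rule density_on_ct[OF \<kappa> dTj' disj])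
  have "sm_integral \<kappa> (\<lambda>x. Tj' (of_real x)) \<in> \<real>"
    by (rule sm_integral_real[OF \<kappa> dTj']) (rule real_continuous_off_real[OF Tj'])
  then obtain S where S: "sm_integral \<kappa> (\<lambda>x. Tj' (of_real x)) = of_real S" by (auto elim: Reals_cases)
  show thesis
  proof (rule that[of "ci - cj * \<alpha>0 - \<alpha>1 * S"])
    fix z :: complex assume z: "Im z \<noteq> 0"
    have zn: "z \<notin> complex_of_real ` \<Gamma>" "z \<notin> complex_of_real ` \<Gamma>'" using z by auto
    have "ctrans \<kappa> Ti' z = ctrans \<kappa> (\<lambda>x. (of_real \<alpha>1 * x + of_real \<alpha>0) * Tj' x + Tj' x * ctrans \<tau> w x) z"
    proof (rule ctrans_cong[OF \<kappa> dTi'])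
      show "density_on \<Gamma> (\<lambda>x. (of_real \<alpha>1 * x + of_real \<alpha>0) * Tj' x + Tj' x * ctrans \<tau> w x)"
        by (intro density_on_add density_on_mult dTj' dct density_on_const density_on_ident)
      fix x assume x: "x \<in> \<Gamma>"
      then have xn: "complex_of_real x \<notin> complex_of_real ` \<Gamma>'" using disj by auto
      have "Ti' (of_real x) = Tj' (of_real x) * (Ti' (of_real x) / Tj' (of_real x))"
        using Tj'0[OF xn] by simp
      also have "\<dots> = Tj' (of_real x) * (of_real \<alpha>1 * of_real x + of_real \<alpha>0 + ctrans \<tau> w (of_real x))"
        using rep'[of "of_real x"] xn by simp
      finally show "Ti' (of_real x) = (of_real \<alpha>1 * of_real x + of_real \<alpha>0) * Tj' (of_real x) + Tj' (of_real x) * ctrans \<tau> w (of_real x)"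
        by (simp add: algebra_simps)
    qed
    also have "\<dots> = ctrans \<kappa> (\<lambda>x. (of_real \<alpha>1 * x + of_real \<alpha>0) * Tj' x) z + ctrans \<kappa> (\<lambda>x. Tj' x * ctrans \<tau> w x) z"
      by (rule ctrans_add[OF \<kappa> _ _ zn(1)]) (intro density_on_add density_on_mult dTj' dct density_on_const density_on_ident)+
    also have "ctrans \<kappa> (\<lambda>x. (of_real \<alpha>1 * x + of_real \<alpha>0) * Tj' x) z = (of_real \<alpha>1 * z + of_real \<alpha>0) * ctrans \<kappa> Tj' z - of_real \<alpha>1 * of_real S"
      unfolding ctrans_linear_mult[OF \<kappa> dTj' zn(1)] S ..
    also have "ctrans \<kappa> (\<lambda>x. Tj' x * ctrans \<tau> w x) z = ctrans \<kappa> Tj' z * ctrans \<tau> w z - ctrans \<tau> (\<lambda>y. w y * ctrans \<kappa> Tj' y) z"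
      by (rule ctrans_swap[OF \<kappa> \<tau> disj dTj' w zn])
    finally have 1: "ctrans \<kappa> Ti' z = (of_real \<alpha>1 * z + of_real \<alpha>0) * ctrans \<kappa> Tj' z - of_real \<alpha>1 * of_real S +
       (ctrans \<kappa> Tj' z * ctrans \<tau> w z - ctrans \<tau> (\<lambda>y. w y * ctrans \<kappa> Tj' y) z)" .
    have TjG': "Tj (of_real y) = of_real cj + ctrans \<kappa> Tj' (of_real y)" if "y \<in> \<Gamma>'" for y
      using that disj by (intro Tj) auto
    have dTj: "density_on \<Gamma>' Tj" by (rule real_continuous_off_dens[OF Tjn \<kappa>(2)]) (use disj in auto)
    have "ctrans \<tau> (\<lambda>y. - Tj y * w y) z = ctrans \<tau> (\<lambda>y. - of_real cj * w y + (- 1) * (w y * ctrans \<kappa> Tj' y)) z"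
    proof (rule ctrans_cong[OF \<tau>])
      show "density_on \<Gamma>' (\<lambda>y. - Tj y * w y)" "density_on \<Gamma>' (\<lambda>y. - of_real cj * w y + (- 1) * (w y * ctrans \<kappa> Tj' y))"
        by (intro density_on_add density_on_mult density_on_uminus dTj w dctk density_on_const)+
    qed (simp add: TjG' algebra_simps)
    also have "\<dots> = - of_real cj * ctrans \<tau> w z + (- 1) * ctrans \<tau> (\<lambda>y. w y * ctrans \<kappa> Tj' y) z"
      by (subst ctrans_add[OF \<tau> _ _ zn(2)]) (auto intro!: density_on_mult density_on_uminus w dctk simp: ctrans_cmult[of _ "- of_real cj", simplified] ctrans_uminus)
    finally have 2: "ctrans \<tau> (\<lambda>y. - Tj y * w y) z = - of_real cj * ctrans \<tau> w z - ctrans \<tau> (\<lambda>y. w y * ctrans \<kappa> Tj' y) z" by simp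
    show "Ti z - Tj z * (Ti' z / Tj' z) = of_real (- cj * \<alpha>1) * z + of_real (ci - cj * \<alpha>0 - \<alpha>1 * S) + ctrans \<tau> (\<lambda>y. - Tj y * w y) z"
      unfolding Ti[OF z] Tj[OF zn(1)] rep[OF z] 1 2 by (simp add: algebra_simps)
  qed
qed

text \<open>Dividing \<open>Ti = Tj * R + W\<close> by \<open>Tj\<close> gives
  \<open>R + W / Tj\<close>. With \<open>f = - Tj * w\<close> one has
  \<open>w = - f * (1 / Tj)\<close>; inserting the inverse of \<open>Tj\<close> and exchanging the
  integrations, the transform of \<open>w\<close> cancels against \<open>W / Tj\<close> up to a
  transform with respect to \<open>\<theta>\<close>. A linear term in \<open>W\<close> would meet
  the one in \<open>1 / Tj\<close> and produce a quadratic one.\<close>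

lemma rep_step2:
  fixes \<alpha>1 \<alpha>0 p0 l1 l0 :: real
  assumes \<theta>: "concentrated \<Gamma> \<theta>" "compact \<Gamma>" and \<tau>: "concentrated \<Gamma>' \<tau>" "compact \<Gamma>'"
    and disj: "\<Gamma> \<inter> \<Gamma>' = {}"
    and w: "density_on \<Gamma>' w" "\<And>x. x \<in> \<Gamma>' \<Longrightarrow> w (of_real x) \<in> \<real>"
    and Tjn: "real_continuous_off \<Gamma> Tj" and Tj0: "\<And>z. z \<notin> complex_of_real ` \<Gamma> \<Longrightarrow> Tj z \<noteq> 0"
    and inv: "\<And>z. z \<notin> complex_of_real ` \<Gamma> \<Longrightarrow> 1 / Tj z = of_real l1 * z + of_real l0 + ctrans \<theta> (\<lambda>_. 1) z"
    and rep: "\<And>z. Im z \<noteq> 0 \<Longrightarrow> R z = of_real \<alpha>1 * z + of_real \<alpha>0 + ctrans \<tau> w z"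
    and W: "density_on \<Gamma> W" "\<And>z. z \<notin> complex_of_real ` \<Gamma>' \<Longrightarrow> W z = of_real p0 + ctrans \<tau> (\<lambda>y. - Tj y * w y) z"
    and eq: "\<And>z. Im z \<noteq> 0 \<Longrightarrow> Ti z - Tj z * R z = W z"
  obtains q1 q0 :: real where
    "\<And>z. Im z \<noteq> 0 \<Longrightarrow> Ti z / Tj z = of_real q1 * z + of_real q0 + ctrans \<theta> W z"
proof -
  have dTj: "density_on \<Gamma>' Tj" by (rule real_continuous_off_dens[OF Tjn \<theta>(2)]) (use disj in auto)
  define f where "f y = - Tj y * w y" for y
  have df: "density_on \<Gamma>' f" unfolding f_def by (intro density_on_mult density_on_uminus dTj w)
  have d1: "density_on \<Gamma>' (ctrans \<theta> (\<lambda>_. 1))" by (rule density_on_ct[OF \<theta> density_on_const disj])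
  have dcf: "density_on \<Gamma> (ctrans \<tau> f)" by (rule density_on_ct[OF \<tau> df]) (use disj in auto)
  have "sm_integral \<tau> (\<lambda>x. f (of_real x)) \<in> \<real>"
    by (rule sm_integral_real[OF \<tau> df]) (auto simp: f_def intro!: Reals_minus Reals_mult real_continuous_off_real[OF Tjn] w)
  then obtain S where S: "sm_integral \<tau> (\<lambda>x. f (of_real x)) = of_real S" by (auto elim: Reals_cases)
  show thesis
  proof (rule that[of "\<alpha>1 + p0 * l1" "\<alpha>0 + p0 * l0 + l1 * S"])
    fix z :: complex assume z: "Im z \<noteq> 0"
    have zn: "z \<notin> complex_of_real ` \<Gamma>" "z \<notin> complex_of_real ` \<Gamma>'" using z by auto
    have "ctrans \<tau> w z = ctrans \<tau> (\<lambda>y. (- of_real l1 * y + - of_real l0) * f y + (- 1) * (f y * ctrans \<theta> (\<lambda>_. 1) y)) z"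
    proof (rule ctrans_cong[OF \<tau> w(1)])
      show "density_on \<Gamma>' (\<lambda>y. (- of_real l1 * y + - of_real l0) * f y + (- 1) * (f y * ctrans \<theta> (\<lambda>_. 1) y))"
        by (intro density_on_add density_on_mult df d1 density_on_const density_on_ident)
      fix y assume "y \<in> \<Gamma>'"
      then have y: "complex_of_real y \<notin> complex_of_real ` \<Gamma>" using disj by auto
      have "w (of_real y) = Tj (of_real y) * w (of_real y) * (1 / Tj (of_real y))"
        using Tj0[OF y] by simp
      then show "w (of_real y) = (- of_real l1 * of_real y + - of_real l0) * f (of_real y) + (- 1) * (f (of_real y) * ctrans \<theta> (\<lambda>_. 1) (of_real y))"
        unfolding inv[OF y] f_def by (simp add: algebra_simps)
    qed
    also have "\<dots> = ctrans \<tau> (\<lambda>y. (- of_real l1 * y + - of_real l0) * f y) z + ctrans \<tau> (\<lambda>y. (- 1) * (f y * ctrans \<theta> (\<lambda>_. 1) y)) z"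
      by (rule ctrans_add[OF \<tau> _ _ zn(2)]) (intro density_on_add density_on_mult df d1 density_on_const density_on_ident)+
    also have "ctrans \<tau> (\<lambda>y. (- of_real l1 * y + - of_real l0) * f y) z = (- of_real l1 * z + - of_real l0) * ctrans \<tau> f z - (- of_real l1) * of_real S"
      unfolding ctrans_linear_mult[OF \<tau> df zn(2)] S ..
    also have "ctrans \<tau> (\<lambda>y. (- 1) * (f y * ctrans \<theta> (\<lambda>_. 1) y)) z = - (ctrans \<tau> f z * ctrans \<theta> (\<lambda>_. 1) z - ctrans \<theta> (\<lambda>y. 1 * ctrans \<tau> f y) z)"
      unfolding ctrans_cmult by (subst ctrans_swap[OF \<tau> \<theta> _ df density_on_const zn(2,1)]) (use disj in auto)
    finally have 1: "ctrans \<tau> w z = - ctrans \<tau> f z * (1 / Tj z) + of_real l1 * of_real S + ctrans \<theta> (ctrans \<tau> f) z"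
      unfolding inv[OF zn(1)] by (simp add: algebra_simps)
    have "ctrans \<theta> W z = ctrans \<theta> (\<lambda>x. of_real p0 * 1 + ctrans \<tau> f x) z"
    proof (rule ctrans_cong[OF \<theta> W(1)])
      fix x assume "x \<in> \<Gamma>"
      then have "complex_of_real x \<notin> complex_of_real ` \<Gamma>'" using disj by auto
      then show "W (of_real x) = of_real p0 * 1 + ctrans \<tau> f (of_real x)" by (simp add: W(2) f_def[abs_def])
    qed (auto intro!: density_on_add dcf)
    also have "\<dots> = of_real p0 * ctrans \<theta> (\<lambda>_. 1) z + ctrans \<theta> (ctrans \<tau> f) z"
      by (subst ctrans_add[OF \<theta> _ _ zn(1)]) (auto intro!: dcf simp: ctrans_cmult[of _ "of_real p0" "\<lambda>_. 1", simplified])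
    finally have 2: "ctrans \<theta> W z = of_real p0 * ctrans \<theta> (\<lambda>_. 1) z + ctrans \<theta> (ctrans \<tau> f) z" .
    have "Ti z = Tj z * R z + W z" using eq[OF z] by (simp add: algebra_simps)
    then have "Ti z / Tj z = R z + W z * (1 / Tj z)" using Tj0[OF zn(1)] by (simp add: field_simps)
    also have "W z = of_real p0 + ctrans \<tau> f z" using W(2)[OF zn(2)] by (simp add: f_def[abs_def])
    also have "(of_real p0 + ctrans \<tau> f z) * (1 / Tj z) = of_real p0 * (1 / Tj z) + ctrans \<tau> f z * (1 / Tj z)" by (rule distrib_right)
    also have "R z + (of_real p0 * (1 / Tj z) + ctrans \<tau> f z * (1 / Tj z)) =
        of_real \<alpha>1 * z + of_real \<alpha>0 + of_real p0 * (of_real l1 * z + of_real l0 + ctrans \<theta> (\<lambda>_. 1) z) + of_real l1 * of_real S + ctrans \<theta> (ctrans \<tau> f) z"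
      unfolding rep[OF z] 1 by (simp add: inv[OF zn(1)] algebra_simps)
    also have "\<dots> = of_real (\<alpha>1 + p0 * l1) * z + of_real (\<alpha>0 + p0 * l0 + l1 * S) + ctrans \<theta> W z"
      unfolding 2 by (simp add: algebra_simps)
    finally show "Ti z / Tj z = of_real (\<alpha>1 + p0 * l1) * z + of_real (\<alpha>0 + p0 * l0 + l1 * S) + ctrans \<theta> W z" .
  qed
qed

lemma inverse_ct:
  fixes a b c :: real
  assumes s: "concentrated_inf {a..b} s" and f: "density_on {a..b} f"
    and re: "\<And>x. x \<in> {a..b} \<Longrightarrow> f (of_real x) \<in> \<real>" and f0: "\<And>x. x \<in> {a..b} \<Longrightarrow> f (of_real x) \<noteq> 0"
    and nz: "\<And>x. x \<notin> {a..b} \<Longrightarrow> of_real c + ctrans s f (complex_of_real x) \<noteq> 0"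
  obtains \<tau> \<beta> \<gamma> where "concentrated_inf {a..b} \<tau>"
    "\<And>z. z \<notin> complex_of_real ` {a..b} \<Longrightarrow> 1 / (of_real c + ctrans s f z) = of_real \<beta> * z + of_real \<gamma> + ctrans \<tau> (\<lambda>_. 1) z"
proof -
  obtain s' where s': "concentrated_inf {a..b} s'"
    and ctrans: "\<And>g z. density_on {a..b} g \<Longrightarrow> ctrans s (\<lambda>z. f z * g z) z = ctrans s' g z"
    using absorb_density[OF s f re f0] by blast
  have ct1: "ctrans s f z = ctrans s' (\<lambda>_. 1) z" for z using ctrans[of "\<lambda>_. 1" z] by simp
  show thesis
    by (rule inverse_ct_one[OF s', of c]) (use nz in \<open>simp add: ct1\<close>, rule that, simp_all add: ct1)
qed

text \<open>Absorbing the density reduces both claims to the transform of a measure. The lower bound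
  is uniform in the real constant \<open>c\<close> because it rests on the imaginary part.\<close>

lemma
  assumes s: "concentrated_inf {a..b} s" and f: "density_on {a..b} f"
    and re: "\<And>x. x \<in> {a..b} \<Longrightarrow> f (of_real x) \<in> \<real>" and f0: "\<And>x. x \<in> {a..b} \<Longrightarrow> f (of_real x) \<noteq> 0"
  shows ctrans_density_nonzero: "z \<notin> complex_of_real ` {a..b} \<Longrightarrow> ctrans s f z \<noteq> 0"
    and ctrans_density_i_lower: "\<exists>d>0. \<forall>y\<ge>1. \<forall>c. d / y \<le> norm (of_real c + ctrans s f (\<i> * of_real y))"
proof -
  obtain s' where s': "concentrated_inf {a..b} s'"
    and ctrans: "\<And>g z. density_on {a..b} g \<Longrightarrow> ctrans s (\<lambda>z. f z * g z) z = ctrans s' g z"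
    using absorb_density[OF s f re f0] by blast
  have ct1: "ctrans s f z = ctrans s' (\<lambda>_. 1) z" for z using ctrans[of "\<lambda>_. 1" z] by simp
  show "z \<notin> complex_of_real ` {a..b} \<Longrightarrow> ctrans s f z \<noteq> 0"
    unfolding ct1 by (rule ctrans_nonzero[OF s'])
  obtain R m where R: "0 < R" "0 < m"
    and l: "\<And>z. Im z \<noteq> 0 \<Longrightarrow> \<bar>Im z\<bar> * m / (norm z + R)\<^sup>2 \<le> \<bar>Im (ctrans s' (\<lambda>_. 1) z)\<bar>"
    using Im_ct_lower_bound[OF s' compact_Icc] by blast
  have "m / (1 + R)\<^sup>2 / y \<le> norm (of_real c + ctrans s f (\<i> * of_real y))" if y: "1 \<le> y" for y c
  proof -
    have "y + R \<le> y * (1 + R)" using y R by (simp add: algebra_simps mult_le_cancel_right1)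
    then have "(y + R)\<^sup>2 \<le> (y * (1 + R))\<^sup>2" using y R by (intro power_mono) auto
    then have "y * m / (y * (1 + R))\<^sup>2 \<le> y * m / (y + R)\<^sup>2"
      using y R by (intro divide_left_mono mult_pos_pos zero_less_power) auto
    also have "\<dots> \<le> \<bar>Im (ctrans s' (\<lambda>_. 1) (\<i> * of_real y))\<bar>"
      using l[of "\<i> * of_real y"] y by (simp add: norm_mult)
    also have "\<dots> \<le> norm (of_real c + ctrans s f (\<i> * of_real y))"
      using abs_Im_le_cmod[of "of_real c + ctrans s f (\<i> * of_real y)"] by (simp add: ct1)
    also have "y * m / (y * (1 + R))\<^sup>2 = m / (1 + R)\<^sup>2 / y" using y by (simp add: power2_eq_square)
    finally show ?thesis .
  qed
  moreover have "0 < m / (1 + R)\<^sup>2" using R by simp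
  ultimately show "\<exists>d>0. \<forall>y\<ge>1. \<forall>c. d / y \<le> norm (of_real c + ctrans s f (\<i> * of_real y))" by blast
qed

section \<open>Elimination in a triangular array\<close>

text \<open>The gap of \<open>J\<close>. Columns below it need no elimination: in a triangular array
  they already vanish in row \<open>mex J\<close> and in all later rows.\<close>

definition mex :: "nat set \<Rightarrow> nat" where
  "mex J = (LEAST i. i \<notin> J)"

text \<open>The number of columns that really have to be eliminated from row \<open>mex J\<close>;
  the measure of the main inductions.\<close>

definition above_mex :: "nat set \<Rightarrow> nat" where
  "above_mex J = card {i \<in> J. mex J < i}"

section \<open>Behaviour of the gap when elements are added\<close>

lemma mex_notin: "finite J \<Longrightarrow> mex J \<notin> J"
  unfolding mex_def by (rule LeastI_ex) (rule ex_new_if_finite[OF infinite_UNIV_nat])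

lemma mex_least: "i \<notin> J \<Longrightarrow> mex J \<le> i"
  unfolding mex_def by (rule Least_le)

lemma mex_eqI: "x \<notin> J \<Longrightarrow> (\<And>i. i < x \<Longrightarrow> i \<in> J) \<Longrightarrow> mex J = x"
  unfolding mex_def by (rule Least_equality) (auto simp: not_less[symmetric])

lemma mex_insert: "finite J \<Longrightarrow> N \<noteq> mex J \<Longrightarrow> mex (insert N J) = mex J"
  by (rule mex_eqI) (use mex_notin mex_least[of _ J] in force)+

lemma mex_insert_mex: "finite J \<Longrightarrow> mex J < mex (insert (mex J) J)"
  using mex_least[of "mex (insert (mex J) J)" J] mex_notin[of "insert (mex J) J"] by (auto simp: le_less)

lemma mex_lessThan: "mex {..<n} = n"
  by (rule mex_eqI) auto

lemma no_high: "\<not> (\<exists>x\<in>J. mex J < x) \<Longrightarrow> finite J \<Longrightarrow> J = {..<mex J}"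
proof (intro equalityI subsetI)
  fix x assume a: "\<not> (\<exists>x\<in>J. mex J < x)" "finite J" "x \<in> J"
  then have "x \<le> mex J" "x \<noteq> mex J" using mex_notin[OF a(2)] by (auto simp: not_less)
  then show "x \<in> {..<mex J}" by simp
next
  fix x assume "x \<in> {..<mex J}"
  then show "x \<in> J" using mex_least[of x J] by (meson lessThan_iff not_less)
qed

lemma above_mex_insert: "finite J \<Longrightarrow> N \<notin> J \<Longrightarrow> mex J < N \<Longrightarrow> above_mex (insert N J) = Suc (above_mex J)"
proof -
  assume a: "finite J" "N \<notin> J" "mex J < N"
  then have "{i \<in> insert N J. mex J < i} = insert N {i \<in> J. mex J < i}" by auto
  with a show ?thesis by (simp add: above_mex_def mex_insert)
qed

lemma above_mex_insert_mex: "finite J \<Longrightarrow> above_mex (insert (mex J) J) \<le> above_mex J"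
  unfolding above_mex_def using mex_insert_mex[of J] by (intro card_mono) auto

lemma max_split:
  assumes "finite J" "x \<in> J" "mex J < x"
  obtains N J' where "J = insert N J'" "N \<notin> J'" "finite J'" "mex J' < N" "mex J' = mex J" "\<And>j. j \<in> J' \<Longrightarrow> j < N" "x \<le> N"
proof (rule that[of "Max J" "J - {Max J}"])
  have M: "Max J \<in> J" using assms by (intro Max_in) auto
  show eq: "J = insert (Max J) (J - {Max J})" using M by auto
  have x: "x \<le> Max J" using assms by auto
  show "mex (J - {Max J}) = mex J"
  proof (rule mex_eqI)
    show "mex J \<notin> J - {Max J}" using mex_notin[OF assms(1)] by simp
    fix i assume i: "i < mex J"
    then have "i \<in> J" using mex_least[of i J] by (meson not_less)
    then show "i \<in> J - {Max J}" using i x assms(3) by auto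
  qed
  then show "mex (J - {Max J}) < Max J" using assms(3) x by linarith
  show "j < Max J" if "j \<in> J - {Max J}" for j
    using that assms(1) by (simp add: order.not_eq_order_implies_strict)
qed (use assms in auto)

text \<open>Row \<open>mex J\<close> of the triangular array \<open>M\<close> after elimination of the columns in \<open>J\<close> by means of the rows below.\<close>

function elim :: "(nat \<Rightarrow> nat \<Rightarrow> complex) \<Rightarrow> nat set \<Rightarrow> nat \<Rightarrow> complex" where
  "elim M J i = (if finite J \<and> (\<exists>x\<in>J. mex J < x)
     then elim M (J - {Max J}) i
       - elim M (J - {Max J}) (Max J) / elim M (insert (mex J) (J - {Max J})) (Max J)
         * elim M (insert (mex J) (J - {Max J})) i
     else M (mex J) i)"
  by pat_completeness auto
termination
proof (relation "Wellfounded.measure (\<lambda>(M, J, i). above_mex J)", goal_cases)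
  case 1
  show ?case by simp
next
  \<comment> \<open>Removing \<open>Max J\<close> lowers \<open>above_mex\<close> by one, and
    filling the gap afterwards cannot raise it again.\<close>
  have *: "above_mex (J - {Max J}) < above_mex J \<and> above_mex (insert (mex J) (J - {Max J})) < above_mex J" if J: "finite J \<and> (\<exists>x\<in>J. mex J < x)" for J :: "nat set"
  proof -
    obtain x where x: "x \<in> J" "mex J < x" "finite J" using J by blast
    obtain N J' where N: "J = insert N J'" "N \<notin> J'" "finite J'" "mex J' < N" "mex J' = mex J" "\<And>j. j \<in> J' \<Longrightarrow> j < N" "x \<le> N"
      using max_split[OF x(3,1,2)] by metis
    have "Max J = N" using N by (intro Max_eqI) (auto simp: less_imp_le)
    then have "J - {Max J} = J'" using N by auto
    then show ?thesis using above_mex_insert[OF N(3,2,4)] above_mex_insert_mex[OF N(3)] N(1,5) by simp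
  qed
  {
    case (2 M J i) then show ?case using * by simp
  next
    case (3 M J i) then show ?case using * by simp
  next
    case (4 M J i) then show ?case using * by simp
  next
    case (5 M J i) then show ?case using * by simp
  }
qed

declare elim.simps [simp del]

lemma elim_base: "elim M {..<n} i = M n i"
  by (subst elim.simps) (simp add: mex_lessThan)

lemma elim_insert:
  assumes J: "finite J" "mex J < N" "\<And>j. j \<in> J \<Longrightarrow> j < N"
  shows "elim M (insert N J) i = elim M J i - elim M J N / elim M (insert (mex J) J) N * elim M (insert (mex J) J) i"
proof -
  have "Max (insert N J) = N" using J by (intro Max_eqI) (auto simp: less_imp_le)
  moreover have "insert N J - {N} = J" using J(3) by blast
  moreover have "mex (insert N J) = mex J" using J by (intro mex_insert) auto
  ultimately show ?thesis using J(1,2) by (subst elim.simps) simp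
qed

text \<open>Mirrors the recursion of \<open>elim\<close>: the hypothesis for all \<open>I\<close>
  with at most as many columns above the gap covers both sets that occur there, \<open>J\<close> and
  \<open>insert (mex J) J\<close>.\<close>

lemma flag_induct [consumes 1, case_names base step]:
  assumes "finite J"
    and base: "\<And>n. P {..<n}"
    and step: "\<And>J N. finite J \<Longrightarrow> mex J < N \<Longrightarrow> (\<And>j. j \<in> J \<Longrightarrow> j < N) \<Longrightarrow> N \<notin> J \<Longrightarrow>
       (\<And>I. finite I \<Longrightarrow> above_mex I \<le> above_mex J \<Longrightarrow> P I) \<Longrightarrow> P (insert N J)"
  shows "P J"
  using assms(1)
proof (induction "above_mex J" arbitrary: J rule: less_induct)
  case less
  show ?case
  proof (cases "\<exists>x\<in>J. mex J < x")
    case False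
    then show ?thesis using no_high[OF False less.prems] base[of "mex J"] by simp
  next
    case True
    then obtain x where x: "x \<in> J" "mex J < x" by blast
    obtain N J' where N: "J = insert N J'" "N \<notin> J'" "finite J'" "mex J' < N" "mex J' = mex J" "\<And>j. j \<in> J' \<Longrightarrow> j < N" "x \<le> N"
      using max_split[OF less.prems x] by metis
    show ?thesis unfolding N(1)
      by (rule step[OF N(3,4,6,2)]) (use less.hyps N above_mex_insert[OF N(3,2,4)] in auto)
  qed
qed

text \<open>Nonvanishing is assumed only for sets with smaller \<open>above_mex\<close>, so that the
  lemma is available inside the induction that establishes nonvanishing.\<close>

lemma elim_mex_zero_aux:
  fixes M :: "nat \<Rightarrow> nat \<Rightarrow> complex"
  assumes diag: "\<And>r. M r r = 1" and low: "\<And>r i. i < r \<Longrightarrow> M r i = 0"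
    and "finite J" "J \<subseteq> {..m}"
    and pure: "\<And>I N. I \<subseteq> {..m} \<Longrightarrow> above_mex I < above_mex J \<Longrightarrow> N \<le> m \<Longrightarrow> (\<And>j. j \<in> I \<Longrightarrow> j < N) \<Longrightarrow> elim M I N \<noteq> 0"
  shows "elim M J (mex J) = 1 \<and> (\<forall>i\<in>J. elim M J i = 0)"
  using assms(3-)
proof (induction J rule: flag_induct)
  case (base n)
  show ?case by (simp add: elim_base mex_lessThan diag low)
next
  case (step J N)
  have sub: "J \<subseteq> {..m}" "insert (mex J) J \<subseteq> {..m}" "N \<le> m" using step.prems(1) step.hyps(2) by auto
  have h: "above_mex (insert N J) = Suc (above_mex J)" by (rule above_mex_insert[OF step.hyps(1,4,2)])
  have hB: "above_mex (insert (mex J) J) \<le> above_mex J" by (rule above_mex_insert_mex[OF step.hyps(1)])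
  have IH: "elim M I (mex I) = 1 \<and> (\<forall>i\<in>I. elim M I i = 0)" if "finite I" "above_mex I \<le> above_mex J" "I \<subseteq> {..m}" for I
    using that h by (intro step.IH step.prems(2)) auto
  have 1: "elim M J (mex J) = 1" "\<forall>i\<in>J. elim M J i = 0" using IH[of J] step.hyps(1) sub by auto
  have 2: "\<forall>i\<in>insert (mex J) J. elim M (insert (mex J) J) i = 0"
    using IH[of "insert (mex J) J"] step.hyps(1) hB sub by auto
  have nz: "elim M (insert (mex J) J) N \<noteq> 0"
    using step.hyps sub h hB by (intro step.prems(2)) auto
  have eq: "elim M (insert N J) i = elim M J i - elim M J N / elim M (insert (mex J) J) N * elim M (insert (mex J) J) i" for i
    by (rule elim_insert) (use step.hyps in auto)
  show ?case
    using 1 2 nz step.hyps(1,2) by (auto simp: eq mex_insert)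
qed

text \<open>Columns \<open>j\<close> and \<open>N\<close> are removed from row \<open>A\<close> by
  means of rows \<open>B\<close> and \<open>C\<close>, in either order. Both orders divide by the
  same 2 by 2 minor \<open>D\<close>, up to the factors \<open>- C j\<close> and
  \<open>C N\<close>.\<close>

lemma elim_alg_identity:
  fixes A B C :: "nat \<Rightarrow> complex"
  assumes "B j \<noteq> 0" "B N \<noteq> 0" "C j \<noteq> 0" "C N \<noteq> 0" "B N - B j / C j * C N \<noteq> 0" "B j - B N / C N * C j \<noteq> 0"
  shows "(A i - A j / B j * B i) - (A N - A j / B j * B N) / (B N - B j / C j * C N) * (B i - B j / C j * C i)
     = (A i - A N / B N * B i) - (A j - A N / B N * B j) / (B j - B N / C N * C j) * (B i - B N / C N * C i)"
proof -
  define D where "D = B j * C N - B N * C j"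
  have e1: "B N - B j / C j * C N = - D / C j" and e2: "B j - B N / C N * C j = D / C N"
    using assms by (simp_all add: D_def field_simps)
  have D: "D \<noteq> 0" using assms(6) e2 by auto
  show ?thesis unfolding e1 e2 using assms D
    by (simp add: divide_simps) (simp add: D_def algebra_simps)
qed

text \<open>Eliminating \<open>N\<close> and eliminating \<open>j\<close> subtract multiples of the
  same row from the same row. The entry left at \<open>j\<close> in the first case and the one left
  at \<open>N\<close> in the second are one determinant, up to sign and divisor.\<close>

lemma elim_star:
  assumes J: "finite J" "\<And>x. x \<in> J \<Longrightarrow> x < N" "mex J < N"
    and j: "elim M (insert (mex J) J) j \<noteq> 0" "elim M (insert (mex J) J) N \<noteq> 0"
    and rec: "elim M (insert j J) N = elim M J N - elim M J j / elim M (insert (mex J) J) j * elim M (insert (mex J) J) N"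
  shows "elim M (insert N J) j = - (elim M (insert (mex J) J) j / elim M (insert (mex J) J) N) * elim M (insert j J) N"
proof -
  have eq: "elim M (insert N J) j = elim M J j - elim M J N / elim M (insert (mex J) J) N * elim M (insert (mex J) J) j"
    by (rule elim_insert) (use J in auto)
  show ?thesis unfolding eq rec using j by (simp add: field_simps)
qed

section \<open>Independence of the order of elimination\<close>

locale triangular =
  fixes m :: nat and M :: "nat \<Rightarrow> nat \<Rightarrow> complex"
  assumes diag: "M r r = 1" and low: "i < r \<Longrightarrow> M r i = 0"
    and pure: "\<And>J N. J \<subseteq> {..m} \<Longrightarrow> N \<le> m \<Longrightarrow> (\<And>j. j \<in> J \<Longrightarrow> j < N) \<Longrightarrow> elim M J N \<noteq> 0"
begin

lemma elim_mex_zero: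
  assumes "finite J" "J \<subseteq> {..m}"
  shows "elim M J (mex J) = 1 \<and> (\<forall>i\<in>J. elim M J i = 0)"
  by (rule elim_mex_zero_aux[OF diag low assms]) (simp_all add: pure)

text \<open>The two halves are intertwined. Nonvanishing left of \<open>Max J\<close> comes from
  \<open>elim_star\<close>, which uses the recursion for fewer columns; the recursion for a column
  left of \<open>Max J\<close> comes from \<open>elim_alg_identity\<close>, whose divisors must not
  vanish.\<close>

theorem elim_nonzero_rec:
  assumes "J \<subseteq> {..m}"
  shows "(\<forall>j\<le>m. j \<notin> J \<longrightarrow> elim M J j \<noteq> 0) \<and>
    (\<forall>j\<le>m. j \<notin> J \<longrightarrow> j \<noteq> mex J \<longrightarrow> (\<forall>i. elim M (insert j J) i =
       elim M J i - elim M J j / elim M (insert (mex J) J) j * elim M (insert (mex J) J) i))"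
  using assms
proof (induction "above_mex J" arbitrary: J rule: less_induct)
  case less
  define k where "k = above_mex J"
  have NV: "elim M I j \<noteq> 0" if "above_mex I < k" "I \<subseteq> {..m}" "j \<le> m" "j \<notin> I" for I j
    using less.hyps[of I] that unfolding k_def by blast
  have R: "elim M (insert j I) i = elim M I i - elim M I j / elim M (insert (mex I) I) j * elim M (insert (mex I) I) i"
    if "above_mex I < k" "I \<subseteq> {..m}" "j \<le> m" "j \<notin> I" "j \<noteq> mex I" for I j i
    using less.hyps[of I] that unfolding k_def by blast
  have NVk: "elim M I j \<noteq> 0" if I: "above_mex I \<le> k" "I \<subseteq> {..m}" "j \<le> m" "j \<notin> I" for I j
  proof (cases "\<forall>x\<in>I. x < j")
    case True
    then show ?thesis using I by (intro pure) auto
  next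
    case False
    then obtain x where x: "x \<in> I" "j < x" using I by (metis linorder_neqE_nat)
    have finI: "finite I" using I(2) finite_subset by blast
    show ?thesis
    proof (cases "j = mex I")
      case True
      then show ?thesis using elim_mex_zero[OF finI I(2)] by simp
    next
      case jmu: False
      then have mj: "mex I < j" using mex_least[OF I(4)] by simp
      then have mx: "mex I < x" using x by simp
      obtain N J' where N: "I = insert N J'" "N \<notin> J'" "finite J'" "mex J' < N" "mex J' = mex I" "\<And>j. j \<in> J' \<Longrightarrow> j < N" "x \<le> N"
        using max_split[OF finI x(1) mx] by metis
      have hiJ': "above_mex J' < k" using above_mex_insert[OF N(3,2,4)] I(1) N(1) by simp
      have hiB: "above_mex (insert (mex J') J') < k" using above_mex_insert_mex[OF N(3)] hiJ' by simp
      have sub: "J' \<subseteq> {..m}" "insert (mex J') J' \<subseteq> {..m}" "N \<le> m" using N I(2) by auto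
      have jn: "j \<notin> insert (mex J') J'" using I(4) jmu N(1,5) by auto
      have jN: "j < N" using x N(7) by simp
      have Bj: "elim M (insert (mex J') J') j \<noteq> 0" by (rule NV[OF hiB sub(2) I(3) jn])
      have BN: "elim M (insert (mex J') J') N \<noteq> 0" using N sub by (intro pure) auto
      have jJN: "elim M (insert j J') N \<noteq> 0" using N sub I(3) jN by (intro pure) auto
      have rec: "elim M (insert j J') N = elim M J' N - elim M J' j / elim M (insert (mex J') J') j * elim M (insert (mex J') J') N"
        using jn by (intro R hiJ' sub I(3)) auto
      have "elim M (insert N J') j = - (elim M (insert (mex J') J') j / elim M (insert (mex J') J') N) * elim M (insert j J') N"
        by (rule elim_star[OF N(3) _ N(4) Bj BN rec]) (rule N(6))
      then show ?thesis unfolding N(1) using Bj BN jJN by simp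
    qed
  qed
  have Rk: "elim M (insert j J) i = elim M J i - elim M J j / elim M (insert (mex J) J) j * elim M (insert (mex J) J) i"
    if j: "j \<le> m" "j \<notin> J" "j \<noteq> mex J" for j i
  proof -
    have finJ: "finite J" using less.prems finite_subset by blast
    have mj: "mex J < j" using mex_least[OF j(2)] j(3) by simp
    show ?thesis
    proof (cases "\<forall>x\<in>J. x < j")
      case True
      then show ?thesis using mj by (intro elim_insert finJ) auto
    next
      case False
      then obtain x where x: "x \<in> J" "j < x" using j by (metis linorder_neqE_nat)
      then have mx: "mex J < x" using mj by simp
      obtain N J' where N: "J = insert N J'" "N \<notin> J'" "finite J'" "mex J' < N" "mex J' = mex J" "\<And>j. j \<in> J' \<Longrightarrow> j < N" "x \<le> N"
        using max_split[OF finJ x(1) mx] by metis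
      define B where "B = insert (mex J') J'"
      define \<nu> where "\<nu> = mex B"
      have finB: "finite B" using N(3) by (simp add: B_def)
      have hiJ': "above_mex J' < k" using above_mex_insert[OF N(3,2,4)] N(1) by (simp add: k_def)
      have hiB: "above_mex B < k" using above_mex_insert_mex[OF N(3)] hiJ' by (simp add: B_def)
      have hiC: "above_mex (insert \<nu> B) < k" using above_mex_insert_mex[OF finB] hiB by (simp add: \<nu>_def)
      have jN: "j < N" using x N(7) by simp
      have jB: "j \<notin> B" using j N(1,5) by (auto simp: B_def)
      have \<nu>j: "\<nu> \<le> j" unfolding \<nu>_def by (rule mex_least[OF jB])
      have sub: "J' \<subseteq> {..m}" "B \<subseteq> {..m}" "N \<le> m" "insert \<nu> B \<subseteq> {..m}"
        using N less.prems \<nu>j jN by (auto simp: B_def)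
      have BltN: "x < N" if "x \<in> B" for x using that N by (auto simp: B_def)
      have \<nu>N: "\<nu> < N" using \<nu>j jN by simp
      define A where "A = elim M J'"
      define Bf where "Bf = elim M B"
      define C where "C = elim M (insert \<nu> B)"
      define E where "E = elim M (insert N B)"
      have 1: "elim M J l = A l - A N / Bf N * Bf l" for l
        unfolding N(1) A_def Bf_def B_def by (rule elim_insert[OF N(3,4,6)])
      have 2: "E l = Bf l - Bf N / C N * C l" for l
        unfolding E_def Bf_def C_def \<nu>_def by (rule elim_insert[OF finB]) (use \<nu>N BltN in \<open>auto simp: \<nu>_def\<close>)
      have 3: "elim M (insert j J') l = A l - A j / Bf j * Bf l" for l
        unfolding A_def Bf_def B_def using j jB N(5) by (intro R hiJ' sub) (auto simp: B_def)
      have mujJ': "mex (insert j J') = mex J'" using j N(3,5) by (intro mex_insert) auto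
      have BJ: "insert (mex J') (insert j J') = insert j B" "insert (mex J) J = insert N B"
        "insert j J = insert N (insert j J')" using N(1,5) by (auto simp: B_def)
      have 4: "elim M (insert j J) l = elim M (insert j J') l - elim M (insert j J') N / elim M (insert j B) N * elim M (insert j B) l" for l
        unfolding BJ(3) by (subst elim_insert) (use N jN mujJ' BJ in auto)
      have Bj0: "Bf j \<noteq> 0" unfolding Bf_def by (rule NV[OF hiB sub(2) j(1) jB])
      have BN0: "Bf N \<noteq> 0" unfolding Bf_def using BltN by (intro pure sub)
      have CN0: "C N \<noteq> 0" unfolding C_def using BltN \<nu>N by (intro pure sub) auto
      have jBN0: "elim M (insert j B) N \<noteq> 0" using BltN jN sub j(1) by (intro pure) auto
      have NB: "N \<notin> B" using BltN by blast
      have hiE: "above_mex (insert N B) \<le> k"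
        using above_mex_insert[OF finB NB] hiB \<nu>N by (simp add: \<nu>_def)
      have Ej0: "E j \<noteq> 0" unfolding E_def by (rule NVk[OF hiE]) (use sub j(1) jB jN in auto)
      show ?thesis
      proof (cases "j = \<nu>")
        case False
        have jC: "j \<notin> insert \<nu> B" using jB False by simp
        have Cj0: "C j \<noteq> 0" unfolding C_def by (rule NV[OF hiC sub(4) j(1) jC])
        have 5: "elim M (insert j B) l = Bf l - Bf j / C j * C l" for l
          unfolding Bf_def C_def \<nu>_def using False jB by (intro R hiB sub j(1)) (auto simp: \<nu>_def)
        show ?thesis unfolding 4 BJ(2) E_def[symmetric] 1 2 3 5
          by (rule elim_alg_identity[OF Bj0 BN0 Cj0 CN0]) (use jBN0 Ej0 5 2 in auto)
      next
        \<comment> \<open>Here \<open>j\<close> is the gap of \<open>B\<close>, so eliminating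
          \<open>j\<close> from \<open>B\<close> simply produces the row \<open>C\<close>.\<close>
        case True
        have Bj1: "Bf j = 1" unfolding Bf_def True \<nu>_def using elim_mex_zero[OF finB sub(2)] by simp
        have Cj: "C j = 0" unfolding C_def True using elim_mex_zero[OF _ sub(4)] finB by simp
        show ?thesis unfolding 4 BJ(2) E_def[symmetric] 1 2 3 Bj1 Cj True[symmetric]
          unfolding C_def[folded True, symmetric] using BN0 CN0
          by (simp add: field_simps)
      qed
    qed
  qed
  show ?case using NVk[of J] Rk less.prems by (auto simp: k_def)
qed

end

section \<open>The quotients of a Nikishin system\<close>

lemma slope_zero:
  fixes \<beta> \<gamma> :: real
  assumes s: "concentrated \<Gamma> s" "compact \<Gamma>" and f: "density_on \<Gamma> f"
    and b: "\<And>y. 1 \<le> y \<Longrightarrow> norm (of_real \<beta> * (\<i> * of_real y) + of_real \<gamma> + ctrans s f (\<i> * of_real y)) \<le> K"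
  shows "\<beta> = 0"
proof (rule ccontr)
  assume \<beta>: "\<beta> \<noteq> 0"
  obtain C where C: "0 < C" "\<And>y. 0 < y \<Longrightarrow> norm (ctrans s f (\<i> * of_real y)) \<le> C / y"
    using ctrans_i_bound[OF s f] by blast
  \<comment> \<open>At this height the linear term would exceed the sum of all the other
    bounds.\<close>
  define y where "y = 1 + (\<bar>K\<bar> + \<bar>\<gamma>\<bar> + C) / \<bar>\<beta>\<bar>"
  have y: "1 \<le> y" using C \<beta> by (simp add: y_def)
  have "C / y \<le> C" using y C by (simp add: divide_le_eq mult_le_cancel_left1)
  then have ctb: "norm (ctrans s f (\<i> * of_real y)) \<le> C" using C(2)[of y] y by linarith
  have "norm (of_real \<beta> * (\<i> * of_real y)) \<le> norm (of_real \<beta> * (\<i> * of_real y) + of_real \<gamma> + ctrans s f (\<i> * of_real y)) + norm (of_real \<gamma> + ctrans s f (\<i> * of_real y))"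
    using norm_triangle_ineq4[of "of_real \<beta> * (\<i> * of_real y) + of_real \<gamma> + ctrans s f (\<i> * of_real y)" "of_real \<gamma> + ctrans s f (\<i> * of_real y)"]
    by (simp add: add.assoc)
  also have "\<dots> \<le> K + (\<bar>\<gamma>\<bar> + C)"
    using b[OF y] ctb norm_triangle_ineq[of "complex_of_real \<gamma>" "ctrans s f (\<i> * of_real y)"] by (intro add_mono) auto
  finally have "\<bar>\<beta>\<bar> * y \<le> \<bar>K\<bar> + \<bar>\<gamma>\<bar> + C" using y by (simp add: norm_mult)
  moreover have "\<bar>\<beta>\<bar> * y = \<bar>\<beta>\<bar> + (\<bar>K\<bar> + \<bar>\<gamma>\<bar> + C)" 
  proof -
    have "\<bar>\<beta>\<bar> * (1 + X / \<bar>\<beta>\<bar>) = \<bar>\<beta>\<bar> + X" for X using \<beta> by (simp add: distrib_left)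
    then show ?thesis unfolding y_def .
  qed
  ultimately show False using \<beta> by simp
qed

text \<open>Intervals are provided at every level, possibly empty ones, so that no boundary case
  arises at level \<open>m\<close>.\<close>

locale flag_system =
  fixes m :: nat and \<Gamma> :: "nat \<Rightarrow> real set" and N :: "nat \<Rightarrow> nat \<Rightarrow> complex \<Rightarrow> complex"
    and \<kappa>0 :: "nat \<Rightarrow> sgn_measure"
  assumes interval: "\<exists>a b. \<Gamma> r = {a..b}" and disjoint: "\<Gamma> r \<inter> \<Gamma> (Suc r) = {}"
    and N_diag: "N r r = (\<lambda>_. 1)" and N_low: "i < r \<Longrightarrow> N r i = (\<lambda>_. 0)"
    and \<kappa>0: "r < m \<Longrightarrow> concentrated_inf (\<Gamma> r) (\<kappa>0 r)"
    and N_dens: "r < i \<Longrightarrow> i \<le> m \<Longrightarrow> density_on (\<Gamma> r) (N (Suc r) i)"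
    and N_real: "r < i \<Longrightarrow> i \<le> m \<Longrightarrow> x \<in> \<Gamma> r \<Longrightarrow> N (Suc r) i (of_real x) \<in> \<real>"
    and N_ct: "r < i \<Longrightarrow> i \<le> m \<Longrightarrow> z \<notin> complex_of_real ` \<Gamma> r \<Longrightarrow> N r i z = ctrans (\<kappa>0 r) (N (Suc r) i) z"
begin

text \<open>At a real \<open>z\<close> the pointwise elimination may divide by 0 or meet the
  interval of one of the rows, so only the nonreal values of \<open>Y0\<close> are ever relied
  on.\<close>

definition Y0 :: "nat set \<Rightarrow> nat \<Rightarrow> complex \<Rightarrow> complex" where
  "Y0 J i z = elim (\<lambda>r i. N r i z) J i"

text \<open>The level of \<open>J\<close> is its cardinality: rows of several levels enter the
  combination, yet the only singularities that survive lie on the interval with index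
  \<open>card J\<close>.\<close>

definition Y :: "nat set \<Rightarrow> nat \<Rightarrow> complex \<Rightarrow> complex" where
  "Y J i = extend_off (\<Gamma> (card J)) (Y0 J i)"

abbreviation off :: "nat \<Rightarrow> complex \<Rightarrow> bool" where
  "off r z \<equiv> z \<notin> complex_of_real ` \<Gamma> r"

abbreviation next_set :: "nat set \<Rightarrow> nat set" where
  "next_set J \<equiv> insert (mex J) J"

text \<open>The additive constant vanishes to the right of \<open>J\<close>; this is what distinguishes the pure entries.\<close>

definition row_meas :: "nat set \<Rightarrow> sgn_measure \<Rightarrow> bool" where
  "row_meas J \<kappa> \<longleftrightarrow> concentrated_inf (\<Gamma> (card J)) \<kappa> \<and>
    (\<forall>i\<le>m. i \<notin> J \<longrightarrow> i \<noteq> mex J \<longrightarrow> real_continuous_off (\<Gamma> (Suc (card J))) (Y (next_set J) i) \<and>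
      (\<exists>c::real. ((\<forall>x\<in>J. x < i) \<longrightarrow> c = 0) \<and>
         (\<forall>z. Im z \<noteq> 0 \<longrightarrow> Y0 J i z = of_real c + ctrans \<kappa> (Y (next_set J) i) z)))"

text \<open>One measure serves all columns \<open>i\<close>; this uniformity is what makes a new
  Nikishin system appear. The slope is left open here and is settled by
  \<open>ratio_bounded\<close>.\<close>

definition rep_meas :: "nat set \<Rightarrow> nat \<Rightarrow> sgn_measure \<Rightarrow> bool" where
  "rep_meas J j \<tau> \<longleftrightarrow> concentrated_inf (\<Gamma> (card J)) \<tau> \<and>
    (\<forall>i\<le>m. i \<notin> J \<longrightarrow> i \<noteq> j \<longrightarrow> real_continuous_off (\<Gamma> (Suc (card J))) (Y (insert j J) i) \<and>
      (\<exists>\<beta> \<gamma> :: real. \<forall>z. Im z \<noteq> 0 \<longrightarrow>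
         Y0 J i z / Y0 J j z = of_real \<beta> * z + of_real \<gamma> + ctrans \<tau> (Y (insert j J) i) z))"

definition nonvanishing :: "nat set \<Rightarrow> nat \<Rightarrow> bool" where
  "nonvanishing J j \<longleftrightarrow> (\<forall>z. off (card J) z \<longrightarrow> Y J j z \<noteq> 0)"

section \<open>Entries as transforms with respect to row measures\<close>

lemma compact_\<Gamma>: "compact (\<Gamma> r)"
  using interval[of r] by auto

lemma disjoint': "\<Gamma> (Suc r) \<inter> \<Gamma> r = {}"
  using disjoint[of r] by auto

lemma off_nonreal: "Im z \<noteq> 0 \<Longrightarrow> off r z"
  by auto

lemma off_next: "x \<in> \<Gamma> r \<Longrightarrow> off (Suc r) (of_real x)"
  using disjoint[of r] by auto

lemma off_prev: "x \<in> \<Gamma> (Suc r) \<Longrightarrow> off r (of_real x)"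
  using disjoint[of r] by auto

lemma Y_nonreal: "Im z \<noteq> 0 \<Longrightarrow> Y J i z = Y0 J i z"
  by (auto simp: Y_def extend_off_def complex_is_Real_iff)

lemma concD: "concentrated_inf (\<Gamma> r) s \<Longrightarrow> concentrated (\<Gamma> r) s"
  by (rule concentrated_infD)

lemma Y_const:
  assumes "\<And>z. Im z \<noteq> 0 \<Longrightarrow> Y0 J i z = 1"
  shows "real_continuous_off (\<Gamma> (card J)) (Y J i)" and "off (card J) z \<Longrightarrow> Y J i z = 1"
  unfolding Y_def
  using extend_off_nice[OF compact_\<Gamma>, of "card J" "\<lambda>_. 1" "Y0 J i"] extend_off_eq[OF compact_\<Gamma>, of "card J" "\<lambda>_. 1" "Y0 J i" z] assms by auto

lemma Y_extend:
  assumes s: "concentrated (\<Gamma> (card J)) s" and f: "density_on (\<Gamma> (card J)) f"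
    and re: "\<And>x. x \<in> \<Gamma> (card J) \<Longrightarrow> f (of_real x) \<in> \<real>"
    and eq: "\<And>z. Im z \<noteq> 0 \<Longrightarrow> Y0 J i z = of_real c + ctrans s f z"
  shows "real_continuous_off (\<Gamma> (card J)) (Y J i)" and "off (card J) z \<Longrightarrow> Y J i z = of_real c + ctrans s f z"
proof -
  have cont: "continuous_on (- (complex_of_real ` \<Gamma> (card J))) (\<lambda>z. of_real c + ctrans s f z)"
    by (intro continuous_intros ctrans_continuous[OF s compact_\<Gamma> f])
  show "real_continuous_off (\<Gamma> (card J)) (Y J i)" unfolding Y_def
    by (rule extend_off_nice[OF compact_\<Gamma> cont eq]) (simp_all add: ctrans_cnj[OF s compact_\<Gamma> f re])
  show "off (card J) z \<Longrightarrow> Y J i z = of_real c + ctrans s f z" unfolding Y_def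
    by (rule extend_off_eq[OF compact_\<Gamma> cont]) (rule eq)
qed

lemma row_measD:
  assumes A: "row_meas J \<kappa>" and i: "i \<le> m" "i \<notin> J" "i \<noteq> mex J"
  obtains c :: real where "(\<forall>x\<in>J. x < i) \<longrightarrow> c = 0" "\<And>z. off (card J) z \<Longrightarrow> Y J i z = of_real c + ctrans \<kappa> (Y (next_set J) i) z"
    "real_continuous_off (\<Gamma> (card J)) (Y J i)" "real_continuous_off (\<Gamma> (Suc (card J))) (Y (next_set J) i)" "density_on (\<Gamma> (card J)) (Y (next_set J) i)"
proof -
  obtain c :: real where c: "(\<forall>x\<in>J. x < i) \<longrightarrow> c = 0"
      "\<And>z. Im z \<noteq> 0 \<Longrightarrow> Y0 J i z = of_real c + ctrans \<kappa> (Y (next_set J) i) z"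
    and n: "real_continuous_off (\<Gamma> (Suc (card J))) (Y (next_set J) i)"
    using A i unfolding row_meas_def by blast
  have \<kappa>: "concentrated (\<Gamma> (card J)) \<kappa>" using A by (auto simp: row_meas_def dest: concD)
  have d: "density_on (\<Gamma> (card J)) (Y (next_set J) i)" by (rule real_continuous_off_dens[OF n compact_\<Gamma> disjoint])
  note E = Y_extend[OF \<kappa> d real_continuous_off_real[OF n] c(2)]
  show thesis by (rule that[OF c(1) E(2) E(1) n d])
qed

lemma row_base:
  assumes n: "n < m"
  shows "row_meas {..<n} (\<kappa>0 n)"
proof -
  have next_eq: "next_set {..<n} = {..<Suc n}" by (auto simp: mex_lessThan)
  have Y0N: "Y0 {..<r} i z = N r i z" for r i z by (simp add: Y0_def elim_base)
  show ?thesis unfolding row_meas_def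
  proof (intro conjI allI impI)
    show "concentrated_inf (\<Gamma> (card {..<n})) (\<kappa>0 n)" using \<kappa>0[OF n] by simp
    fix i assume "i \<le> m" "i \<notin> {..<n}" "i \<noteq> mex {..<n}"
    then have i: "n < i" "i \<le> m" by (auto simp: mex_lessThan)
    have "real_continuous_off (\<Gamma> (card {..<Suc n})) (Y {..<Suc n} i) \<and> (\<forall>z. off (Suc n) z \<longrightarrow> Y {..<Suc n} i z = N (Suc n) i z)"
    proof (cases "i = Suc n")
      case True
      then show ?thesis using Y_const[of "{..<Suc n}" i] by (auto simp: Y0N N_diag)
    next
      case False
      then have i': "Suc n < i" using i by simp
      have \<kappa>: "concentrated (\<Gamma> (Suc n)) (\<kappa>0 (Suc n))" using \<kappa>0[of "Suc n"] i i' by (intro concD) auto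
      have "Y0 {..<Suc n} i z = of_real 0 + ctrans (\<kappa>0 (Suc n)) (N (Suc (Suc n)) i) z" if "Im z \<noteq> 0" for z
        using N_ct[OF i' i(2) off_nonreal[OF that]] by (simp add: Y0N)
      note E = Y_extend[of "{..<Suc n}" "\<kappa>0 (Suc n)" "N (Suc (Suc n)) i", OF _ _ _ this]
      show ?thesis using E \<kappa> N_dens[OF i' i(2)] N_real[OF i' i(2)] N_ct[OF i' i(2)] by auto
    qed
    then have nn: "real_continuous_off (\<Gamma> (Suc n)) (Y {..<Suc n} i)" and eq: "\<And>z. off (Suc n) z \<Longrightarrow> Y {..<Suc n} i z = N (Suc n) i z" by auto
    show "real_continuous_off (\<Gamma> (Suc (card {..<n}))) (Y (next_set {..<n}) i)" unfolding next_eq using nn by simp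
    have "Y0 {..<n} i z = of_real 0 + ctrans (\<kappa>0 n) (Y (next_set {..<n}) i) z" if z: "Im z \<noteq> 0" for z
    proof -
      have "ctrans (\<kappa>0 n) (Y (next_set {..<n}) i) z = ctrans (\<kappa>0 n) (N (Suc n) i) z" unfolding next_eq
        by (rule ctrans_cong[OF concD[OF \<kappa>0[OF n]] compact_\<Gamma> real_continuous_off_dens[OF nn compact_\<Gamma> disjoint] N_dens[OF i]])
           (rule eq, rule off_next)
      then show ?thesis using N_ct[OF i off_nonreal[OF z]] by (simp add: Y0N)
    qed
    then show "\<exists>c::real. ((\<forall>x\<in>{..<n}. x < i) \<longrightarrow> c = 0) \<and>
         (\<forall>z. Im z \<noteq> 0 \<longrightarrow> Y0 {..<n} i z = of_real c + ctrans (\<kappa>0 n) (Y (next_set {..<n}) i) z)"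
      by (intro exI[of _ 0]) auto
  qed
qed

lemma rep_mex:
  assumes A: "row_meas J \<kappa>" and one: "\<And>z. Im z \<noteq> 0 \<Longrightarrow> Y0 J (mex J) z = 1"
  shows "rep_meas J (mex J) \<kappa>"
  unfolding rep_meas_def
proof (intro conjI allI impI)
  show "concentrated_inf (\<Gamma> (card J)) \<kappa>" using A by (simp add: row_meas_def)
  fix i assume i: "i \<le> m" "i \<notin> J" "i \<noteq> mex J"
  obtain c :: real where c: "\<And>z. off (card J) z \<Longrightarrow> Y J i z = of_real c + ctrans \<kappa> (Y (next_set J) i) z"
    and n: "real_continuous_off (\<Gamma> (Suc (card J))) (Y (next_set J) i)"
    using row_measD[OF A i] by metis
  show "real_continuous_off (\<Gamma> (Suc (card J))) (Y (next_set J) i)" by (rule n)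
  have "Y0 J i z / Y0 J (mex J) z = of_real 0 * z + of_real c + ctrans \<kappa> (Y (next_set J) i) z" if "Im z \<noteq> 0" for z
    using c[OF off_nonreal[OF that]] one[OF that] Y_nonreal[OF that] by simp
  then show "\<exists>\<beta> \<gamma> :: real. \<forall>z. Im z \<noteq> 0 \<longrightarrow> Y0 J i z / Y0 J (mex J) z = of_real \<beta> * z + of_real \<gamma> + ctrans \<kappa> (Y (next_set J) i) z"
    by blast
qed

section \<open>Growth of the entries along the imaginary axis\<close>

lemma row_i_upper:
  assumes A: "row_meas J \<kappa>" and i: "i \<le> m" "i \<notin> J" "i \<noteq> mex J" and p: "\<forall>x\<in>J. x < i"
  obtains C where "0 < C" "\<And>y. 1 \<le> y \<Longrightarrow> norm (Y0 J i (\<i> * of_real y)) \<le> C / y"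
proof -
  obtain c :: real where c: "(\<forall>x\<in>J. x < i) \<longrightarrow> c = 0" "\<And>z. off (card J) z \<Longrightarrow> Y J i z = of_real c + ctrans \<kappa> (Y (next_set J) i) z"
    and d: "density_on (\<Gamma> (card J)) (Y (next_set J) i)"
    using row_measD[OF A i] by metis
  have \<kappa>: "concentrated (\<Gamma> (card J)) \<kappa>" using A by (auto simp: row_meas_def dest: concD)
  obtain C where C: "0 < C" "\<And>y. 0 < y \<Longrightarrow> norm (ctrans \<kappa> (Y (next_set J) i) (\<i> * of_real y)) \<le> C / y"
    using ctrans_i_bound[OF \<kappa> compact_\<Gamma> d] by blast
  show thesis
  proof (rule that[OF C(1)])
    fix y :: real assume y: "1 \<le> y"
    then have "Im (\<i> * complex_of_real y) \<noteq> 0" by simp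
    then have "Y0 J i (\<i> * of_real y) = ctrans \<kappa> (Y (next_set J) i) (\<i> * of_real y)"
      using c p Y_nonreal off_nonreal by (metis add_0 of_real_0)
    then show "norm (Y0 J i (\<i> * of_real y)) \<le> C / y" using C(2)[of y] y by simp
  qed
qed

lemma row_i_bounded:
  assumes A: "row_meas J \<kappa>" and i: "i \<le> m" "i \<notin> J" "i \<noteq> mex J"
  obtains C where "\<And>y. 1 \<le> y \<Longrightarrow> norm (Y0 J i (\<i> * of_real y)) \<le> C"
proof -
  obtain c :: real where c: "\<And>z. off (card J) z \<Longrightarrow> Y J i z = of_real c + ctrans \<kappa> (Y (next_set J) i) z"
    and d: "density_on (\<Gamma> (card J)) (Y (next_set J) i)"
    using row_measD[OF A i] by metis
  have \<kappa>: "concentrated (\<Gamma> (card J)) \<kappa>" using A by (auto simp: row_meas_def dest: concD)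
  obtain C where C: "0 < C" "\<And>y. 0 < y \<Longrightarrow> norm (ctrans \<kappa> (Y (next_set J) i) (\<i> * of_real y)) \<le> C / y"
    using ctrans_i_bound[OF \<kappa> compact_\<Gamma> d] by blast
  show thesis
  proof (rule that[of "\<bar>c\<bar> + C"])
    fix y :: real assume y: "1 \<le> y"
    then have im: "Im (\<i> * complex_of_real y) \<noteq> 0" by simp
    have "C / y \<le> C" using y C by (simp add: divide_le_eq mult_le_cancel_left1)
    then have "norm (ctrans \<kappa> (Y (next_set J) i) (\<i> * of_real y)) \<le> C" using C(2)[of y] y by linarith
    moreover have "Y0 J i (\<i> * of_real y) = of_real c + ctrans \<kappa> (Y (next_set J) i) (\<i> * of_real y)"
      using c[OF off_nonreal[OF im]] Y_nonreal[OF im] by simp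
    ultimately show "norm (Y0 J i (\<i> * of_real y)) \<le> \<bar>c\<bar> + C"
      using norm_triangle_ineq[of "complex_of_real c" "ctrans \<kappa> (Y (next_set J) i) (\<i> * of_real y)"] by simp
  qed
qed

text \<open>The entry of the next row does not vanish on the interval, so it can be absorbed into
  the measure, whose imaginary part then gives the bound.\<close>

lemma row_i_lower:
  assumes A: "row_meas J \<kappa>" and J: "finite J" and i: "i \<le> m" "i \<notin> J" "i \<noteq> mex J"
    and nv: "nonvanishing (next_set J) i"
  obtains d where "0 < d" "\<And>y. 1 \<le> y \<Longrightarrow> d / y \<le> norm (Y0 J i (\<i> * of_real y))"
proof -
  obtain c :: real where c: "\<And>z. off (card J) z \<Longrightarrow> Y J i z = of_real c + ctrans \<kappa> (Y (next_set J) i) z"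
    and d: "density_on (\<Gamma> (card J)) (Y (next_set J) i)" and n: "real_continuous_off (\<Gamma> (Suc (card J))) (Y (next_set J) i)"
    using row_measD[OF A i] by metis
  obtain a b where ab: "\<Gamma> (card J) = {a..b}" using interval by blast
  have cs: "card (next_set J) = Suc (card J)" using J mex_notin[OF J] by simp
  have f0: "Y (next_set J) i (of_real x) \<noteq> 0" if "x \<in> {a..b}" for x
    using nv off_next[of x "card J"] that ab unfolding nonvanishing_def cs by auto
  have "\<exists>d>0. \<forall>y\<ge>1. \<forall>c. d / y \<le> norm (of_real c + ctrans \<kappa> (Y (next_set J) i) (\<i> * of_real y))"
    by (rule ctrans_density_i_lower) (use A d f0 real_continuous_off_real[OF n] in \<open>auto simp: row_meas_def ab\<close>)
  then obtain e where e: "0 < e" "\<And>y c. 1 \<le> y \<Longrightarrow> e / y \<le> norm (of_real c + ctrans \<kappa> (Y (next_set J) i) (\<i> * of_real y))" by blast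
  show thesis
  proof (rule that[OF e(1)])
    fix y :: real assume y: "1 \<le> y"
    then have im: "Im (\<i> * complex_of_real y) \<noteq> 0" by simp
    show "e / y \<le> norm (Y0 J i (\<i> * of_real y))"
      using e(2)[OF y, of c] c[OF off_nonreal[OF im]] Y_nonreal[OF im] by simp
  qed
qed

section \<open>One elimination step\<close>

lemma card_next: "finite J \<Longrightarrow> card (next_set J) = Suc (card J)"
  using mex_notin[of J] by simp

lemma card_two:
  assumes "J \<subseteq> {..m}" "i \<le> m" "j \<le> m" "i \<notin> J" "j \<notin> J" "i \<noteq> j"
  shows "card J < m"
proof -
  have fin: "finite J" using assms(1) finite_subset by blast
  have "card (insert i (insert j J)) \<le> card {..m}" using assms by (intro card_mono) auto
  then show ?thesis using assms fin by simp
qed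

text \<open>This is \<open>rep_step1\<close> for two entries of \<open>J\<close>, with the entries
  of \<open>next_set J\<close> as densities. The slope is kept in the form
  \<open>- c * \<alpha>1\<close> because it disappears for different reasons in
  \<open>row_step\<close> and in \<open>rep_step\<close>.\<close>

lemma reduced_form:
  assumes A: "row_meas J \<kappa>" and J: "finite J"
    and j: "j \<le> m" "j \<notin> J" "j \<noteq> mex J" and i: "i \<le> m" "i \<notin> J" "i \<noteq> mex J" "i \<noteq> j"
    and nvB: "nonvanishing (next_set J) j" and B: "rep_meas (next_set J) j \<tau>"
    and rec: "\<And>z. Im z \<noteq> 0 \<Longrightarrow> Y0 (insert j J) i z = Y0 J i z - Y0 J j z / Y0 (next_set J) j z * Y0 (next_set J) i z"
  shows "\<exists>c \<alpha>1 \<alpha>0 p0 :: real. ((\<forall>x\<in>J. x < j) \<longrightarrow> c = 0) \<and>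
    (\<forall>z. Im z \<noteq> 0 \<longrightarrow> Y0 (next_set J) i z / Y0 (next_set J) j z = of_real \<alpha>1 * z + of_real \<alpha>0 + ctrans \<tau> (Y (insert j (next_set J)) i) z) \<and>
    (\<forall>z. Im z \<noteq> 0 \<longrightarrow> Y0 (insert j J) i z = of_real (- c * \<alpha>1) * z + of_real p0 + ctrans \<tau> (\<lambda>y. - Y J j y * Y (insert j (next_set J)) i y) z)"
proof -
  let ?n = "card J" and ?w = "Y (insert j (next_set J)) i"
  have cB: "card (next_set J) = Suc ?n" by (rule card_next[OF J])
  have \<kappa>: "concentrated (\<Gamma> ?n) \<kappa>" using A by (auto simp: row_meas_def dest: concD)
  have \<tau>: "concentrated (\<Gamma> (Suc ?n)) \<tau>" using B by (auto simp: rep_meas_def cB dest: concD)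
  obtain c :: real where c: "(\<forall>x\<in>J. x < j) \<longrightarrow> c = 0" "\<And>z. off ?n z \<Longrightarrow> Y J j z = of_real c + ctrans \<kappa> (Y (next_set J) j) z"
      "real_continuous_off (\<Gamma> ?n) (Y J j)" "real_continuous_off (\<Gamma> (Suc ?n)) (Y (next_set J) j)"
    using row_measD[OF A j] by metis
  obtain ci :: real where ci: "\<And>z. off ?n z \<Longrightarrow> Y J i z = of_real ci + ctrans \<kappa> (Y (next_set J) i) z"
      "real_continuous_off (\<Gamma> (Suc ?n)) (Y (next_set J) i)"
    using row_measD[OF A i(1-3)] by metis
  have i': "i \<notin> next_set J" using i by simp
  obtain \<alpha>1 \<alpha>0 :: real where rep: "\<And>z. Im z \<noteq> 0 \<Longrightarrow> Y0 (next_set J) i z / Y0 (next_set J) j z = of_real \<alpha>1 * z + of_real \<alpha>0 + ctrans \<tau> ?w z"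
    and w: "real_continuous_off (\<Gamma> (Suc (Suc ?n))) ?w"
    using B i(1,4) i' unfolding rep_meas_def cB by blast
  have dw: "density_on (\<Gamma> (Suc ?n)) ?w" by (rule real_continuous_off_dens[OF w compact_\<Gamma> disjoint])
  obtain p0 :: real where p0: "\<And>z. Im z \<noteq> 0 \<Longrightarrow> Y0 J i z - Y J j z * (Y (next_set J) i z / Y (next_set J) j z) =
      of_real (- c * \<alpha>1) * z + of_real p0 + ctrans \<tau> (\<lambda>y. - Y J j y * ?w y) z"
  proof (rule rep_step1[OF \<kappa> compact_\<Gamma> \<tau> compact_\<Gamma> disjoint ci(2) c(4) _ dw c(3), where Ti = "Y0 J i" and ci = ci and cj = c])
    fix z :: complex
    show "off (Suc ?n) z \<Longrightarrow> Y (next_set J) j z \<noteq> 0" using nvB by (simp add: nonvanishing_def cB)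
    show "off ?n z \<Longrightarrow> Y J j z = of_real c + ctrans \<kappa> (Y (next_set J) j) z" by (rule c(2))
    assume z: "Im z \<noteq> 0"
    show "Y0 J i z = of_real ci + ctrans \<kappa> (Y (next_set J) i) z" using ci(1)[OF off_nonreal[OF z]] Y_nonreal[OF z] by simp
    show "Y (next_set J) i z / Y (next_set J) j z = of_real \<alpha>1 * z + of_real \<alpha>0 + ctrans \<tau> ?w z" using rep[OF z] Y_nonreal[OF z] by simp
  qed blast
  have "Y0 (insert j J) i z = of_real (- c * \<alpha>1) * z + of_real p0 + ctrans \<tau> (\<lambda>y. - Y J j y * ?w y) z"
    if z: "Im z \<noteq> 0" for z
    using p0[OF z] rec[OF z] unfolding Y_nonreal[OF z] by (simp add: mult.commute)
  then show ?thesis using c(1) rep by blast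
qed

text \<open>To the right of \<open>J\<close> the constant of column \<open>j\<close> is 0, so no
  linear term arises. The factor \<open>- Y J j\<close> has no zeros on the next interval and is
  absorbed into \<open>\<tau>\<close>.\<close>

lemma row_step:
  assumes A: "row_meas J \<kappa>" and J: "finite J"
    and j: "j \<le> m" "mex J < j" "\<forall>x\<in>J. x < j"
    and nvJ: "nonvanishing J j" and nvB: "nonvanishing (next_set J) j"
    and B: "rep_meas (next_set J) j \<tau>" and AB: "row_meas (next_set J) \<kappa>B"
    and one: "\<And>z. Im z \<noteq> 0 \<Longrightarrow> Y0 (next_set J) (mex (next_set J)) z = 1"
    and nvBB: "j \<noteq> mex (next_set J) \<Longrightarrow> nonvanishing (next_set (next_set J)) j"
  shows "\<exists>\<kappa>'. row_meas (insert j J) \<kappa>'"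
proof -
  let ?n = "card J"
  have jJ: "j \<notin> J" "j \<noteq> mex J" using j by auto
  have cB: "card (next_set J) = Suc ?n" by (rule card_next[OF J])
  have cj: "card (insert j J) = Suc ?n" using J jJ by simp
  have muj: "mex (insert j J) = mex J" using J jJ by (intro mex_insert)
  have nextj: "insert (mex J) (insert j J) = insert j (next_set J)" by (rule insert_commute)
  have \<tau>: "concentrated_inf (\<Gamma> (Suc ?n)) \<tau>" using B by (auto simp: rep_meas_def cB)
  have nJj: "real_continuous_off (\<Gamma> ?n) (Y J j)" using row_measD[OF A j(1) jJ] by metis
  obtain a b where ab: "\<Gamma> (Suc ?n) = {a..b}" using interval by blast
  let ?f = "\<lambda>y. - Y J j y"
  have df: "density_on (\<Gamma> (Suc ?n)) ?f" by (rule density_on_uminus[OF real_continuous_off_dens[OF nJj compact_\<Gamma> disjoint']])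
  have "\<exists>s'. concentrated_inf {a..b} s' \<and> (\<forall>g z. density_on {a..b} g \<longrightarrow> ctrans \<tau> (\<lambda>z. ?f z * g z) z = ctrans s' g z)"
  proof (rule absorb_density)
    show "concentrated_inf {a..b} \<tau>" "density_on {a..b} ?f" using \<tau> df by (simp_all add: ab)
    fix x assume "x \<in> {a..b}"
    then have "off ?n (of_real x)" using off_prev[of x ?n] by (simp add: ab)
    then show "?f (of_real x) \<in> \<real>" "?f (of_real x) \<noteq> 0"
      using nvJ real_continuous_off_real[OF nJj] by (auto simp: nonvanishing_def)
  qed
  then obtain \<kappa>' where \<kappa>': "concentrated_inf (\<Gamma> (Suc ?n)) \<kappa>'"
    and abs: "\<And>g z. density_on (\<Gamma> (Suc ?n)) g \<Longrightarrow> ctrans \<tau> (\<lambda>z. ?f z * g z) z = ctrans \<kappa>' g z"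
    unfolding ab by blast
  have "row_meas (insert j J) \<kappa>'" unfolding row_meas_def cj muj nextj
  proof (intro conjI allI impI \<kappa>')
    fix i assume i: "i \<le> m" "i \<notin> insert j J" "i \<noteq> mex J"
    let ?w = "Y (insert j (next_set J)) i"
    have i': "i \<notin> J" "i \<noteq> j" "i \<notin> next_set J" using i by auto
    show w: "real_continuous_off (\<Gamma> (Suc (Suc ?n))) ?w" using B i(1) i' unfolding rep_meas_def cB by blast
    have dw: "density_on (\<Gamma> (Suc ?n)) ?w" by (rule real_continuous_off_dens[OF w compact_\<Gamma> disjoint])
    have rec: "Y0 (insert j J) i z = Y0 J i z - Y0 J j z / Y0 (next_set J) j z * Y0 (next_set J) i z" for z
      unfolding Y0_def by (rule elim_insert[OF J j(2)]) (use j(3) in auto)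
    obtain c \<alpha>1 \<alpha>0 p0 :: real where c: "(\<forall>x\<in>J. x < j) \<longrightarrow> c = 0"
      and "\<And>z. Im z \<noteq> 0 \<Longrightarrow> Y0 (next_set J) i z / Y0 (next_set J) j z = of_real \<alpha>1 * z + of_real \<alpha>0 + ctrans \<tau> ?w z"
      and fm: "\<And>z. Im z \<noteq> 0 \<Longrightarrow> Y0 (insert j J) i z = of_real (- c * \<alpha>1) * z + of_real p0 + ctrans \<tau> (\<lambda>y. - Y J j y * ?w y) z"
      using reduced_form[OF A J j(1) jJ i(1) i'(1) i(3) i'(2) nvB B] rec by blast
    have fm': "Y0 (insert j J) i z = of_real p0 + ctrans \<kappa>' ?w z" if "Im z \<noteq> 0" for z
      using fm[OF that] abs[OF dw] c j(3) by simp
    \<comment> \<open>Purity of the new row. The two parts of the recursion are at most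
      \<open>C1 / y\<close> and \<open>(C2 / y) / (d / y) * (C3 / y)\<close> at
      \<open>\<i> * y\<close>, and the transform is at most \<open>C4 / y\<close>; hence the
      constant \<open>p0\<close> is bounded by a multiple of \<open>1 / y\<close>.\<close>
    have "p0 = 0" if p: "\<forall>x\<in>insert j J. x < i"
    proof -
      have ji: "j < i" using p by simp
      obtain C1 where C1: "0 < C1" "\<And>y. 1 \<le> y \<Longrightarrow> norm (Y0 J i (\<i> * of_real y)) \<le> C1 / y"
        using row_i_upper[OF A i(1) i'(1) i(3)] p by blast
      obtain C2 where C2: "0 < C2" "\<And>y. 1 \<le> y \<Longrightarrow> norm (Y0 J j (\<i> * of_real y)) \<le> C2 / y"
        using row_i_upper[OF A j(1) jJ j(3)] by blast
      have jn: "j \<notin> next_set J" using jJ by simp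
      have mun: "mex (next_set J) \<le> j" by (rule mex_least[OF jn])
      obtain C3 where C3: "0 < C3" "\<And>y. 1 \<le> y \<Longrightarrow> norm (Y0 (next_set J) i (\<i> * of_real y)) \<le> C3 / y"
        using row_i_upper[OF AB i(1) i'(3)] p mun ji j(2) by (metis insert_iff less_trans not_less)
      obtain d where d: "0 < d" "\<And>y. 1 \<le> y \<Longrightarrow> d / y \<le> norm (Y0 (next_set J) j (\<i> * of_real y))"
      proof (cases "j = mex (next_set J)")
        case True
        show thesis
        proof (rule that[of 1])
          fix y :: real assume y: "1 \<le> y"
          then have "Im (\<i> * complex_of_real y) \<noteq> 0" by simp
          then show "1 / y \<le> norm (Y0 (next_set J) j (\<i> * of_real y))" using one True y by simp
        qed simp
      next
        case False
        show thesis using row_i_lower[OF AB _ j(1) jn False nvBB[OF False]] J that by blast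
      qed
      obtain C4 where C4: "0 < C4" "\<And>y. 0 < y \<Longrightarrow> norm (ctrans \<kappa>' ?w (\<i> * of_real y)) \<le> C4 / y"
        using ctrans_i_bound[OF concD[OF \<kappa>'] compact_\<Gamma> dw] by blast
      define K where "K = C1 + C2 * C3 / d + C4"
      have Kpos: "0 < K" using C1 C2 C3 C4 d by (simp add: K_def add_pos_pos)
      have bound: "\<bar>p0\<bar> \<le> K / y" if y: "1 \<le> y" for y
      proof -
        let ?z = "\<i> * complex_of_real y"
        have z: "Im ?z \<noteq> 0" using y by simp
        have y0: "0 < y" using y by simp
        have "norm (Y0 J j ?z / Y0 (next_set J) j ?z * Y0 (next_set J) i ?z) \<le> (C2 / y) / (d / y) * (C3 / y)"
          unfolding norm_mult norm_divide using C2 C3 d y0 y by (intro mult_mono frac_le) auto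
        also have "\<dots> = C2 * C3 / d / y" using y0 d by simp
        finally have "norm (Y0 (insert j J) i ?z) \<le> C1 / y + C2 * C3 / d / y"
          unfolding rec using C1(2)[OF y] norm_triangle_ineq4 by (meson add_mono order_trans)
        moreover have "complex_of_real p0 = Y0 (insert j J) i ?z - ctrans \<kappa>' ?w ?z" using fm'[OF z] by simp
        then have "\<bar>p0\<bar> \<le> norm (Y0 (insert j J) i ?z) + norm (ctrans \<kappa>' ?w ?z)"
          using norm_triangle_ineq4 norm_of_real by metis
        ultimately have "\<bar>p0\<bar> \<le> C1 / y + C2 * C3 / d / y + C4 / y" using C4(2)[OF y0] by linarith
        then show ?thesis by (simp add: K_def add_divide_distrib)
      qed
      show "p0 = 0"
      proof (rule ccontr)
        assume p0: "p0 \<noteq> 0"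
        define y where "y = 1 + K / \<bar>p0\<bar>"
        have y: "1 \<le> y" using Kpos by (simp add: y_def)
        have "\<bar>p0\<bar> * y \<le> K" using bound[OF y] y by (simp add: field_simps)
        moreover have "\<bar>p0\<bar> * y = \<bar>p0\<bar> + K" using p0 by (simp add: y_def distrib_left)
        ultimately show False using p0 by simp
      qed
    qed
    then show "\<exists>c::real. ((\<forall>x\<in>insert j J. x < i) \<longrightarrow> c = 0) \<and>
         (\<forall>z. Im z \<noteq> 0 \<longrightarrow> Y0 (insert j J) i z = of_real c + ctrans \<kappa>' ?w z)"
      using fm' by blast
  qed
  then show ?thesis by blast
qed

text \<open>The inverse of \<open>Y J j\<close> supplies \<open>\<theta>\<close>, and
  \<open>rep_step2\<close> carries it to the other columns. First the slope of the eliminated entry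
  has to vanish: to the right of \<open>J\<close> because the constant is 0, elsewhere because of
  the boundedness in the second alternative of the last assumption.\<close>

lemma rep_step:
  assumes A: "row_meas J \<kappa>" and J: "J \<subseteq> {..m}"
    and j: "j \<le> m" "j \<notin> J" "j \<noteq> mex J"
    and nvJ: "nonvanishing J j" and nvB: "nonvanishing (next_set J) j"
    and one: "\<And>z. Im z \<noteq> 0 \<Longrightarrow> Y0 J (mex J) z = 1" and zero: "\<And>z. Im z \<noteq> 0 \<Longrightarrow> Y0 (next_set J) (mex J) z = 0"
    and rec: "\<And>i z. Im z \<noteq> 0 \<Longrightarrow> Y0 (insert j J) i z = Y0 J i z - Y0 J j z / Y0 (next_set J) j z * Y0 (next_set J) i z"
    and B: "card (next_set J) < m \<Longrightarrow> \<exists>\<tau>. rep_meas (next_set J) j \<tau>"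
    and bd: "(\<forall>x\<in>J. x < j) \<or> (\<forall>i\<le>m. i \<notin> insert j J \<longrightarrow> i \<noteq> mex J \<longrightarrow> (\<exists>C. \<forall>y\<ge>1. norm (Y0 (insert j J) i (\<i> * of_real y)) \<le> C))"
  shows "\<exists>\<theta>. rep_meas J j \<theta>"
proof -
  let ?n = "card J"
  have finJ: "finite J" using J finite_subset by blast
  have cB: "card (next_set J) = Suc ?n" by (rule card_next[OF finJ])
  have cj: "card (insert j J) = Suc ?n" using finJ j by simp
  have \<kappa>: "concentrated_inf (\<Gamma> ?n) \<kappa>" using A by (auto simp: row_meas_def)
  obtain c :: real where c: "(\<forall>x\<in>J. x < j) \<longrightarrow> c = 0" "\<And>z. off ?n z \<Longrightarrow> Y J j z = of_real c + ctrans \<kappa> (Y (next_set J) j) z"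
      "real_continuous_off (\<Gamma> ?n) (Y J j)" "real_continuous_off (\<Gamma> (Suc ?n)) (Y (next_set J) j)" "density_on (\<Gamma> ?n) (Y (next_set J) j)"
    using row_measD[OF A j] by metis
  obtain a b where ab: "\<Gamma> ?n = {a..b}" using interval by blast
  have Y0j: "Y J j z \<noteq> 0" if "off ?n z" for z using nvJ that by (simp add: nonvanishing_def)
  have "\<exists>\<theta> l1 l0. concentrated_inf {a..b} \<theta> \<and> (\<forall>z. z \<notin> complex_of_real ` {a..b} \<longrightarrow>
      1 / (of_real c + ctrans \<kappa> (Y (next_set J) j) z) = of_real l1 * z + of_real l0 + ctrans \<theta> (\<lambda>_. 1) z)"
  proof (rule inverse_ct[of a b \<kappa> "Y (next_set J) j" c])
    show "concentrated_inf {a..b} \<kappa>" "density_on {a..b} (Y (next_set J) j)" using \<kappa> c(5) by (simp_all add: ab)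
    fix x
    show "Y (next_set J) j (of_real x) \<in> \<real>" by (rule real_continuous_off_real[OF c(4)])
    show "x \<in> {a..b} \<Longrightarrow> Y (next_set J) j (of_real x) \<noteq> 0"
      using nvB off_next[of x ?n] by (simp add: nonvanishing_def cB ab)
    assume "x \<notin> {a..b}"
    then have "off ?n (of_real x)" unfolding ab by (auto simp del: atLeastAtMost_iff)
    then show "of_real c + ctrans \<kappa> (Y (next_set J) j) (complex_of_real x) \<noteq> 0" using c(2) Y0j by metis
  qed blast
  then obtain \<theta> l1 l0 where \<theta>: "concentrated_inf (\<Gamma> ?n) \<theta>"
    and inv': "\<And>z. off ?n z \<Longrightarrow> 1 / (of_real c + ctrans \<kappa> (Y (next_set J) j) z) = of_real l1 * z + of_real l0 + ctrans \<theta> (\<lambda>_. 1) z"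
    unfolding ab by blast
  have inv: "1 / Y J j z = of_real l1 * z + of_real l0 + ctrans \<theta> (\<lambda>_. 1) z" if "off ?n z" for z
    using inv'[OF that] c(2)[OF that] by simp
  have "rep_meas J j \<theta>" unfolding rep_meas_def
  proof (intro conjI allI impI \<theta>)
    fix i assume i: "i \<le> m" "i \<notin> J" "i \<noteq> j"
    have "real_continuous_off (\<Gamma> (Suc ?n)) (Y (insert j J) i) \<and> (\<exists>\<beta> \<gamma> :: real. \<forall>z. Im z \<noteq> 0 \<longrightarrow>
         Y0 J i z / Y0 J j z = of_real \<beta> * z + of_real \<gamma> + ctrans \<theta> (Y (insert j J) i) z)"
    proof (cases "i = mex J")
      \<comment> \<open>The numerator is 1, so the quotient is the inverse itself.\<close>
      case True
      have "Y0 (insert j J) i z = 1" if "Im z \<noteq> 0" for z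
        using rec[OF that, of i] one[OF that] zero[OF that] True by simp
      note Yc = Y_const[of "insert j J" i, OF this, unfolded cj]
      have "ctrans \<theta> (Y (insert j J) i) z = ctrans \<theta> (\<lambda>_. 1) z" for z
        by (rule ctrans_cong[OF concD[OF \<theta>] compact_\<Gamma> real_continuous_off_dens[OF Yc(1) compact_\<Gamma> disjoint] density_on_const])
           (use Yc(2) off_next in auto)
      then have "Y0 J i z / Y0 J j z = of_real l1 * z + of_real l0 + ctrans \<theta> (Y (insert j J) i) z" if "Im z \<noteq> 0" for z
        using inv[OF off_nonreal[OF that]] one[OF that] True Y_nonreal[OF that] by simp
      then show ?thesis using Yc(1) by blast
    next
      case False
      have i': "i \<notin> next_set J" using i False by simp
      have "card (next_set J) < m"
        by (rule card_two[of _ i j]) (use i i' j J False mex_least[of j J] in auto)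
      then obtain \<tau> where \<tau>: "rep_meas (next_set J) j \<tau>" using B by blast
      then have \<tau>c: "concentrated (\<Gamma> (Suc ?n)) \<tau>" by (auto simp: rep_meas_def cB dest: concD)
      let ?w = "Y (insert j (next_set J)) i"
      have w: "real_continuous_off (\<Gamma> (Suc (Suc ?n))) ?w" using \<tau> i i' unfolding rep_meas_def cB by blast
      have dw: "density_on (\<Gamma> (Suc ?n)) ?w" by (rule real_continuous_off_dens[OF w compact_\<Gamma> disjoint])
      obtain c' \<alpha>1 \<alpha>0 p0 :: real where c': "(\<forall>x\<in>J. x < j) \<longrightarrow> c' = 0"
        and rep: "\<And>z. Im z \<noteq> 0 \<Longrightarrow> Y0 (next_set J) i z / Y0 (next_set J) j z = of_real \<alpha>1 * z + of_real \<alpha>0 + ctrans \<tau> ?w z"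
        and fm: "\<And>z. Im z \<noteq> 0 \<Longrightarrow> Y0 (insert j J) i z = of_real (- c' * \<alpha>1) * z + of_real p0 + ctrans \<tau> (\<lambda>y. - Y J j y * ?w y) z"
        using reduced_form[OF A finJ j i(1,2) False i(3) nvB \<tau>] rec by blast
      have df: "density_on (\<Gamma> (Suc ?n)) (\<lambda>y. - Y J j y * ?w y)"
        by (intro density_on_mult density_on_uminus real_continuous_off_dens[OF c(3) compact_\<Gamma> disjoint'] dw)
      have "- c' * \<alpha>1 = 0"
        using bd
      proof
        assume "\<forall>x\<in>J. x < j" then show ?thesis using c' by simp
      next
        assume "\<forall>i\<le>m. i \<notin> insert j J \<longrightarrow> i \<noteq> mex J \<longrightarrow> (\<exists>C. \<forall>y\<ge>1. norm (Y0 (insert j J) i (\<i> * of_real y)) \<le> C)"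
        then obtain C where C: "\<And>y. 1 \<le> y \<Longrightarrow> norm (Y0 (insert j J) i (\<i> * of_real y)) \<le> C" using i False by blast
        show ?thesis
        proof (rule slope_zero[OF \<tau>c compact_\<Gamma> df])
          fix y :: real assume y: "1 \<le> y"
          then have "Im (\<i> * complex_of_real y) \<noteq> 0" by simp
          from C[OF y] show "norm (of_real (- c' * \<alpha>1) * (\<i> * of_real y) + of_real p0 + ctrans \<tau> (\<lambda>y. - Y J j y * ?w y) (\<i> * of_real y)) \<le> C"
            unfolding fm[OF \<open>Im (\<i> * complex_of_real y) \<noteq> 0\<close>] .
        qed
      qed
      then have fm': "Y0 (insert j J) i z = of_real p0 + ctrans \<tau> (\<lambda>y. - Y J j y * ?w y) z" if "Im z \<noteq> 0" for z
        using fm[OF that] by simp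
      have re: "- Y J j (of_real x) * ?w (of_real x) \<in> \<real>" for x
        by (intro Reals_mult Reals_minus real_continuous_off_real[OF c(3)] real_continuous_off_real[OF w])
      note E = Y_extend[of "insert j J", unfolded cj, OF \<tau>c df re fm']
      obtain q1 q0 :: real where q: "\<And>z. Im z \<noteq> 0 \<Longrightarrow> Y0 J i z / Y J j z = of_real q1 * z + of_real q0 + ctrans \<theta> (Y (insert j J) i) z"
      proof (rule rep_step2[OF concD[OF \<theta>] compact_\<Gamma> \<tau>c compact_\<Gamma> disjoint dw _ c(3) Y0j inv rep real_continuous_off_dens[OF E(1) compact_\<Gamma> disjoint] E(2), where Ti = "Y0 J i"])
        fix z :: complex assume z: "Im z \<noteq> 0"
        show "Y0 J i z - Y J j z * (Y0 (next_set J) i z / Y0 (next_set J) j z) = Y (insert j J) i z"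
          using rec[OF z, of i] unfolding Y_nonreal[OF z] by simp
      qed (use real_continuous_off_real[OF w] in auto)
      have "Y0 J i z / Y0 J j z = of_real q1 * z + of_real q0 + ctrans \<theta> (Y (insert j J) i) z" if "Im z \<noteq> 0" for z
        using q[OF that] unfolding Y_nonreal[OF that] .
      then show ?thesis using E(1) by blast
    qed
    then show "real_continuous_off (\<Gamma> (Suc ?n)) (Y (insert j J) i)" "\<exists>\<beta> \<gamma> :: real. \<forall>z. Im z \<noteq> 0 \<longrightarrow>
         Y0 J i z / Y0 J j z = of_real \<beta> * z + of_real \<gamma> + ctrans \<theta> (Y (insert j J) i) z" by blast+
  qed
  then show ?thesis by blast
qed

text \<open>Rows, nonvanishing and quotients depend on one another at neighbouring levels, which
  forces a simultaneous induction.\<close>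

definition stage :: "nat set \<Rightarrow> bool" where
  "stage J \<longleftrightarrow> (card J < m \<longrightarrow> (\<exists>\<kappa>. row_meas J \<kappa>)) \<and>
    (\<forall>j\<le>m. (\<forall>x\<in>J. x < j) \<longrightarrow> nonvanishing J j \<and> (card J < m \<longrightarrow> (\<exists>\<tau>. rep_meas J j \<tau>)))"

lemma nonvanishing_Y0: "nonvanishing J j \<Longrightarrow> Im z \<noteq> 0 \<Longrightarrow> Y0 J j z \<noteq> 0"
  using Y_nonreal[of z J j] off_nonreal[of z] unfolding nonvanishing_def by metis

text \<open>Only columns to the right of \<open>J\<close> are divided by here. Their entries are Cauchy transforms without
  additive constant, so that they have no zeros for trivial reasons.\<close>

theorem stage_all: "J \<subseteq> {..m} \<Longrightarrow> stage J"
proof (induction "above_mex J" arbitrary: J rule: less_induct)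
  case less
  define k where "k = above_mex J"
  have IH: "stage I" if "above_mex I < k" "I \<subseteq> {..m}" for I
    using less.hyps[of I] that by (simp add: k_def)
  have fin: "finite I" if "I \<subseteq> {..m}" for I using that finite_subset by blast
  have D: "Y0 I (mex I) z = 1 \<and> (\<forall>i\<in>I. Y0 I i z = 0)" if I: "above_mex I \<le> k" "I \<subseteq> {..m}" and z: "Im z \<noteq> 0" for I z
    unfolding Y0_def
  proof (rule elim_mex_zero_aux)
    fix I' n assume "I' \<subseteq> {..m}" "above_mex I' < above_mex I" "n \<le> m" "\<And>j. j \<in> I' \<Longrightarrow> j < n"
    then have "nonvanishing I' n" using IH[of I'] I(1) by (auto simp: stage_def)
    then show "elim (\<lambda>r i. N r i z) I' n \<noteq> 0" using nonvanishing_Y0[OF _ z] by (simp add: Y0_def)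
  qed (use I fin in \<open>auto simp: N_diag N_low\<close>)
  \<comment> \<open>An initial segment gives a row of the original array. Otherwise the row arises
    from the set without its largest column, which has smaller \<open>above_mex\<close>.\<close>
  have rows: "\<exists>\<kappa>. row_meas I \<kappa>" if I: "above_mex I \<le> k" "I \<subseteq> {..m}" "card I < m" for I
  proof (cases "\<exists>x\<in>I. mex I < x")
    case False
    then have eq: "I = {..<mex I}" by (rule no_high[OF _ fin[OF I(2)]])
    then have "mex I < m" using I(3) by (metis card_lessThan)
    then show ?thesis using row_base[of "mex I"] eq by metis
  next
    case True
    then obtain x where x: "x \<in> I" "mex I < x" by blast
    obtain n I' where n: "I = insert n I'" "n \<notin> I'" "finite I'" "mex I' < n" "mex I' = mex I" "\<And>j. j \<in> I' \<Longrightarrow> j < n" "x \<le> n"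
      using max_split[OF fin[OF I(2)] x] by metis
    have h: "above_mex I' < k" using above_mex_insert[OF n(3,2,4)] I(1) n(1) by simp
    have finB: "finite (next_set I')" using n(3) by simp
    have hB: "above_mex (next_set I') < k" using above_mex_insert_mex[OF n(3)] h by simp
    have hBB: "above_mex (next_set (next_set I')) < k" using above_mex_insert_mex[OF finB] hB by simp
    have sub: "I' \<subseteq> {..m}" "n \<le> m" "next_set I' \<subseteq> {..m}" using n I(2) by auto
    have cI: "card I' < m" "card (next_set I') < m" using I(3) n(1,2,3) card_next[OF n(3)] by auto
    have lt: "\<forall>x\<in>I'. x < n" "\<forall>x\<in>next_set I'. x < n" using n(4,6) by auto
    obtain \<kappa> where \<kappa>: "row_meas I' \<kappa>" using IH[OF h sub(1)] cI(1) unfolding stage_def by blast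
    have nv: "nonvanishing I' n" using IH[OF h sub(1)] lt sub(2) unfolding stage_def by blast
    have nvB: "nonvanishing (next_set I') n" using IH[OF hB sub(3)] lt sub(2) unfolding stage_def by blast
    obtain \<tau> where \<tau>: "rep_meas (next_set I') n \<tau>" using IH[OF hB sub(3)] lt sub(2) cI(2) unfolding stage_def by blast
    obtain \<kappa>B where \<kappa>B: "row_meas (next_set I') \<kappa>B" using IH[OF hB sub(3)] cI(2) unfolding stage_def by blast
    have nvBB: "nonvanishing (next_set (next_set I')) n" if "n \<noteq> mex (next_set I')"
    proof -
      have "n \<notin> next_set I'" using lt(2) by blast
      then have "mex (next_set I') < n" using mex_least[of n "next_set I'"] that by simp
      then have "next_set (next_set I') \<subseteq> {..m}" "\<forall>x\<in>next_set (next_set I'). x < n" using sub lt(2) by auto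
      then show ?thesis using IH[OF hBB] sub(2) unfolding stage_def by blast
    qed
    show ?thesis unfolding n(1)
      by (rule row_step[OF \<kappa> n(3) sub(2) n(4) lt(1) nv nvB \<tau> \<kappa>B _ nvBB])
         (use D[of "next_set I'"] hB sub(3) in auto)
  qed
  \<comment> \<open>Inner induction on the gap: filling it does not raise \<open>above_mex\<close>
    and moves the gap to the right, so the claim may be assumed for
    \<open>next_set I\<close>.\<close>
  have PB: "nonvanishing I j \<and> (card I < m \<longrightarrow> (\<exists>\<tau>. rep_meas I j \<tau>))"
    if "above_mex I \<le> k" "I \<subseteq> {..m}" "j \<le> m" "\<forall>x\<in>I. x < j" for I j
    using that
  proof (induction "Suc m - mex I" arbitrary: I rule: less_induct)
    case (less I)
    note I = less.prems
    have finI: "finite I" by (rule fin[OF I(2)])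
    have jI: "j \<notin> I" using I(4) by blast
    have muj: "mex I \<le> j" by (rule mex_least[OF jI])
    have one: "Y0 I (mex I) z = 1" if "Im z \<noteq> 0" for z using D[OF I(1,2) that] by simp
    show ?case
    proof (cases "j = mex I")
      case True
      have "nonvanishing I j" unfolding True nonvanishing_def using Y_const(2)[of I "mex I", OF one] by simp
      moreover have "\<exists>\<tau>. rep_meas I j \<tau>" if "card I < m"
        using rows[OF I(1,2) that] rep_mex[OF _ one] True by blast
      ultimately show ?thesis by blast
    next
      case False
      then have mj: "mex I < j" using muj by simp
      have cI: "card I < m" using card_two[OF I(2) I(3), of "mex I"] jI mj mex_notin[OF finI] I(3) by auto
      have sub: "next_set I \<subseteq> {..m}" using I(2,3) mj by auto
      have hB: "above_mex (next_set I) \<le> k" using above_mex_insert_mex[OF finI] I(1) by simp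
      have lt: "\<forall>x\<in>next_set I. x < j" using I(4) mj by auto
      have "Suc m - mex (next_set I) < Suc m - mex I" using mex_insert_mex[OF finI] mj I(3) by simp
      note ih = less.hyps[OF this hB sub I(3) lt]
      obtain \<kappa> where \<kappa>: "row_meas I \<kappa>" using rows[OF I(1,2) cI] by blast
      have nvB: "nonvanishing (next_set I) j" using ih by simp
      obtain c :: real where c: "(\<forall>x\<in>I. x < j) \<longrightarrow> c = 0" "\<And>z. off (card I) z \<Longrightarrow> Y I j z = of_real c + ctrans \<kappa> (Y (next_set I) j) z"
        "real_continuous_off (\<Gamma> (Suc (card I))) (Y (next_set I) j)" "density_on (\<Gamma> (card I)) (Y (next_set I) j)"
        using row_measD[OF \<kappa> I(3) jI False] by metis
      obtain a b where ab: "\<Gamma> (card I) = {a..b}" using interval by blast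
      have "ctrans \<kappa> (Y (next_set I) j) z \<noteq> 0" if "off (card I) z" for z
      proof (rule ctrans_density_nonzero[of a b])
        show "concentrated_inf {a..b} \<kappa>" using \<kappa> by (simp add: row_meas_def ab)
        show "density_on {a..b} (Y (next_set I) j)" using c(4) by (simp add: ab)
        show "z \<notin> complex_of_real ` {a..b}" using that by (simp add: ab)
        fix x assume "x \<in> {a..b}"
        then show "Y (next_set I) j (of_real x) \<noteq> 0"
          using nvB off_next[of x "card I"] by (simp add: nonvanishing_def card_next[OF finI] ab)
      qed (rule real_continuous_off_real[OF c(3)])
      then have nv: "nonvanishing I j" unfolding nonvanishing_def using c(1,2) I(4) by simp
      have "\<exists>\<tau>. rep_meas I j \<tau>"
      proof (rule rep_step[OF \<kappa> I(2,3) jI False nv nvB one])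
        fix i and z :: complex assume z: "Im z \<noteq> 0"
        show "Y0 (next_set I) (mex I) z = 0" using D[OF hB sub z] by simp
        show "Y0 (insert j I) i z = Y0 I i z - Y0 I j z / Y0 (next_set I) j z * Y0 (next_set I) i z"
          unfolding Y0_def by (rule elim_insert[OF finI mj]) (use I(4) in auto)
      next
        assume "card (next_set I) < m" then show "\<exists>\<tau>. rep_meas (next_set I) j \<tau>" using ih by blast
      qed (use I(4) in auto)
      then show ?thesis using nv by blast
    qed
  qed
  show ?case unfolding stage_def using rows[of J] PB[of J] less.prems by (auto simp: k_def)
qed

section \<open>Columns in arbitrary position\<close>

lemma pure_nonvanishing: "J \<subseteq> {..m} \<Longrightarrow> j \<le> m \<Longrightarrow> (\<forall>x\<in>J. x < j) \<Longrightarrow> nonvanishing J j"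
  using stage_all[of J] by (auto simp: stage_def)

lemma rows: "J \<subseteq> {..m} \<Longrightarrow> card J < m \<Longrightarrow> \<exists>\<kappa>. row_meas J \<kappa>"
  using stage_all[of J] by (auto simp: stage_def)

lemma triangular: "Im z \<noteq> 0 \<Longrightarrow> triangular m (\<lambda>r i. N r i z)"
proof
  fix J n assume z: "Im z \<noteq> 0" and J: "J \<subseteq> {..m}" "n \<le> m" "\<And>j. j \<in> J \<Longrightarrow> j < n"
  then have "nonvanishing J n" by (intro pure_nonvanishing) auto
  then show "elim (\<lambda>r i. N r i z) J n \<noteq> 0" using nonvanishing_Y0[OF _ z] by (simp add: Y0_def)
qed (simp_all add: N_diag N_low)

lemma Y0_mex: "J \<subseteq> {..m} \<Longrightarrow> Im z \<noteq> 0 \<Longrightarrow> Y0 J (mex J) z = 1"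
  and Y0_mem: "J \<subseteq> {..m} \<Longrightarrow> Im z \<noteq> 0 \<Longrightarrow> i \<in> J \<Longrightarrow> Y0 J i z = 0"
  using triangular.elim_mex_zero[OF triangular, of z J] finite_subset[of J "{..m}"] by (auto simp: Y0_def)

lemma Y0_nonzero: "J \<subseteq> {..m} \<Longrightarrow> Im z \<noteq> 0 \<Longrightarrow> j \<le> m \<Longrightarrow> j \<notin> J \<Longrightarrow> Y0 J j z \<noteq> 0"
  using triangular.elim_nonzero_rec[OF triangular, of z J] by (auto simp: Y0_def)

lemma Y0_rec:
  "J \<subseteq> {..m} \<Longrightarrow> Im z \<noteq> 0 \<Longrightarrow> j \<le> m \<Longrightarrow> j \<notin> J \<Longrightarrow> j \<noteq> mex J \<Longrightarrow>
     Y0 (insert j J) i z = Y0 J i z - Y0 J j z / Y0 (next_set J) j z * Y0 (next_set J) i z"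
  using triangular.elim_nonzero_rec[OF triangular, of z J] by (auto simp: Y0_def)

lemma Y_nice:
  assumes J: "J \<subseteq> {..m}" and i: "i \<le> m" "i \<notin> J"
  shows "real_continuous_off (\<Gamma> (card J)) (Y J i)"
proof (cases "i = mex J")
  case True
  then show ?thesis using Y_const(1)[of J i] Y0_mex[OF J] by simp
next
  case False
  have fin: "finite J" using J finite_subset by blast
  have "card J < m" using card_two[OF J i(1), of "mex J"] i False mex_notin[OF fin] mex_least[of i J] by auto
  then obtain \<kappa> where "row_meas J \<kappa>" using rows[OF J] by blast
  then show ?thesis using row_measD[OF _ i False] by metis
qed

text \<open>Exchanging the order in which \<open>n\<close> and \<open>j\<close> are eliminated expresses an entry to the left of
  \<open>n = Max (insert n J)\<close> by entries with fewer eliminated columns and entries to the right.\<close>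

lemma star:
  assumes J: "finite J" "\<forall>x\<in>J. x < n" "mex J < n" "J \<subseteq> {..m}" "n \<le> m"
    and j: "j \<notin> J" "j \<noteq> mex J" "j < n" and z: "Im z \<noteq> 0"
  shows "Y0 (insert n J) j z = - (Y0 (next_set J) j z / Y0 (next_set J) n z) * Y0 (insert j J) n z"
proof -
  have sub: "next_set J \<subseteq> {..m}" using J by auto
  have nz: "Y0 (next_set J) j z \<noteq> 0" "Y0 (next_set J) n z \<noteq> 0"
    using Y0_nonzero[OF sub z, of j] Y0_nonzero[OF sub z, of n] J j by auto
  have rec: "Y0 (insert j J) n z = Y0 J n z - Y0 J j z / Y0 (next_set J) j z * Y0 (next_set J) n z"
    using J j by (intro Y0_rec z) auto
  show ?thesis using elim_star[OF J(1) _ J(3), of "\<lambda>r i. N r i z" j, OF _ nz[unfolded Y0_def] rec[unfolded Y0_def]] J(2) unfolding Y0_def by blast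
qed

text \<open>In the formula of \<open>star\<close> two factors are pure, and the third belongs to
  \<open>next_set J'\<close>, which has fewer columns above its gap. Continuity carries the formula
  to the real points off the interval.\<close>

theorem nonvanishing_all:
  "J \<subseteq> {..m} \<Longrightarrow> j \<le> m \<Longrightarrow> j \<notin> J \<Longrightarrow> nonvanishing J j"
proof (induction "above_mex J" arbitrary: J rule: less_induct)
  case less
  note J = less.prems
  have fin: "finite J" using J(1) finite_subset by blast
  show ?case
  proof (cases "j = mex J")
    case True
    then show ?thesis unfolding nonvanishing_def using Y_const(2)[of J j] Y0_mex[OF J(1)] by simp
  next
    case jmu: False
    then have mj: "mex J < j" using mex_least[OF J(3)] by simp
    show ?thesis
    proof (cases "\<forall>x\<in>J. x < j")
      case True then show ?thesis using pure_nonvanishing J by blast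
    next
      case False
      then obtain x where x: "x \<in> J" "j < x" using J(3) by (metis linorder_neqE_nat)
      then have mx: "mex J < x" using mj by simp
      obtain n J' where n: "J = insert n J'" "n \<notin> J'" "finite J'" "mex J' < n" "mex J' = mex J" "\<And>j. j \<in> J' \<Longrightarrow> j < n" "x \<le> n"
        using max_split[OF fin x(1) mx] by metis
      let ?B = "next_set J'"
      have lt: "\<forall>x\<in>J'. x < n" using n(6) by blast
      have sub: "J' \<subseteq> {..m}" "n \<le> m" "?B \<subseteq> {..m}" "insert j J' \<subseteq> {..m}" using n J by auto
      have jn: "j < n" using x n by simp
      have jB: "j \<notin> J'" "j \<noteq> mex J'" "j \<notin> ?B" using J(3) n jmu by auto
      have nB: "n \<notin> ?B" "n \<notin> insert j J'" using n jn by auto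
      have hB: "above_mex ?B < above_mex J" using above_mex_insert_mex[OF n(3)] above_mex_insert[OF n(3,2,4)] n(1) by simp
      have c: "card J = Suc (card J')" "card ?B = Suc (card J')" "card (insert j J') = Suc (card J')"
        using n jB card_next[OF n(3)] by auto
      have nv: "nonvanishing ?B j" "nonvanishing ?B n" "nonvanishing (insert j J') n"
        using less.hyps[OF hB sub(3) J(2) jB(3)] pure_nonvanishing[OF sub(3,2)] pure_nonvanishing[OF sub(4,2)] lt n(4) jn by auto
      have nc: "real_continuous_off (\<Gamma> (card J)) (Y J j)" "real_continuous_off (\<Gamma> (card J)) (Y ?B j)" "real_continuous_off (\<Gamma> (card J)) (Y ?B n)" "real_continuous_off (\<Gamma> (card J)) (Y (insert j J') n)"
        using Y_nice[OF J] Y_nice[OF sub(3) J(2) jB(3)] Y_nice[OF sub(3,2) nB(1)] Y_nice[OF sub(4,2) nB(2)] c by auto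
      have op: "open (- (complex_of_real ` \<Gamma> (card J)))"
        using compact_imp_closed[OF compact_of_real_image[OF compact_\<Gamma>]] by (rule open_Compl)
      have eq: "Y J j z = - (Y ?B j z / Y ?B n z) * Y (insert j J') n z" if z: "off (card J) z" for z
      proof (rule agree_off_real[OF op, where z = z])
        show "continuous_on (- (complex_of_real ` \<Gamma> (card J))) (\<lambda>z. - (Y ?B j z / Y ?B n z) * Y (insert j J') n z)"
          using nc nv(2) c by (auto simp: real_continuous_off_def nonvanishing_def intro!: continuous_intros)
        fix z :: complex assume "Im z \<noteq> 0"
        then show "Y J j z = - (Y ?B j z / Y ?B n z) * Y (insert j J') n z"
          using star[OF n(3) lt n(4) sub(1,2) jB(1,2) jn] Y_nonreal n(1) by simp
      qed (use nc z in \<open>auto simp: real_continuous_off_def\<close>)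
      show ?thesis unfolding nonvanishing_def
      proof (intro allI impI)
        fix z assume z: "off (card J) z"
        have "Y ?B j z \<noteq> 0" "Y ?B n z \<noteq> 0" "Y (insert j J') n z \<noteq> 0"
          using nv z c by (simp_all add: nonvanishing_def)
        then show "Y J j z \<noteq> 0" unfolding eq[OF z] by simp
      qed
    qed
  qed
qed

text \<open>Once rows exist for all sets, the eliminated entries are a constant plus a transform and
  so are bounded on the imaginary axis; this is the second alternative in
  \<open>rep_step\<close>.\<close>

theorem rep_all:
  "J \<subseteq> {..m} \<Longrightarrow> card J < m \<Longrightarrow> j \<le> m \<Longrightarrow> j \<notin> J \<Longrightarrow> \<exists>\<tau>. rep_meas J j \<tau>"
proof (induction "Suc m - mex J" arbitrary: J rule: less_induct)
  case (less J)
  note J = less.prems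
  have fin: "finite J" using J(1) finite_subset by blast
  obtain \<kappa> where \<kappa>: "row_meas J \<kappa>" using rows[OF J(1,2)] by blast
  show ?case
  proof (cases "j = mex J")
    case True
    then show ?thesis using rep_mex[OF \<kappa> Y0_mex[OF J(1)]] by blast
  next
    case False
    then have mj: "mex J < j" using mex_least[OF J(4)] by simp
    have sub: "next_set J \<subseteq> {..m}" using J mj by auto
    have jn: "j \<notin> next_set J" using J False by simp
    have muj: "mex (insert j J) = mex J" using fin False by (intro mex_insert)
    show ?thesis
    proof (rule rep_step[OF \<kappa> J(1,3,4) False])
      show "nonvanishing J j" "nonvanishing (next_set J) j"
        using nonvanishing_all J sub jn by blast+
      fix i and z :: complex assume z: "Im z \<noteq> 0"
      show "Y0 J (mex J) z = 1" by (rule Y0_mex[OF J(1) z])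
      show "Y0 (next_set J) (mex J) z = 0" by (rule Y0_mem[OF sub z]) simp
      show "Y0 (insert j J) i z = Y0 J i z - Y0 J j z / Y0 (next_set J) j z * Y0 (next_set J) i z"
        by (rule Y0_rec[OF J(1) z J(3,4) False])
    next
      assume c: "card (next_set J) < m"
      have "Suc m - mex (next_set J) < Suc m - mex J" using mex_insert_mex[OF fin] mj J(3) by simp
      then show "\<exists>\<tau>. rep_meas (next_set J) j \<tau>" by (rule less.hyps[OF _ sub c J(3) jn])
    next
      have "\<exists>C. \<forall>y\<ge>1. norm (Y0 (insert j J) i (\<i> * of_real y)) \<le> C" if i: "i \<le> m" "i \<notin> insert j J" "i \<noteq> mex J" for i
      proof -
        have sj: "insert j J \<subseteq> {..m}" using J by auto
        have "card (insert j J) < m"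
          using card_two[OF sj i(1), of "mex J"] i mex_notin[OF fin] mj J(3) by auto
        then obtain \<kappa>' where "row_meas (insert j J) \<kappa>'" using rows[OF sj] by blast
        then show ?thesis using row_i_bounded[of "insert j J" \<kappa>' i] i muj by metis
      qed
      then show "(\<forall>x\<in>J. x < j) \<or> (\<forall>i\<le>m. i \<notin> insert j J \<longrightarrow> i \<noteq> mex J \<longrightarrow> (\<exists>C. \<forall>y\<ge>1. norm (Y0 (insert j J) i (\<i> * of_real y)) \<le> C))"
        by blast
    qed
  qed
qed

text \<open>If \<open>j\<close> is the gap, the denominator is 1. If \<open>i\<close> lies to the
  right of \<open>J\<close>, the numerator is O(1/y) and the denominator at least of that order.
  Otherwise \<open>star\<close> is applied to both entries: a common factor cancels and leaves a
  quotient with fewer columns above the gap, times a quotient of entries in column \<open>n\<close>,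
  whose numerator is O(1/y). The condition \<open>j < i\<close> keeps \<open>i\<close> away from the
  gap throughout.\<close>

lemma ratio_bounded:
  "J \<subseteq> {..m} \<Longrightarrow> i \<le> m \<Longrightarrow> i \<notin> J \<Longrightarrow> j \<notin> J \<Longrightarrow> j < i \<Longrightarrow>
     \<exists>C. \<forall>y\<ge>1. norm (Y0 J i (\<i> * of_real y) / Y0 J j (\<i> * of_real y)) \<le> C"
proof (induction "above_mex J" arbitrary: J rule: less_induct)
  case less
  note J = less.prems
  have fin: "finite J" using J(1) finite_subset by blast
  have mj: "mex J \<le> j" by (rule mex_least[OF J(4)])
  have imu: "i \<noteq> mex J" using mj J(5) by simp
  have cJ: "card J < m" using card_two[OF J(1,2), of j] J by auto
  obtain \<kappa> where \<kappa>: "row_meas J \<kappa>" using rows[OF J(1) cJ] by blast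
  have im: "Im (\<i> * complex_of_real y) \<noteq> 0" if "1 \<le> y" for y using that by simp
  have lower: "\<exists>d>0. \<forall>y\<ge>1. d / y \<le> norm (Y0 I l (\<i> * of_real y))"
    if "row_meas I \<kappa>'" "I \<subseteq> {..m}" "l \<le> m" "l \<notin> I" "l \<noteq> mex I" for I l \<kappa>'
  proof -
    have f: "finite I" using that(2) finite_subset by blast
    have "next_set I \<subseteq> {..m}" using that mex_least[of l I] by auto
    then have "nonvanishing (next_set I) l" using that by (intro nonvanishing_all) auto
    then show ?thesis using row_i_lower[OF that(1) f that(3-5)] by metis
  qed
  show ?case
  proof (cases "j = mex J")
    case True
    obtain C where C: "\<And>y. 1 \<le> y \<Longrightarrow> norm (Y0 J i (\<i> * of_real y)) \<le> C"
      using row_i_bounded[OF \<kappa> J(2,3) imu] by blast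
    show ?thesis using C Y0_mex[OF J(1) im] True by auto
  next
    case jmu: False
    show ?thesis
    proof (cases "\<forall>x\<in>J. x < i")
      case True
      obtain C where C: "0 < C" "\<And>y. 1 \<le> y \<Longrightarrow> norm (Y0 J i (\<i> * of_real y)) \<le> C / y"
        using row_i_upper[OF \<kappa> J(2,3) imu True] by blast
      obtain d where d: "0 < d" "\<And>y. 1 \<le> y \<Longrightarrow> d / y \<le> norm (Y0 J j (\<i> * of_real y))"
        using lower[OF \<kappa> J(1) _ J(4) jmu] J by (metis less_imp_le order_trans)
      have "norm (Y0 J i (\<i> * of_real y) / Y0 J j (\<i> * of_real y)) \<le> C / d" if y: "1 \<le> y" for y
      proof -
        have "norm (Y0 J i (\<i> * of_real y) / Y0 J j (\<i> * of_real y)) \<le> (C / y) / (d / y)"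
          unfolding norm_divide using C d y by (intro frac_le) auto
        then show ?thesis using y by simp
      qed
      then show ?thesis by blast
    next
      case False
      then obtain x where x: "x \<in> J" "i < x" using J(3) by (metis linorder_neqE_nat)
      then have mx: "mex J < x" using mj J(5) by simp
      obtain n J' where n: "J = insert n J'" "n \<notin> J'" "finite J'" "mex J' < n" "mex J' = mex J" "\<And>j. j \<in> J' \<Longrightarrow> j < n" "x \<le> n"
        using max_split[OF fin x(1) mx] by metis
      let ?B = "next_set J'"
      have lt: "\<forall>x\<in>J'. x < n" using n(6) by blast
      have iN: "i < n" "j < n" using x n J(5) by simp_all
      have sub: "J' \<subseteq> {..m}" "n \<le> m" "?B \<subseteq> {..m}" "insert i J' \<subseteq> {..m}" "insert j J' \<subseteq> {..m}"
        using n J by auto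
      have iB: "i \<notin> J'" "i \<noteq> mex J'" "i \<notin> ?B" "j \<notin> J'" "j \<noteq> mex J'" "j \<notin> ?B" using J n jmu imu by auto
      have hB: "above_mex ?B < above_mex J" using above_mex_insert_mex[OF n(3)] above_mex_insert[OF n(3,2,4)] n(1) by simp
      obtain C1 where C1: "\<And>y. 1 \<le> y \<Longrightarrow> norm (Y0 ?B i (\<i> * of_real y) / Y0 ?B j (\<i> * of_real y)) \<le> C1"
        using less.hyps[OF hB sub(3) J(2) iB(3,6) J(5)] by blast
      have cc: "card (insert i J') < m" "card (insert j J') < m" using cJ n iB by auto
      obtain \<kappa>i \<kappa>j where \<kappa>i: "row_meas (insert i J') \<kappa>i" and \<kappa>j: "row_meas (insert j J') \<kappa>j"
        using rows[OF sub(4) cc(1)] rows[OF sub(5) cc(2)] by blast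
      have mus: "mex (insert i J') = mex J'" "mex (insert j J') = mex J'" using mex_insert[OF n(3)] iB by auto
      have nn: "n \<notin> insert i J'" "n \<notin> insert j J'" "n \<noteq> mex (insert i J')" "n \<noteq> mex (insert j J')" "\<forall>x\<in>insert i J'. x < n"
        using n iN mus by auto
      obtain C where C: "0 < C" "\<And>y. 1 \<le> y \<Longrightarrow> norm (Y0 (insert i J') n (\<i> * of_real y)) \<le> C / y"
        using row_i_upper[OF \<kappa>i sub(2) nn(1,3,5)] by blast
      obtain d where d: "0 < d" "\<And>y. 1 \<le> y \<Longrightarrow> d / y \<le> norm (Y0 (insert j J') n (\<i> * of_real y))"
        using lower[OF \<kappa>j sub(5,2) nn(2,4)] by blast
      have "norm (Y0 J i (\<i> * of_real y) / Y0 J j (\<i> * of_real y)) \<le> C1 * (C / d)" if y: "1 \<le> y" for y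
      proof -
        let ?z = "\<i> * complex_of_real y"
        have z: "Im ?z \<noteq> 0" by (rule im[OF y])
        have si: "Y0 J i ?z = - (Y0 ?B i ?z / Y0 ?B n ?z) * Y0 (insert i J') n ?z"
          unfolding n(1) by (rule star[OF n(3) lt n(4) sub(1,2) iB(1,2) iN(1) z])
        have sj: "Y0 J j ?z = - (Y0 ?B j ?z / Y0 ?B n ?z) * Y0 (insert j J') n ?z"
          unfolding n(1) by (rule star[OF n(3) lt n(4) sub(1,2) iB(4,5) iN(2) z])
        have nB: "Y0 ?B n ?z \<noteq> 0" using n by (intro Y0_nonzero sub z) auto
        have "Y0 J i ?z / Y0 J j ?z = (Y0 ?B i ?z / Y0 ?B j ?z) * (Y0 (insert i J') n ?z / Y0 (insert j J') n ?z)"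
          unfolding si sj using nB by simp
        also have "norm \<dots> \<le> C1 * ((C / y) / (d / y))"
          unfolding norm_mult
        proof (rule mult_mono)
          show "norm (Y0 (insert i J') n ?z / Y0 (insert j J') n ?z) \<le> (C / y) / (d / y)"
            unfolding norm_divide using C d y by (intro frac_le) auto
          show "norm (Y0 ?B i ?z / Y0 ?B j ?z) \<le> C1" by (rule C1[OF y])
          show "0 \<le> C1" using C1[OF y] norm_ge_zero order_trans by blast
        qed simp
        finally show ?thesis using y by simp
      qed
      then show ?thesis by blast
    qed
  qed
qed

theorem representation:
  assumes J: "J \<subseteq> {..m}" "card J < m" and j: "j \<le> m" "j \<notin> J"
  shows "\<exists>\<tau>. concentrated_inf (\<Gamma> (card J)) \<tau> \<and>
    (\<forall>i\<le>m. i \<notin> J \<longrightarrow> i \<noteq> j \<longrightarrow> (\<exists>\<beta> \<gamma> :: real. (j < i \<longrightarrow> \<beta> = 0) \<and>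
       (\<forall>z. Im z \<noteq> 0 \<longrightarrow> Y J i z / Y J j z = of_real \<beta> * z + of_real \<gamma> + ctrans \<tau> (Y (insert j J) i) z)))"
proof -
  obtain \<tau> where \<tau>: "rep_meas J j \<tau>" using rep_all[OF J j] by blast
  have \<tau>c: "concentrated_inf (\<Gamma> (card J)) \<tau>" using \<tau> by (simp add: rep_meas_def)
  have "\<exists>\<beta> \<gamma> :: real. (j < i \<longrightarrow> \<beta> = 0) \<and>
       (\<forall>z. Im z \<noteq> 0 \<longrightarrow> Y J i z / Y J j z = of_real \<beta> * z + of_real \<gamma> + ctrans \<tau> (Y (insert j J) i) z)"
    if i: "i \<le> m" "i \<notin> J" "i \<noteq> j" for i
  proof -
    obtain \<beta> \<gamma> :: real where rep: "\<And>z. Im z \<noteq> 0 \<Longrightarrow> Y0 J i z / Y0 J j z = of_real \<beta> * z + of_real \<gamma> + ctrans \<tau> (Y (insert j J) i) z"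
      and n: "real_continuous_off (\<Gamma> (Suc (card J))) (Y (insert j J) i)"
      using \<tau> i unfolding rep_meas_def by blast
    have "\<beta> = 0" if ji: "j < i"
    proof -
      obtain C where C: "\<And>y. 1 \<le> y \<Longrightarrow> norm (Y0 J i (\<i> * of_real y) / Y0 J j (\<i> * of_real y)) \<le> C"
        using ratio_bounded[OF J(1) i(1,2) j(2) ji] by blast
      show ?thesis
      proof (rule slope_zero[OF concD[OF \<tau>c] compact_\<Gamma> real_continuous_off_dens[OF n compact_\<Gamma> disjoint]])
        fix y :: real assume y: "1 \<le> y"
        then have z: "Im (\<i> * complex_of_real y) \<noteq> 0" by simp
        show "norm (of_real \<beta> * (\<i> * of_real y) + of_real \<gamma> + ctrans \<tau> (Y (insert j J) i) (\<i> * of_real y)) \<le> C"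
          using C[OF y] unfolding rep[OF z] .
      qed
    qed
    moreover have "Y J i z / Y J j z = of_real \<beta> * z + of_real \<gamma> + ctrans \<tau> (Y (insert j J) i) z" if "Im z \<noteq> 0" for z
      using rep[OF that] unfolding Y_nonreal[OF that] .
    ultimately show ?thesis by blast
  qed
  then show ?thesis using \<tau>c by blast
qed

end

section \<open>Nikishin systems and concentrated measures\<close>

text \<open>The complement of the support is a union of open null sets; by the Lindelof property
  countably many of them suffice.\<close>

lemma supp_complement_null:
  assumes "sets (snd s) = sets borel"
  shows "emeasure (snd s) (- sm_supp s) = 0" and "open (- sm_supp s)"
proof -
  let ?F = "{U. open U \<and> emeasure (snd s) U = 0}"
  have eq: "- sm_supp s = \<Union>?F" by (auto simp: sm_supp_def zero_less_iff_neq_zero)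
  show "open (- sm_supp s)" unfolding eq by auto
  obtain F' where F': "F' \<subseteq> ?F" "countable F'" "\<Union>F' = \<Union>?F"
    using Lindelof[of ?F] by auto
  have "(\<Union>U\<in>F'. U) \<in> null_sets (snd s)"
    using F'(1,2) assms by (intro null_sets_UN') (auto simp: null_sets_def subset_iff)
  then show "emeasure (snd s) (- sm_supp s) = 0" using F'(3) by (simp add: eq null_setsD1)
qed

lemma concentrated_inf_of_const_sign:
  assumes "s \<in> const_sign_measures \<Delta>"
  shows "concentrated_inf \<Delta> s" and "\<exists>a b. \<Delta> = {a..b}"
proof -
  have s: "fst s = 1 \<or> fst s = -1" "finite_measure (snd s)" "sets (snd s) = sets borel"
    "compact (sm_supp s)" "infinite (sm_supp s)" "\<Delta> = convex hull (sm_supp s)"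
    using assms by (auto simp: const_sign_measures_def)
  have sub: "sm_supp s \<subseteq> \<Delta>" using s(6) by (simp add: hull_subset)
  have comp: "compact \<Delta>" using s(4,6) by (simp add: compact_convex_hull)
  have "connected \<Delta>" using s(6) by (simp add: convex_connected)
  then show "\<exists>a b. \<Delta> = {a..b}" using comp by (metis connected_compact_interval_1)
  have "emeasure (snd s) (- \<Delta>) \<le> emeasure (snd s) (- sm_supp s)"
    using sub s(3) supp_complement_null(2)[OF s(3)] by (intro emeasure_mono) auto
  then have null: "emeasure (snd s) (- \<Delta>) = 0" using supp_complement_null(1)[OF s(3)] by simp
  have "emeasure (snd s) (- F) \<noteq> 0" if F: "finite F" for F
  proof
    assume z: "emeasure (snd s) (- F) = 0"
    have "open (- F)" using finite_imp_closed[OF F] by auto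
    then have "sm_supp s \<subseteq> F" using z by (force simp: sm_supp_def)
    then show False using F s(5) finite_subset by blast
  qed
  then show "concentrated_inf \<Delta> s" using s null by (auto simp: concentrated_inf_def concentrated_def)
qed

text \<open>The way back to the class in the definition of a Nikishin system: the hull of the
  support may be smaller than the interval carrying the measure, and it is this hull that the class
  requires.\<close>

lemma const_sign_of_concentrated_inf:
  assumes s: "concentrated_inf {a..b} s"
  shows "s \<in> const_sign_measures (convex hull (sm_supp s))" and "convex hull (sm_supp s) \<subseteq> {a..b}"
    and "concentrated_inf (convex hull (sm_supp s)) s" and "compact (convex hull (sm_supp s))"
proof -
  have sets: "sets (snd s) = sets borel" using s by (simp add: concentrated_inf_def concentrated_def)
  have sub: "sm_supp s \<subseteq> {a..b}"
  proof
    fix x assume x: "x \<in> sm_supp s"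
    show "x \<in> {a..b}"
    proof (rule ccontr)
      assume "x \<notin> {a..b}"
      moreover have "open (- {a..b})" by (intro open_Compl) simp
      ultimately have "emeasure (snd s) (- {a..b}) > 0" using x by (simp add: sm_supp_def)
      then show False using s by (simp add: concentrated_inf_def concentrated_def)
    qed
  qed
  then show "convex hull (sm_supp s) \<subseteq> {a..b}" by (intro hull_minimal) auto
  have "closed (sm_supp s)" using supp_complement_null(2)[OF sets] by (simp add: closed_def)
  then have comp: "compact (sm_supp s)" using sub
    by (metis compact_Icc compact_Int_closed inf.absorb_iff2)
  then show "compact (convex hull (sm_supp s))" by (rule compact_convex_hull)
  have "infinite (sm_supp s)"
    using s supp_complement_null(1)[OF sets] by (auto simp: concentrated_inf_def)
  then show m: "s \<in> const_sign_measures (convex hull (sm_supp s))"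
    using s comp by (auto simp: const_sign_measures_def concentrated_inf_def concentrated_def)
  show "concentrated_inf (convex hull (sm_supp s)) s" by (rule concentrated_inf_of_const_sign(1)[OF m])
qed

section \<open>Brackets and generators\<close>

lemma cauchy_transform_ct: "cauchy_transform s = ctrans s (\<lambda>_. 1)"
  by (simp add: fun_eq_iff cauchy_transform_def ctrans_def)

lemma cauchy_transform_of_real:
  "complex_of_real (cauchy_transform s x) = ctrans s (\<lambda>_. 1) (of_real x)"
proof -
  have "(\<integral>t. 1 / (complex_of_real x - of_real t) \<partial>snd s) = (\<integral>t. complex_of_real (1 / (x - t)) \<partial>snd s)" by simp
  also have "\<dots> = of_real (\<integral>t. 1 / (x - t) \<partial>snd s)" by (rule integral_complex_of_real)
  finally show ?thesis by (simp add: cauchy_transform_def ctrans_def sm_integral_def scaleR_conv_of_real)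
qed

text \<open>The transform of \<open>t\<close> has no zeros on \<open>{a..b}\<close>, hence one sign
  there, so the bracket is again a measure of constant sign with infinite support.\<close>

lemma bracket:
  assumes s: "concentrated_inf {a..b} s" and t: "concentrated_inf {a'..b'} t" and disj: "{a..b} \<inter> {a'..b'} = {}"
  shows "concentrated_inf {a..b} (sm_bracket s t)"
    and "ctrans (sm_bracket s t) (\<lambda>_. 1) z = ctrans s (ctrans t (\<lambda>_. 1)) z"
proof -
  let ?f = "cauchy_transform t :: real \<Rightarrow> real"
  have t': "concentrated {a'..b'} t" using t by (rule concentrated_infD)
  have f: "?f x = Re (ctrans t (\<lambda>_. 1) (of_real x))" for x
    using cauchy_transform_of_real[of t x] by (metis Re_complex_of_real)
  have d: "density_on {a..b} (ctrans t (\<lambda>_. 1))" by (rule density_on_ct[OF t' compact_Icc density_on_const]) (use disj in blast)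
  have [measurable]: "(\<lambda>x. ctrans t (\<lambda>_. 1) (of_real x)) \<in> borel_measurable borel" using d by (simp add: density_on_def)
  have fm [measurable]: "?f \<in> borel_measurable borel" unfolding f[abs_def] by measurable
  have fc: "continuous_on {a..b} ?f" unfolding f[abs_def] using d by (auto simp: density_on_def intro!: continuous_intros)
  have f0: "?f x \<noteq> 0" if "x \<in> {a..b}" for x
  proof -
    have "complex_of_real x \<notin> complex_of_real ` {a'..b'}" using that disj by auto
    then have "ctrans t (\<lambda>_. 1) (of_real x) \<noteq> 0" by (rule ctrans_nonzero[OF t])
    then show ?thesis using cauchy_transform_of_real[of t x] by auto
  qed
  obtain K where K: "\<And>x. x \<in> {a..b} \<Longrightarrow> norm (ctrans t (\<lambda>_. 1) (of_real x)) \<le> K"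
    using density_on_bounded[OF compact_Icc d] by blast
  have fK: "\<bar>?f x\<bar> \<le> K" if "x \<in> {a..b}" for x
    using K[OF that] cauchy_transform_of_real[of t x] by (metis norm_of_real)
  have sgn: "(\<forall>x\<in>{a..b}. 0 < ?f x) \<or> (\<forall>x\<in>{a..b}. ?f x < 0)"
    by (rule nonzero_constant_sign[OF fc]) (rule f0)
  show "concentrated_inf {a..b} (sm_bracket s t)" unfolding sm_bracket_def
    by (rule concentrated_sm_density(1)[OF s compact_Icc fm _ sgn]) (rule fK)
  have "sm_integral (sm_bracket s t) (\<lambda>x. 1 / (z - of_real x)) = sm_integral s (\<lambda>x. of_real (?f x) * (1 / (z - of_real x)))"
    unfolding sm_bracket_def by (rule concentrated_sm_density(2)[OF s compact_Icc fm _ sgn]) (use fK in auto)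
  then show "ctrans (sm_bracket s t) (\<lambda>_. 1) z = ctrans s (ctrans t (\<lambda>_. 1)) z"
    by (simp add: ctrans_def[of s] ctrans_def[of "sm_bracket s t"] cauchy_transform_of_real)
qed

lemma nikishin_diag: "nikishin \<sigma> k k = \<sigma> k"
  by (subst nikishin.simps) simp

lemma nikishin_less: "j < k \<Longrightarrow> nikishin \<sigma> j k = sm_bracket (\<sigma> j) (nikishin \<sigma> (Suc j) k)"
  by (subst nikishin.simps) simp

text \<open>The measure \<open>\<sigma> (Suc r)\<close> lives on \<open>\<Gamma> r\<close>: levels are counted from 0, generators from 1.\<close>

locale generator =
  fixes m :: nat and \<Gamma> :: "nat \<Rightarrow> real set" and \<sigma> :: "nat \<Rightarrow> sgn_measure"
  assumes interval: "\<exists>a b. \<Gamma> r = {a..b}" and disjoint: "\<Gamma> r \<inter> \<Gamma> (Suc r) = {}"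
    and meas: "r < m \<Longrightarrow> concentrated_inf (\<Gamma> r) (\<sigma> (Suc r))"
begin

definition hat :: "nat \<Rightarrow> nat \<Rightarrow> complex \<Rightarrow> complex" where
  "hat r i = (if i < r then (\<lambda>_. 0) else if i = r then (\<lambda>_. 1) else ctrans (nikishin \<sigma> (Suc r) i) (\<lambda>_. 1))"

lemma nikishin_concentrated:
  assumes "r < i" "i \<le> m"
  shows "concentrated_inf (\<Gamma> r) (nikishin \<sigma> (Suc r) i) \<and>
    ctrans (nikishin \<sigma> (Suc r) i) (\<lambda>_. 1) z = ctrans (\<sigma> (Suc r)) (hat (Suc r) i) z"
  using assms
proof (induction "i - r" arbitrary: r z rule: less_induct)
  case less
  have s: "concentrated_inf (\<Gamma> r) (\<sigma> (Suc r))" using meas[of r] less.prems by simp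
  show ?case
  proof (cases "i = Suc r")
    case True
    then show ?thesis using s by (simp add: nikishin_diag hat_def)
  next
    case False
    then have i: "Suc r < i" "i \<le> m" using less.prems by auto
    have t: "concentrated_inf (\<Gamma> (Suc r)) (nikishin \<sigma> (Suc (Suc r)) i)" using less.hyps[of "Suc r"] i by auto
    obtain a b a' b' where ab: "\<Gamma> r = {a..b}" "\<Gamma> (Suc r) = {a'..b'}" using interval by metis
    note B = bracket[OF s[unfolded ab] t[unfolded ab] disjoint[of r, unfolded ab]]
    show ?thesis unfolding nikishin_less[OF i(1)] using B i by (simp add: ab hat_def)
  qed
qed

lemma compact_\<Gamma>: "compact (\<Gamma> r)"
  using interval[of r] by auto

lemma hat_dens: "r < i \<Longrightarrow> i \<le> m \<Longrightarrow> density_on (\<Gamma> r) (hat (Suc r) i)"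
proof (cases "i = Suc r")
  case False
  assume i: "r < i" "i \<le> m"
  then have "concentrated (\<Gamma> (Suc r)) (nikishin \<sigma> (Suc (Suc r)) i)"
    using nikishin_concentrated[of "Suc r" i] False by (auto dest: concentrated_infD)
  then have "density_on (\<Gamma> r) (ctrans (nikishin \<sigma> (Suc (Suc r)) i) (\<lambda>_. 1))"
    by (rule density_on_ct[OF _ compact_\<Gamma> density_on_const]) (use disjoint[of r] in blast)
  then show ?thesis using i False by (simp add: hat_def)
qed (simp add: hat_def)

lemma hat_cnj: "r \<le> i \<Longrightarrow> i \<le> m \<Longrightarrow> hat r i (cnj z) = cnj (hat r i z)"
proof (cases "i = r")
  case False
  assume i: "r \<le> i" "i \<le> m"
  then have "concentrated (\<Gamma> r) (nikishin \<sigma> (Suc r) i)"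
    using nikishin_concentrated[of r i] False by (auto dest: concentrated_infD)
  then show ?thesis using i False ctrans_cnj[OF _ compact_\<Gamma> density_on_const] by (simp add: hat_def)
qed (simp add: hat_def)

lemma hat_real: "r \<le> i \<Longrightarrow> i \<le> m \<Longrightarrow> hat r i (of_real x) \<in> \<real>"
  using hat_cnj[of r i "of_real x"] by (simp add: Reals_cnj_iff)

lemma hat_continuous:
  "r \<le> i \<Longrightarrow> i \<le> m \<Longrightarrow> continuous_on (- (complex_of_real ` \<Gamma> r)) (hat r i)"
proof (cases "i = r")
  case False
  assume i: "r \<le> i" "i \<le> m"
  then have "concentrated (\<Gamma> r) (nikishin \<sigma> (Suc r) i)"
    using nikishin_concentrated[of r i] False by (auto dest: concentrated_infD)
  then show ?thesis using i False ctrans_continuous[OF _ compact_\<Gamma> density_on_const] by (simp add: hat_def)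
qed (simp add: hat_def)

lemma hat_ct: "r < i \<Longrightarrow> i \<le> m \<Longrightarrow> hat r i z = ctrans (\<sigma> (Suc r)) (hat (Suc r) i) z"
  using nikishin_concentrated[of r i z] by (simp add: hat_def)

lemma flag: "flag_system m \<Gamma> hat (\<lambda>r. \<sigma> (Suc r))"
proof
  fix r i x z
  show "\<exists>a b. \<Gamma> r = {a..b}" by (rule interval)
  show "\<Gamma> r \<inter> \<Gamma> (Suc r) = {}" by (rule disjoint)
  show "hat r r = (\<lambda>_. 1)" "i < r \<Longrightarrow> hat r i = (\<lambda>_. 0)" by (simp_all add: hat_def)
  show "r < m \<Longrightarrow> concentrated_inf (\<Gamma> r) (\<sigma> (Suc r))" by (rule meas)
  show "r < i \<Longrightarrow> i \<le> m \<Longrightarrow> density_on (\<Gamma> r) (hat (Suc r) i)" by (rule hat_dens)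
  show "r < i \<Longrightarrow> i \<le> m \<Longrightarrow> x \<in> \<Gamma> r \<Longrightarrow> hat (Suc r) i (complex_of_real x) \<in> \<real>" by (simp add: hat_real)
  show "r < i \<Longrightarrow> i \<le> m \<Longrightarrow> z \<notin> complex_of_real ` \<Gamma> r \<Longrightarrow> hat r i z = ctrans (\<sigma> (Suc r)) (hat (Suc r) i) z"
    by (rule hat_ct)
qed

lemma nikishin_hat_eq: "k \<le> m \<Longrightarrow> nikishin_hat \<sigma> k z = hat 0 k z"
  by (simp add: nikishin_hat_def hat_def cauchy_transform_ct)

text \<open>The hulls of the supports lie inside the intervals \<open>\<Gamma>\<close> and inherit
  their disjointness.\<close>

lemma nikishin_generator: "nikishin_generator m \<sigma>"
  unfolding nikishin_generator_def
proof (intro exI[of _ "\<lambda>j. convex hull (sm_supp (\<sigma> j))"] conjI ballI)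
  have *: "\<sigma> j \<in> const_sign_measures (convex hull (sm_supp (\<sigma> j))) \<and> convex hull (sm_supp (\<sigma> j)) \<subseteq> \<Gamma> (j - 1)"
    if "j \<in> {1..m}" for j
  proof -
    have "j - 1 < m" "Suc (j - 1) = j" using that by auto
    then have "concentrated_inf (\<Gamma> (j - 1)) (\<sigma> j)" using meas[of "j - 1"] by simp
    then show ?thesis using interval[of "j - 1"] const_sign_of_concentrated_inf by metis
  qed
  show "j \<in> {1..m} \<Longrightarrow> \<sigma> j \<in> const_sign_measures (convex hull (sm_supp (\<sigma> j)))" for j using * by blast
  fix j assume "j \<in> {1..<m}"
  then have j: "j \<in> {1..m}" "Suc j \<in> {1..m}" by auto
  then show "convex hull (sm_supp (\<sigma> j)) \<inter> convex hull (sm_supp (\<sigma> (Suc j))) = {}"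
    using *[OF j(1)] *[OF j(2)] disjoint[of "j - 1"] by auto
qed

text \<open>The domain excludes only the hulls of the supports, which may be smaller than
  \<open>\<Gamma> 0\<close>; continuity is therefore proved relative to these hulls instead of being
  taken from \<open>hat_continuous\<close>.\<close>

lemma open_domain: "open (nikishin_domain m \<sigma>)"
  and nikishin_hat_continuous: "k \<le> m \<Longrightarrow> continuous_on (nikishin_domain m \<sigma>) (nikishin_hat \<sigma> k)"
proof -
  have *: "concentrated_inf (convex hull (sm_supp (nikishin \<sigma> 1 k))) (nikishin \<sigma> 1 k) \<and> compact (convex hull (sm_supp (nikishin \<sigma> 1 k)))"
    if "k \<in> {1..m}" for k
  proof -
    have "concentrated_inf (\<Gamma> 0) (nikishin \<sigma> 1 k)" using nikishin_concentrated[of 0 k] that by simp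
    then show ?thesis using interval[of 0] const_sign_of_concentrated_inf(3,4) by metis
  qed
  show "open (nikishin_domain m \<sigma>)" unfolding nikishin_domain_def
    by (intro open_Compl closed_UN ballI compact_imp_closed compact_of_real_image) (use * in auto)
  assume k: "k \<le> m"
  show "continuous_on (nikishin_domain m \<sigma>) (nikishin_hat \<sigma> k)"
  proof (cases "k = 0")
    case True
    then show ?thesis by (simp add: nikishin_hat_def[abs_def])
  next
    case False
    then have km: "k \<in> {1..m}" using k by simp
    have "continuous_on (- (complex_of_real ` (convex hull (sm_supp (nikishin \<sigma> 1 k))))) (ctrans (nikishin \<sigma> 1 k) (\<lambda>_. 1))"
      using *[OF km] by (intro ctrans_continuous density_on_const) (auto dest: concentrated_infD)
    then have "continuous_on (nikishin_domain m \<sigma>) (ctrans (nikishin \<sigma> 1 k) (\<lambda>_. 1))"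
      by (rule continuous_on_subset) (use km in \<open>auto simp: nikishin_domain_def\<close>)
    then show ?thesis using False by (simp add: nikishin_hat_def[abs_def] cauchy_transform_ct)
  qed
qed

end

lemma generator_of_nikishin:
  assumes "nikishin_generator m \<sigma>"
  obtains \<Gamma> where "generator m \<Gamma> \<sigma>"
proof -
  obtain \<Delta> where \<Delta>: "\<And>j. j \<in> {1..m} \<Longrightarrow> \<sigma> j \<in> const_sign_measures (\<Delta> j)"
    "\<And>j. j \<in> {1..<m} \<Longrightarrow> \<Delta> j \<inter> \<Delta> (Suc j) = {}"
    using assms unfolding nikishin_generator_def by blast
  \<comment> \<open>Empty intervals from level \<open>m\<close> on make disjointness hold at every
    level.\<close>
  define \<Gamma> where "\<Gamma> r = (if r < m then \<Delta> (Suc r) else {})" for r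
  have "generator m \<Gamma> \<sigma>"
  proof
    fix r
    show "\<exists>a b. \<Gamma> r = {a..b}"
    proof (cases "r < m")
      case True
      then show ?thesis using concentrated_inf_of_const_sign(2)[OF \<Delta>(1)[of "Suc r"]] by (simp add: \<Gamma>_def)
    next
      case False
      then show ?thesis by (intro exI[of _ 1] exI[of _ 0]) (simp add: \<Gamma>_def)
    qed
    show "\<Gamma> r \<inter> \<Gamma> (Suc r) = {}" using \<Delta>(2)[of "Suc r"] by (auto simp: \<Gamma>_def)
    show "r < m \<Longrightarrow> concentrated_inf (\<Gamma> r) (\<sigma> (Suc r))"
      using concentrated_inf_of_const_sign(1)[OF \<Delta>(1)[of "Suc r"]] by (simp add: \<Gamma>_def)
  qed
  then show thesis by (rule that)
qed

section \<open>Sorting the components, degree bounds\<close>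

lemma stable_decreasing_permutation:
  fixes n :: "nat \<Rightarrow> nat"
  obtains \<pi> where "\<pi> permutes {0..m}"
    "\<And>i j. i < j \<Longrightarrow> j \<le> m \<Longrightarrow> n (\<pi> j) < n (\<pi> i) \<or> n (\<pi> j) = n (\<pi> i) \<and> \<pi> i < \<pi> j"
proof -
  define B where "B = Max (n ` {0..m})"
  have nB: "n i \<le> B" if "i \<le> m" for i using that by (simp add: B_def)
  \<comment> \<open>The key encodes the lexicographic order, larger \<open>n\<close> first and then
    smaller index; its remainder modulo \<open>Suc m\<close> recovers the index.\<close>
  define key where "key i = (B - n i) * Suc m + i" for i
  have key: "key i < key j \<Longrightarrow> n j < n i \<or> n j = n i \<and> i < j" if ij: "i \<le> m" "j \<le> m" for i j
  proof (rule ccontr)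
    assume a: "key i < key j" "\<not> (n j < n i \<or> n j = n i \<and> i < j)"
    then consider "n i < n j" | "n i = n j" "j \<le> i" by linarith
    then show False
    proof cases
      case 1
      then have "Suc (B - n j) \<le> B - n i" using nB[OF ij(1)] nB[OF ij(2)] by linarith
      then have "Suc (B - n j) * Suc m \<le> (B - n i) * Suc m" by (rule mult_le_mono1)
      then have "key j \<le> key i" using ij by (simp add: key_def)
      with a show False by simp
    next
      case 2
      with a show False by (simp add: key_def)
    qed
  qed
  have key_mod: "key i mod Suc m = i" if "i \<le> m" for i
  proof -
    have "key i mod Suc m = (i + (B - n i) * Suc m) mod Suc m" by (simp only: key_def add.commute)
    also have "\<dots> = i mod Suc m" by (rule mod_mult_self1)
    finally show ?thesis using that by simp
  qed
  have key_inj: "inj_on key {0..m}"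
  proof (rule inj_onI)
    fix i j assume ij: "i \<in> {0..m}" "j \<in> {0..m}" "key i = key j"
    then show "i = j" by (metis atLeastAtMost_iff key_mod)
  qed
  have card: "card (key ` {0..m}) = Suc m" using card_image[OF key_inj] by simp
  have fin: "finite (key ` {0..m})" by simp
  obtain h where h0: "bij_betw h {..<card (key ` {0..m})} (key ` {0..m})" "strict_mono_on {..<card (key ` {0..m})} h"
    by (rule ex_bij_betw_strict_mono_card[OF fin])
  note h = h0[unfolded card]
  define \<pi> where "\<pi> i = (if i \<le> m then inv_into {0..m} key (h i) else i)" for i
  have hk: "h i \<in> key ` {0..m}" if "i \<le> m" for i using h(1) that by (auto simp: bij_betw_def)
  have \<pi>m: "\<pi> i \<le> m" "key (\<pi> i) = h i" if "i \<le> m" for i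
    using inv_into_into[OF hk[OF that]] f_inv_into_f[OF hk[OF that]] that by (auto simp: \<pi>_def)
  show thesis
  proof (rule that[of \<pi>])
    have "inj_on \<pi> {0..m}"
    proof (rule inj_onI)
      fix i j assume ij: "i \<in> {0..m}" "j \<in> {0..m}" "\<pi> i = \<pi> j"
      then have "h i = h j" using \<pi>m(2)[of i] \<pi>m(2)[of j] by simp
      then show "i = j" using inj_onD[OF bij_betw_imp_inj_on[OF h(1)], of i j] ij(1,2) by simp
    qed
    moreover have "\<pi> ` {0..m} \<subseteq> {0..m}" by (intro image_subsetI) (simp add: \<pi>m(1))
    ultimately have "bij_betw \<pi> {0..m} {0..m}"
      by (simp add: bij_betw_def endo_inj_surj)
    then show "\<pi> permutes {0..m}" by (rule bij_imp_permutes) (simp add: \<pi>_def)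
    fix i j assume ij: "i < j" "j \<le> m"
    then have "h i < h j" using h(2) by (auto simp: strict_mono_on_def)
    then show "n (\<pi> j) < n (\<pi> i) \<or> n (\<pi> j) = n (\<pi> i) \<and> \<pi> i < \<pi> j"
      using \<pi>m[of i] \<pi>m[of j] ij key[of "\<pi> i" "\<pi> j"] by auto
  qed
qed

text \<open>A description by coefficients treats \<open>d = 0\<close>, where the polynomial must
  vanish, like all other bounds.\<close>

lemma deg_le_coeff: "deg_le p (int d - 1) \<longleftrightarrow> (\<forall>i\<ge>d. coeff p i = 0)"
proof
  assume "deg_le p (int d - 1)"
  then have "p = 0 \<or> degree p < d" by (auto simp: deg_le_def)
  then show "\<forall>i\<ge>d. coeff p i = 0" by (auto intro: coeff_eq_0)
next
  assume a: "\<forall>i\<ge>d. coeff p i = 0"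
  show "deg_le p (int d - 1)"
  proof (cases "p = 0")
    case False
    then have "\<not> d \<le> degree p" using a leading_coeff_0_iff by blast
    then show ?thesis by (simp add: deg_le_def)
  qed (simp add: deg_le_def)
qed

lemma ctrans_sum:
  assumes s: "concentrated \<Gamma> s" "compact \<Gamma>" and z: "z \<notin> complex_of_real ` \<Gamma>" and "finite A"
    and "\<And>l. l \<in> A \<Longrightarrow> density_on \<Gamma> (f l)"
  shows "density_on \<Gamma> (\<lambda>x. \<Sum>l\<in>A. f l x) \<and> ctrans s (\<lambda>x. \<Sum>l\<in>A. f l x) z = (\<Sum>l\<in>A. ctrans s (f l) z)"
  using assms(4,5)
proof (induction A rule: finite_induct)
  case empty
  show ?case by (simp add: ctrans_def sm_integral_def)
next
  case (insert l A)
  then show ?case using ctrans_add[OF s, of "f l" "\<lambda>x. \<Sum>l\<in>A. f l x" z] z by (simp add: density_on_add)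
qed

section \<open>Reordering\<close>

locale reordering = generator m \<Gamma> \<sigma> + F: flag_system m \<Gamma> hat "\<lambda>r. \<sigma> (Suc r)"
  for m :: nat and \<Gamma> :: "nat \<Rightarrow> real set" and \<sigma> :: "nat \<Rightarrow> sgn_measure" +
  fixes \<pi> n :: "nat \<Rightarrow> nat"
  assumes perm: "\<pi> permutes {0..m}"
    and decreasing: "i < j \<Longrightarrow> j \<le> m \<Longrightarrow> n (\<pi> j) < n (\<pi> i) \<or> n (\<pi> j) = n (\<pi> i) \<and> \<pi> i < \<pi> j"
begin

definition Js :: "nat \<Rightarrow> nat set" where
  "Js k = \<pi> ` {..<k}"

text \<open>The row belonging to the first \<open>k\<close> columns of the new order, normalised to
  have entry 1 at column \<open>\<pi> k\<close>, like a row of the original array at its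
  diagonal.\<close>

definition Q :: "nat \<Rightarrow> nat \<Rightarrow> complex \<Rightarrow> complex" where
  "Q k i z = F.Y (Js k) (\<pi> i) z / F.Y (Js k) (\<pi> k) z"

lemma \<pi>_inj: "\<pi> i = \<pi> j \<longleftrightarrow> i = j"
  using permutes_inj[OF perm] by (simp add: inj_eq)

lemma \<pi>_le: "i \<le> m \<Longrightarrow> \<pi> i \<le> m"
  using permutes_in_image[OF perm, of i] by simp

lemma Js_Suc: "insert (\<pi> k) (Js k) = Js (Suc k)"
  by (auto simp: Js_def lessThan_Suc)

lemma Js_card: "card (Js k) = k"
  unfolding Js_def by (subst card_image) (auto simp: inj_on_def \<pi>_inj)

lemma Js_subset: "k \<le> Suc m \<Longrightarrow> Js k \<subseteq> {..m}"
  using \<pi>_le by (force simp: Js_def)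

lemma Js_notin: "k \<le> i \<Longrightarrow> \<pi> i \<notin> Js k"
  by (auto simp: Js_def \<pi>_inj)

lemma Y_off:
  assumes "k \<le> i" "i \<le> m"
  shows "real_continuous_off (\<Gamma> k) (F.Y (Js k) (\<pi> i))" and "z \<notin> complex_of_real ` \<Gamma> k \<Longrightarrow> F.Y (Js k) (\<pi> i) z \<noteq> 0"
  using F.Y_nice[OF Js_subset[of k] \<pi>_le[of i] Js_notin[of k i]]
    F.nonvanishing_all[OF Js_subset[of k] \<pi>_le[of i] Js_notin[of k i]] assms
  by (auto simp: Js_card F.nonvanishing_def)

lemma Q_continuous: "k \<le> i \<Longrightarrow> i \<le> m \<Longrightarrow> continuous_on (- (complex_of_real ` \<Gamma> k)) (Q k i)"
  unfolding Q_def[abs_def] using Y_off[of k i] Y_off[of k k]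
  by (auto simp: real_continuous_off_def intro!: continuous_on_divide)

lemma density_on_prev: "real_continuous_off (\<Gamma> (Suc k)) f \<Longrightarrow> density_on (\<Gamma> k) f"
  by (rule real_continuous_off_dens[OF _ compact_\<Gamma> disjoint])

lemma off_next: "x \<in> \<Gamma> k \<Longrightarrow> complex_of_real x \<notin> complex_of_real ` \<Gamma> (Suc k)"
  using disjoint[of k] by auto

lemma Q_dens: "Suc k \<le> i \<Longrightarrow> i \<le> m \<Longrightarrow> density_on (\<Gamma> k) (Q (Suc k) i)"
  unfolding Q_def[abs_def] using Y_off[of "Suc k" i] Y_off[of "Suc k" "Suc k"] off_next
  by (intro density_on_divide density_on_prev) auto

text \<open>Passing from \<open>Y\<close> to the normalised \<open>Q\<close> costs the factor
  \<open>Y\<close> at the next leading column; it has no zeros on the interval and is absorbed into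
  \<open>\<tau>\<close>, which yields the next generator. A nonzero slope requires
  \<open>\<pi> i < \<pi> k\<close>, and since ties are broken by the natural order the sizes then
  differ strictly.\<close>

lemma next_generator:
  assumes k: "k < m"
  shows "\<exists>r. concentrated_inf (\<Gamma> k) r \<and> (\<forall>i\<in>{k<..m}. \<exists>\<beta> \<gamma> :: real. (\<beta> \<noteq> 0 \<longrightarrow> n (\<pi> i) < n (\<pi> k)) \<and>
    (\<forall>z. Im z \<noteq> 0 \<longrightarrow> Q k i z = of_real \<beta> * z + of_real \<gamma> + ctrans r (Q (Suc k) i) z))"
proof -
  obtain \<tau> where \<tau>: "concentrated_inf (\<Gamma> k) \<tau>"
    and rep: "\<And>i. i \<le> m \<Longrightarrow> i \<notin> Js k \<Longrightarrow> i \<noteq> \<pi> k \<Longrightarrow> \<exists>\<beta> \<gamma> :: real. (\<pi> k < i \<longrightarrow> \<beta> = 0) \<and>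
       (\<forall>z. Im z \<noteq> 0 \<longrightarrow> F.Y (Js k) i z / F.Y (Js k) (\<pi> k) z = of_real \<beta> * z + of_real \<gamma> + ctrans \<tau> (F.Y (Js (Suc k)) i) z)"
    using F.representation[OF Js_subset[of k] _ \<pi>_le[of k] Js_notin[of k k]] k by (auto simp: Js_card Js_Suc)
  let ?f = "F.Y (Js (Suc k)) (\<pi> (Suc k))"
  have f: "real_continuous_off (\<Gamma> (Suc k)) ?f" "\<And>z. z \<notin> complex_of_real ` \<Gamma> (Suc k) \<Longrightarrow> ?f z \<noteq> 0"
    using Y_off[of "Suc k" "Suc k"] k by auto
  obtain a b where ab: "\<Gamma> k = {a..b}" using interval by blast
  have "\<exists>s'. concentrated_inf {a..b} s' \<and> (\<forall>g z. density_on {a..b} g \<longrightarrow> ctrans \<tau> (\<lambda>z. ?f z * g z) z = ctrans s' g z)"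
    by (rule absorb_density)
       (use \<tau> density_on_prev[OF f(1)] real_continuous_off_real[OF f(1)] f(2) off_next[of _ k] in \<open>auto simp: ab\<close>)
  then obtain r where r: "concentrated_inf (\<Gamma> k) r"
    and abs: "\<And>g z. density_on (\<Gamma> k) g \<Longrightarrow> ctrans \<tau> (\<lambda>z. ?f z * g z) z = ctrans r g z"
    unfolding ab by blast
  have "\<exists>\<beta> \<gamma> :: real. (\<beta> \<noteq> 0 \<longrightarrow> n (\<pi> i) < n (\<pi> k)) \<and>
    (\<forall>z. Im z \<noteq> 0 \<longrightarrow> Q k i z = of_real \<beta> * z + of_real \<gamma> + ctrans r (Q (Suc k) i) z)" if i: "i \<in> {k<..m}" for i
  proof -
    have ki: "Suc k \<le> i" "i \<le> m" "k < i" using i by auto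
    obtain \<beta> \<gamma> :: real where \<beta>: "\<pi> k < \<pi> i \<longrightarrow> \<beta> = 0"
      and eq: "\<And>z. Im z \<noteq> 0 \<Longrightarrow> Q k i z = of_real \<beta> * z + of_real \<gamma> + ctrans \<tau> (F.Y (Js (Suc k)) (\<pi> i)) z"
      using rep[OF \<pi>_le[OF ki(2)] Js_notin[of k i]] ki by (auto simp: \<pi>_inj Q_def)
    have dQ: "density_on (\<Gamma> k) (Q (Suc k) i)" by (rule Q_dens[OF ki(1,2)])
    have "ctrans \<tau> (F.Y (Js (Suc k)) (\<pi> i)) z = ctrans \<tau> (\<lambda>z. ?f z * Q (Suc k) i z) z" for z
    proof (rule ctrans_cong[OF concentrated_infD[OF \<tau>] compact_\<Gamma>])
      show "density_on (\<Gamma> k) (F.Y (Js (Suc k)) (\<pi> i))" by (rule density_on_prev[OF Y_off(1)[OF ki(1,2)]])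
      show "density_on (\<Gamma> k) (\<lambda>z. ?f z * Q (Suc k) i z)" by (intro density_on_mult density_on_prev f(1) dQ)
      fix x assume "x \<in> \<Gamma> k"
      then show "F.Y (Js (Suc k)) (\<pi> i) (of_real x) = ?f (of_real x) * Q (Suc k) i (of_real x)"
        using f(2)[OF off_next] by (simp add: Q_def)
    qed
    then have "Q k i z = of_real \<beta> * z + of_real \<gamma> + ctrans r (Q (Suc k) i) z" if "Im z \<noteq> 0" for z
      using eq[OF that] abs[OF dQ] by simp
    moreover have "\<beta> \<noteq> 0 \<longrightarrow> n (\<pi> i) < n (\<pi> k)"
      using \<beta> decreasing[OF ki(3,2)] by auto
    ultimately show ?thesis by blast
  qed
  then show ?thesis using r by blast
qed

text \<open>Iterates the relation of \<open>next_generator\<close>. A linear factor leaves the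
  transform at the cost of a real moment, which goes into the constant of the first term; hence the
  factors stay linear and never multiply.\<close>

lemma expansion:
  assumes \<rho>: "generator m \<Gamma> \<rho>"
    and step: "\<And>k i. k < i \<Longrightarrow> i \<le> m \<Longrightarrow> \<exists>\<beta> \<gamma> :: real. (\<beta> \<noteq> 0 \<longrightarrow> n (\<pi> i) < n (\<pi> k)) \<and>
      (\<forall>z. Im z \<noteq> 0 \<longrightarrow> Q k i z = of_real \<beta> * z + of_real \<gamma> + ctrans (\<rho> (Suc k)) (Q (Suc k) i) z)"
    and "k \<le> i" "i \<le> m"
  shows "\<exists>b1 b0 :: nat \<Rightarrow> real. (\<forall>l\<in>{k..i}. b1 l \<noteq> 0 \<longrightarrow> n (\<pi> i) < n (\<pi> l)) \<and>
    (\<forall>z. Im z \<noteq> 0 \<longrightarrow> Q k i z = (\<Sum>l=k..i. (of_real (b1 l) * z + of_real (b0 l)) * generator.hat \<rho> k l z))"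
  using assms(3,4)
proof (induction "i - k" arbitrary: k rule: less_induct)
  case less
  interpret R: generator m \<Gamma> \<rho> by (rule \<rho>)
  show ?case
  proof (cases "k = i")
    case True
    have "Q k i z = 1" if "Im z \<noteq> 0" for z
    proof -
      have "z \<notin> complex_of_real ` \<Gamma> k" using that by auto
      then show ?thesis using Y_off(2)[of k i z] less.prems True by (simp add: Q_def)
    qed
    then show ?thesis using True
      by (intro exI[of _ "\<lambda>_. 0"] exI[of _ "\<lambda>_. 1"]) (simp add: R.hat_def)
  next
    case False
    then have ki: "k < i" "Suc k \<le> i" "i \<le> m" using less.prems by auto
    obtain \<beta> \<gamma> :: real where \<beta>: "\<beta> \<noteq> 0 \<longrightarrow> n (\<pi> i) < n (\<pi> k)"
      and eq: "\<And>z. Im z \<noteq> 0 \<Longrightarrow> Q k i z = of_real \<beta> * z + of_real \<gamma> + ctrans (\<rho> (Suc k)) (Q (Suc k) i) z"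
      using step[OF ki(1,3)] by blast
    have "i - Suc k < i - k" using ki by simp
    from less.hyps[OF this ki(2,3)]
    obtain b1 b0 :: "nat \<Rightarrow> real" where b: "\<And>l. l \<in> {Suc k..i} \<Longrightarrow> b1 l \<noteq> 0 \<Longrightarrow> n (\<pi> i) < n (\<pi> l)"
      and Qeq: "\<And>z. Im z \<noteq> 0 \<Longrightarrow> Q (Suc k) i z = (\<Sum>l=Suc k..i. (of_real (b1 l) * z + of_real (b0 l)) * R.hat (Suc k) l z)"
      by blast
    have r: "concentrated (\<Gamma> k) (\<rho> (Suc k))" using R.meas[of k] ki by (auto dest: concentrated_infD)
    let ?U = "- (complex_of_real ` \<Gamma> (Suc k))"
    have op: "open ?U" using compact_imp_closed[OF compact_of_real_image[OF compact_\<Gamma>]] by (rule open_Compl)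
    have hc: "continuous_on ?U (R.hat (Suc k) l)" if "l \<in> {Suc k..i}" for l
      using R.hat_continuous[of "Suc k" l] that ki by simp
    have Qeq': "Q (Suc k) i z = (\<Sum>l=Suc k..i. (of_real (b1 l) * z + of_real (b0 l)) * R.hat (Suc k) l z)" if "z \<in> ?U" for z
    proof (rule agree_off_real[OF op _ _ _ that])
      show "continuous_on ?U (\<lambda>z. \<Sum>l=Suc k..i. (of_real (b1 l) * z + of_real (b0 l)) * R.hat (Suc k) l z)"
        by (intro continuous_intros hc)
    qed (use Q_continuous[OF ki(2,3)] Qeq in auto)
    have hd: "density_on (\<Gamma> k) (R.hat (Suc k) l)" if "l \<in> {Suc k..i}" for l
      using R.hat_dens[of k l] that ki by simp
    have td: "density_on (\<Gamma> k) (\<lambda>z. (of_real (b1 l) * z + of_real (b0 l)) * R.hat (Suc k) l z)" if "l \<in> {Suc k..i}" for l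
      by (intro density_on_mult density_on_add density_on_const density_on_ident hd that)
    have "sm_integral (\<rho> (Suc k)) (\<lambda>x. R.hat (Suc k) l (of_real x)) \<in> \<real>" if "l \<in> {Suc k..i}" for l
      using that ki R.hat_real[of "Suc k" l] by (intro sm_integral_real[OF r compact_\<Gamma> hd[OF that]]) auto
    then have "\<forall>l\<in>{Suc k..i}. \<exists>s. sm_integral (\<rho> (Suc k)) (\<lambda>x. R.hat (Suc k) l (of_real x)) = of_real s"
      by (meson Reals_cases)
    from bchoice[OF this] obtain S
      where S: "\<And>l. l \<in> {Suc k..i} \<Longrightarrow> sm_integral (\<rho> (Suc k)) (\<lambda>x. R.hat (Suc k) l (of_real x)) = of_real (S l)"
      by blast
    define b1' where "b1' l = (if l = k then \<beta> else b1 l)" for l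
    define b0' where "b0' l = (if l = k then \<gamma> - (\<Sum>l=Suc k..i. b1 l * S l) else b0 l)" for l
    have "Q k i z = (\<Sum>l=k..i. (of_real (b1' l) * z + of_real (b0' l)) * R.hat k l z)" if z: "Im z \<noteq> 0" for z
    proof -
      have zn: "z \<notin> complex_of_real ` \<Gamma> k" using z by auto
      note sum = ctrans_sum[OF r compact_\<Gamma> zn finite_atLeastAtMost, of "Suc k" i "\<lambda>l z. (of_real (b1 l) * z + of_real (b0 l)) * R.hat (Suc k) l z", OF td]
      have "ctrans (\<rho> (Suc k)) (Q (Suc k) i) z = ctrans (\<rho> (Suc k)) (\<lambda>z. \<Sum>l=Suc k..i. (of_real (b1 l) * z + of_real (b0 l)) * R.hat (Suc k) l z) z"
        by (rule ctrans_cong[OF r compact_\<Gamma> Q_dens[OF ki(2,3)]]) (use sum Qeq' off_next in auto)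
      also have "\<dots> = (\<Sum>l=Suc k..i. ctrans (\<rho> (Suc k)) (\<lambda>z. (of_real (b1 l) * z + of_real (b0 l)) * R.hat (Suc k) l z) z)"
        using sum by blast
      also have "\<dots> = (\<Sum>l=Suc k..i. (of_real (b1 l) * z + of_real (b0 l)) * R.hat k l z - of_real (b1 l * S l))"
      proof (rule sum.cong[OF refl])
        fix l assume l: "l \<in> {Suc k..i}"
        have "R.hat k l z = ctrans (\<rho> (Suc k)) (R.hat (Suc k) l) z" using l ki by (intro R.hat_ct) auto
        then show "ctrans (\<rho> (Suc k)) (\<lambda>z. (of_real (b1 l) * z + of_real (b0 l)) * R.hat (Suc k) l z) z =
            (of_real (b1 l) * z + of_real (b0 l)) * R.hat k l z - of_real (b1 l * S l)"
          using ctrans_linear_mult[OF r compact_\<Gamma> hd[OF l] zn] S[OF l] by simp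
      qed
      also have "\<dots> = (\<Sum>l=Suc k..i. (of_real (b1 l) * z + of_real (b0 l)) * R.hat k l z) - of_real (\<Sum>l=Suc k..i. b1 l * S l)"
        by (simp add: sum_subtractf)
      finally have 1: "Q k i z = of_real \<beta> * z + of_real (\<gamma> - (\<Sum>l=Suc k..i. b1 l * S l)) +
          (\<Sum>l=Suc k..i. (of_real (b1 l) * z + of_real (b0 l)) * R.hat k l z)"
        using eq[OF z] by simp
      have 2: "(\<Sum>l=Suc k..i. (of_real (b1' l) * z + of_real (b0' l)) * R.hat k l z) =
          (\<Sum>l=Suc k..i. (of_real (b1 l) * z + of_real (b0 l)) * R.hat k l z)"
        by (rule sum.cong) (auto simp: b1'_def b0'_def)
      show ?thesis
        unfolding sum.atLeast_Suc_atMost[OF less_imp_le[OF ki(1)]] 1 2 by (simp add: b1'_def b0'_def R.hat_def)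
    qed
    moreover have "\<forall>l\<in>{k..i}. b1' l \<noteq> 0 \<longrightarrow> n (\<pi> i) < n (\<pi> l)"
      using \<beta> b by (auto simp: b1'_def)
    ultimately show ?thesis by blast
  qed
qed

end

section \<open>Linear factors of real polynomials\<close>

lemma coeff_times_linear:
  "coeff (p * [:b0, b1:]) i = b0 * coeff p i + (if i = 0 then 0 else b1 * coeff p (i - 1))"
  for p :: "real poly"
  by (cases i) (simp_all add: mult.commute[of p])

lemma cpoly_sum: "cpoly (\<Sum>k\<in>A. p k) z = (\<Sum>k\<in>A. cpoly (p k) z)"
proof (induction A rule: infinite_finite_induct)
  case (insert k A)
  have "map_poly complex_of_real (p k + sum p A) = map_poly complex_of_real (p k) + map_poly complex_of_real (sum p A)"
    by (rule poly_eqI) (simp add: coeff_map_poly)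
  then show ?case using insert by simp
qed simp_all

lemma cpoly_times_linear: "cpoly (p * [:b0, b1:]) z = cpoly p z * (of_real b1 * z + of_real b0)"
proof -
  have "map_poly complex_of_real (p * [:b0, b1:]) =
      smult (of_real b0) (map_poly complex_of_real p) + pCons 0 (smult (of_real b1) (map_poly complex_of_real p))"
    by (rule poly_eqI) (simp add: coeff_map_poly coeff_pCons split: nat.split)
  then show ?thesis by (simp add: algebra_simps)
qed

theorem theorem1p3:
  fixes m :: nat and \<sigma> :: "nat \<Rightarrow> sgn_measure" and n :: "nat \<Rightarrow> nat"
  assumes "nikishin_generator m \<sigma>"
  shows "\<exists>\<pi> \<rho>. \<pi> permutes {0..m} \<and>
      (\<forall>i j. i \<le> j \<longrightarrow> j \<le> m \<longrightarrow> n (\<pi> j) \<le> n (\<pi> i)) \<and>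
      nikishin_generator m \<rho> \<and>
      (\<forall>p :: nat \<Rightarrow> real poly. (\<forall>k\<in>{0..m}. deg_le (p k) (int (n k) - 1)) \<longrightarrow>
        (\<exists>q :: nat \<Rightarrow> real poly. (\<forall>k\<in>{0..m}. deg_le (q k) (int (n (\<pi> k)) - 1)) \<and>
          (\<forall>z \<in> nikishin_domain m \<sigma> \<inter> nikishin_domain m \<rho>.
             cpoly (p 0) z + (\<Sum>k=1..m. cpoly (p k) z * nikishin_hat \<sigma> k z) =
             (cpoly (q 0) z + (\<Sum>k=1..m. cpoly (q k) z * nikishin_hat \<rho> k z)) *
               nikishin_hat \<sigma> (\<pi> 0) z)))"
proof -
  obtain \<Gamma> where \<Gamma>: "generator m \<Gamma> \<sigma>" using generator_of_nikishin[OF assms] by blast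
  interpret S: generator m \<Gamma> \<sigma> by (rule \<Gamma>)
  obtain \<pi> where \<pi>: "\<pi> permutes {0..m}"
    and dec: "\<And>i j. i < j \<Longrightarrow> j \<le> m \<Longrightarrow> n (\<pi> j) < n (\<pi> i) \<or> n (\<pi> j) = n (\<pi> i) \<and> \<pi> i < \<pi> j"
    by (rule stable_decreasing_permutation[of m n]) blast
  interpret F: flag_system m \<Gamma> S.hat "\<lambda>r. \<sigma> (Suc r)" by (rule S.flag)
  interpret O: reordering m \<Gamma> \<sigma> \<pi> n
    by standard (use \<pi> dec in auto)
  define ok where "ok k r \<longleftrightarrow> concentrated_inf (\<Gamma> k) r \<and> (\<forall>i\<in>{k<..m}. \<exists>\<beta> \<gamma> :: real. (\<beta> \<noteq> 0 \<longrightarrow> n (\<pi> i) < n (\<pi> k)) \<and>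
    (\<forall>z. Im z \<noteq> 0 \<longrightarrow> O.Q k i z = of_real \<beta> * z + of_real \<gamma> + ctrans r (O.Q (Suc k) i) z))" for k r
  have "\<exists>r. k < m \<longrightarrow> ok k r" for k using O.next_generator[of k] unfolding ok_def by blast
  then obtain r where r: "\<And>k. k < m \<Longrightarrow> ok k (r k)" by metis
  define \<rho> where "\<rho> j = r (j - 1)" for j
  have \<rho>: "generator m \<Gamma> \<rho>"
    by standard (use S.interval S.disjoint r in \<open>auto simp: ok_def \<rho>_def\<close>)
  interpret R: generator m \<Gamma> \<rho> by (rule \<rho>)
  have mono: "n (\<pi> j) \<le> n (\<pi> i)" if "i \<le> j" "j \<le> m" for i j
    using dec[of i j] that by (cases "i = j") auto
  \<comment> \<open>Slope and constant are paired, so that one choice over \<open>k\<close> provides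
    both.\<close>
  have "\<forall>k\<in>{..m}. \<exists>f :: nat \<Rightarrow> real \<times> real. (\<forall>l\<in>{0..k}. fst (f l) \<noteq> 0 \<longrightarrow> n (\<pi> k) < n (\<pi> l)) \<and>
    (\<forall>z. Im z \<noteq> 0 \<longrightarrow> O.Q 0 k z = (\<Sum>l=0..k. (of_real (fst (f l)) * z + of_real (snd (f l))) * R.hat 0 l z))"
  proof
    fix k assume "k \<in> {..m}"
    then have k: "0 \<le> k" "k \<le> m" by auto
    have "\<exists>b1 b0 :: nat \<Rightarrow> real. (\<forall>l\<in>{0..k}. b1 l \<noteq> 0 \<longrightarrow> n (\<pi> k) < n (\<pi> l)) \<and>
      (\<forall>z. Im z \<noteq> 0 \<longrightarrow> O.Q 0 k z = (\<Sum>l=0..k. (of_real (b1 l) * z + of_real (b0 l)) * R.hat 0 l z))"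
      by (rule O.expansion[OF \<rho> _ k]) (use r in \<open>auto simp: ok_def \<rho>_def\<close>)
    then obtain b1 b0 :: "nat \<Rightarrow> real" where "\<forall>l\<in>{0..k}. b1 l \<noteq> 0 \<longrightarrow> n (\<pi> k) < n (\<pi> l)"
      "\<forall>z. Im z \<noteq> 0 \<longrightarrow> O.Q 0 k z = (\<Sum>l=0..k. (of_real (b1 l) * z + of_real (b0 l)) * R.hat 0 l z)" by blast
    then show "\<exists>f :: nat \<Rightarrow> real \<times> real. (\<forall>l\<in>{0..k}. fst (f l) \<noteq> 0 \<longrightarrow> n (\<pi> k) < n (\<pi> l)) \<and>
      (\<forall>z. Im z \<noteq> 0 \<longrightarrow> O.Q 0 k z = (\<Sum>l=0..k. (of_real (fst (f l)) * z + of_real (snd (f l))) * R.hat 0 l z))"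
      by (intro exI[of _ "\<lambda>l. (b1 l, b0 l)"]) simp
  qed
  from bchoice[OF this] obtain f :: "nat \<Rightarrow> nat \<Rightarrow> real \<times> real"
    where f: "\<And>k. k \<in> {..m} \<Longrightarrow> (\<forall>l\<in>{0..k}. fst (f k l) \<noteq> 0 \<longrightarrow> n (\<pi> k) < n (\<pi> l)) \<and>
    (\<forall>z. Im z \<noteq> 0 \<longrightarrow> O.Q 0 k z = (\<Sum>l=0..k. (of_real (fst (f k l)) * z + of_real (snd (f k l))) * R.hat 0 l z))"
    by blast
  define b1 b0 where "b1 k l = fst (f k l)" and "b0 k l = snd (f k l)" for k l
  have b: "n (\<pi> k) < n (\<pi> l)" if "k \<le> m" "l \<le> k" "b1 k l \<noteq> 0" for k l
    using f[of k] that by (auto simp: b1_def)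
  have Q: "O.Q 0 k z = (\<Sum>l=0..k. (of_real (b1 k l) * z + of_real (b0 k l)) * R.hat 0 l z)" if "k \<le> m" "Im z \<noteq> 0" for k z
    using f[of k] that by (simp add: b1_def b0_def)
  \<comment> \<open>No column is eliminated at level 0, so \<open>Q 0 k\<close> is a quotient of two
    original transforms.\<close>
  have hat: "S.hat 0 (\<pi> k) z = (\<Sum>l=0..k. (of_real (b1 k l) * z + of_real (b0 k l)) * R.hat 0 l z) * S.hat 0 (\<pi> 0) z"
    if k: "k \<le> m" and z: "Im z \<noteq> 0" for k z
  proof -
    have Y: "F.Y (O.Js 0) i z = S.hat 0 i z" for i
      using F.Y_nonreal[OF z] by (simp add: O.Js_def F.Y0_def elim_base[of _ 0, simplified])
    have "z \<notin> complex_of_real ` \<Gamma> 0" using z by auto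
    then have "S.hat 0 (\<pi> 0) z \<noteq> 0" using O.Y_off(2)[of 0 0 z] by (simp add: Y)
    then show ?thesis using Q[OF k z] by (simp add: O.Q_def Y field_simps)
  qed
  show ?thesis
  proof (intro exI[of _ \<pi>] exI[of _ \<rho>] conjI allI impI)
    show "\<pi> permutes {0..m}" by (rule \<pi>)
    show "nikishin_generator m \<rho>" by (rule R.nikishin_generator)
    show "i \<le> j \<Longrightarrow> j \<le> m \<Longrightarrow> n (\<pi> j) \<le> n (\<pi> i)" for i j by (rule mono)
    fix p :: "nat \<Rightarrow> real poly"
    assume p: "\<forall>k\<in>{0..m}. deg_le (p k) (int (n k) - 1)"
    \<comment> \<open>Collects the coefficients of the transform with index \<open>l\<close>. The
      factor is truly linear only if \<open>n (\<pi> k) < n (\<pi> l)\<close>, which leaves room for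
      the extra degree.\<close>
    define q where "q l = (\<Sum>k=l..m. p (\<pi> k) * [:b0 k l, b1 k l:])" for l
    have "deg_le (q l) (int (n (\<pi> l)) - 1)" if l: "l \<in> {0..m}" for l
      unfolding deg_le_coeff
    proof (intro allI impI)
      fix i assume i: "n (\<pi> l) \<le> i"
      have "coeff (p (\<pi> k) * [:b0 k l, b1 k l:]) i = 0" if k: "k \<in> {l..m}" for k
      proof -
        have "\<pi> k \<in> {0..m}" using O.\<pi>_le[of k] k by simp
        then have pk: "coeff (p (\<pi> k)) i' = 0" if "n (\<pi> k) \<le> i'" for i'
          using p that unfolding deg_le_coeff by blast
        have 1: "coeff (p (\<pi> k)) i = 0" using mono[of l k] k i by (intro pk) simp
        have 2: "b1 k l * coeff (p (\<pi> k)) (i - 1) = 0" if "i \<noteq> 0"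
        proof (cases "b1 k l = 0")
          case False
          then have "n (\<pi> k) < n (\<pi> l)" using b[of k l] k by simp
          then have "coeff (p (\<pi> k)) (i - 1) = 0" using i that by (intro pk) simp
          then show ?thesis by simp
        qed simp
        show ?thesis unfolding coeff_times_linear using 1 2 by simp
      qed
      then show "coeff (q l) i = 0" by (simp add: q_def coeff_sum)
    qed
    moreover have "cpoly (p 0) z + (\<Sum>k=1..m. cpoly (p k) z * nikishin_hat \<sigma> k z) =
             (cpoly (q 0) z + (\<Sum>k=1..m. cpoly (q k) z * nikishin_hat \<rho> k z)) * nikishin_hat \<sigma> (\<pi> 0) z"
      if "z \<in> nikishin_domain m \<sigma> \<inter> nikishin_domain m \<rho>" for z
    \<comment> \<open>The computation is made at nonreal points; continuity of both sides extends it
      to the whole domain, real points included.\<close>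
    proof (rule agree_off_real[OF _ _ _ _ that])
      let ?D = "nikishin_domain m \<sigma> \<inter> nikishin_domain m \<rho>"
      show "open ?D" using S.open_domain R.open_domain by (rule open_Int)
      have cS: "continuous_on ?D (nikishin_hat \<sigma> k)" if "k \<le> m" for k
        by (rule continuous_on_subset[OF S.nikishin_hat_continuous[OF that]]) simp
      have cR: "continuous_on ?D (nikishin_hat \<rho> k)" if "k \<le> m" for k
        by (rule continuous_on_subset[OF R.nikishin_hat_continuous[OF that]]) simp
      show "continuous_on ?D (\<lambda>z. cpoly (p 0) z + (\<Sum>k=1..m. cpoly (p k) z * nikishin_hat \<sigma> k z))"
        by (intro continuous_intros cS) auto
      show "continuous_on ?D (\<lambda>z. (cpoly (q 0) z + (\<Sum>k=1..m. cpoly (q k) z * nikishin_hat \<rho> k z)) * nikishin_hat \<sigma> (\<pi> 0) z)"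
        by (intro continuous_intros cS cR O.\<pi>_le) auto
      fix z :: complex assume z: "Im z \<noteq> 0"
      have zero: "nikishin_hat s 0 z = 1" for s by (simp add: nikishin_hat_def)
      have "cpoly (p 0) z + (\<Sum>k=1..m. cpoly (p k) z * nikishin_hat \<sigma> k z) = (\<Sum>k=0..m. cpoly (p k) z * nikishin_hat \<sigma> k z)"
        by (simp add: sum.atLeast_Suc_atMost[of 0] zero)
      also have "\<dots> = (\<Sum>k=0..m. cpoly (p (\<pi> k)) z * nikishin_hat \<sigma> (\<pi> k) z)"
        by (rule sum.permute[OF \<pi>, unfolded comp_def])
      also have "\<dots> = (\<Sum>k=0..m. \<Sum>l=0..k. cpoly (p (\<pi> k)) z * (of_real (b1 k l) * z + of_real (b0 k l)) * R.hat 0 l z) * S.hat 0 (\<pi> 0) z"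
        unfolding sum_distrib_right
      proof (rule sum.cong[OF refl])
        fix k assume "k \<in> {0..m}"
        then have k: "k \<le> m" by simp
        show "cpoly (p (\<pi> k)) z * nikishin_hat \<sigma> (\<pi> k) z =
          (\<Sum>l=0..k. cpoly (p (\<pi> k)) z * (of_real (b1 k l) * z + of_real (b0 k l)) * R.hat 0 l z * S.hat 0 (\<pi> 0) z)"
          unfolding S.nikishin_hat_eq[OF O.\<pi>_le[OF k]] hat[OF k z] by (simp add: sum_distrib_left sum_distrib_right mult.assoc)
      qed
      also have "(\<Sum>k=0..m. \<Sum>l=0..k. cpoly (p (\<pi> k)) z * (of_real (b1 k l) * z + of_real (b0 k l)) * R.hat 0 l z) =
          (\<Sum>l=0..m. \<Sum>k=l..m. cpoly (p (\<pi> k)) z * (of_real (b1 k l) * z + of_real (b0 k l)) * R.hat 0 l z)"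
        unfolding sum.Sigma[of "{0..m}", OF finite_atLeastAtMost ballI[OF finite_atLeastAtMost]]
        by (rule sum.reindex_bij_witness[of _ "\<lambda>(l, k). (k, l)" "\<lambda>(k, l). (l, k)"]) auto
      also have "\<dots> = (\<Sum>l=0..m. cpoly (q l) z * nikishin_hat \<rho> l z)"
      proof (rule sum.cong[OF refl])
        fix l assume "l \<in> {0..m}"
        then show "(\<Sum>k=l..m. cpoly (p (\<pi> k)) z * (of_real (b1 k l) * z + of_real (b0 k l)) * R.hat 0 l z) = cpoly (q l) z * nikishin_hat \<rho> l z"
          unfolding q_def cpoly_sum cpoly_times_linear by (simp add: R.nikishin_hat_eq sum_distrib_right)
      qed
      also have "\<dots> = cpoly (q 0) z + (\<Sum>k=1..m. cpoly (q k) z * nikishin_hat \<rho> k z)"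
        by (simp add: sum.atLeast_Suc_atMost[of 0] zero)
      finally show "cpoly (p 0) z + (\<Sum>k=1..m. cpoly (p k) z * nikishin_hat \<sigma> k z) =
          (cpoly (q 0) z + (\<Sum>k=1..m. cpoly (q k) z * nikishin_hat \<rho> k z)) * nikishin_hat \<sigma> (\<pi> 0) z"
        using O.\<pi>_le[of 0] by (simp add: S.nikishin_hat_eq)
    qed
    ultimately show "\<exists>q :: nat \<Rightarrow> real poly. (\<forall>k\<in>{0..m}. deg_le (q k) (int (n (\<pi> k)) - 1)) \<and>
          (\<forall>z \<in> nikishin_domain m \<sigma> \<inter> nikishin_domain m \<rho>.
             cpoly (p 0) z + (\<Sum>k=1..m. cpoly (p k) z * nikishin_hat \<sigma> k z) =
             (cpoly (q 0) z + (\<Sum>k=1..m. cpoly (q k) z * nikishin_hat \<rho> k z)) *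
               nikishin_hat \<sigma> (\<pi> 0) z)" by blast
  qed
qed

end
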